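(* Consider the estimation of a probability density $\pi$ relative to a finite measure $\nu$ on a measurable space $(T,\mathcal{T})$, based on observations $X_1,\dots,X_n\mid\pi\stackrel{iid}{\sim}\pi$, with prior on $\pi$ given by the law of $$\pi(x)=\frac{e^{W(x)}}{\int_Te^{W(y)}d\nu(y)},\qquad x\in T.$$ Let $W$ be a $p$-exponential random element ($p\in[1,2]$) in a separable Banach subspace of $L_\infty(T)$ possessing a Schauder basis, which is almost surely continuous. Assume $w_0=\log\pi_0$ belongs to the support of $W$ and denote by $P^n_0$ the corresponding distribution of the vector $(X_1,\dots,X_n)$ (i.i.d. from $\pi_0$). Let $f,g:\mathbb{R}_{>0}\to\mathbb{R}_{>0}$ be respectively non-decreasing and non-increasing functions such that for all $\epsilon,a>0$ and $h\in aB_{\mathcal{Q}}$ $$\inf_{x\in\mathcal{Z}:\|x-h\|_{L_\infty}\le\epsilon}\|x\|_{\mathcal{Z}}^p\le f(a)g(\epsilon)^{1-\frac p2},$$ and such that, as $a\to\infty$, $f(a)$ grows at most polynomially to infinity. Let $\epsilon_n$ satisfy $\varphi_{w_0}(\epsilon_n)\le n\epsilon_n^2$ with respect to $\|\cdot\|_{L_\infty}$, and let $\tilde\epsilon_n>0$ satisfy $f(n^{\frac12}\epsilon_n)g(\epsilon_n)^{1-\frac p2}\lesssim n\tilde\epsilon_n^2$. Then, for some sufficiently large constant $M$, $$\Pi_n\left(\pi:d_H(\pi,\pi_0)>M(\epsilon_n\vee\tilde\epsilon_n)\mid X_1,\dots,X_n\right)\to0\quad\text{in }P^n_0\text{-p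robability}.$$
   Context: $T$ carries a topology so that continuity of $W$ makes sense; $\Pi_n(\cdot\mid X_1,\dots,X_n)$ is the posterior distribution on $\pi$; $d_H(\pi,\pi')=\left(\int(\sqrt\pi-\sqrt{\pi'})^2d\nu\right)^{1/2}$ is the Hellinger distance. Let $p\in[1,2]$, let $\gamma=(\gamma_\ell)_{\ell\in\mathbb{N}}$ be a deterministic decaying sequence of positive reals, and let $\xi_\ell$ be i.i.d. real random variables with density proportional to $\exp(-|x|^p/p)$. A $p$-exponential random element in a separable Banach space $X$ with Schauder basis $\{\psi_\ell\}$ is $W=\sum_\ell\gamma_\ell\xi_\ell\psi_\ell$, where the scaling sequence is such that the series a.s. defines an element of $X$; its law $\mu$ is a $p$-exponential measure in $X$. Here $X\subset L_\infty(T)$ with norm $\|\cdot\|_{L_\infty}$. Sequences $(h_\ell)$ are identified with $\sum_\ell h_\ell\psi_\ell$. Define $\mathcal{Q}=\{h:\|h\|_{\mathcal{Q}}^2=\sum_\ell h_\ell^2\gamma_\ell^{-2}<\infty\}$ and $\mathcal{Z}=\{h:\|h\|_{\mathcal{Z}}^p=\sum_\ell|h_\ell|^p\gamma_\ell^{-p}<\infty\}$, regarded as subspaces of $X$; $B_Y$ is the closed unit ball of a normed space $Y$. The concentration function with respect to $\|\cdot\|_X$ is $\varphi_w(\epsilon)=\inf_{h\in\mathcal{Z}:\|h-w\|_X\le\epsilon}\frac1p\|h\|_{\mathcal{Z}}^p-\log\mu(\epsilon B_X)$. $a_n\lesssim b_n$ means $a_n/b_n$ is bounded; $a\vee b=\max\{a,b\}$.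 *)

theory Defs
  imports "HOL-Probability.Probability" "HOL-Library.Landau_Symbols"
begin

text \<open>A Banach subspace \<open>X\<close> of \<open>L\<^sub>\<infinity>(T)\<close>, with \<open>T = space \<nu>\<close>, is a Banach space type \<open>'x\<close>
  together with the map \<open>J\<close> sending each element to the bounded measurable function on \<open>T\<close> that
  it is. The norm of \<open>L\<^sub>\<infinity>(T)\<close> is the supremum norm, so that \<open>J v x\<close> is meaningful for every
  \<open>x \<in> T\<close>. Values \<open>J v x\<close> with \<open>x \<notin> T\<close> are irrelevant. For a metric space, separability is
  \<open>second_countable_topology\<close>.\<close>

definition Linf_subspace :: "'a measure \<Rightarrow> ('x::real_normed_vector \<Rightarrow> 'a \<Rightarrow> real) \<Rightarrow> bool" where
  "Linf_subspace \<nu> J \<longleftrightarrow>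
     (\<forall>x\<in>space \<nu>. linear (\<lambda>v. J v x)) \<and>
     (\<forall>v. J v \<in> borel_measurable \<nu>) \<and>
     (\<forall>v. bdd_above ((\<lambda>x. \<bar>J v x\<bar>) ` space \<nu>) \<and> norm v = (SUP x\<in>space \<nu>. \<bar>J v x\<bar>))"

definition schauder_basis :: "(nat \<Rightarrow> 'x::real_normed_vector) \<Rightarrow> bool" where
  "schauder_basis \<psi> \<longleftrightarrow> (\<forall>v. \<exists>!c. (\<lambda>l. c l *\<^sub>R \<psi> l) sums v)"

definition coef :: "(nat \<Rightarrow> 'x::real_normed_vector) \<Rightarrow> 'x \<Rightarrow> nat \<Rightarrow> real" where
  "coef \<psi> v = (THE c. (\<lambda>l. c l *\<^sub>R \<psi> l) sums v)"

definition p_exp_density :: "real \<Rightarrow> real \<Rightarrow> real" where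
  "p_exp_density p x =
     exp (- (\<bar>x\<bar> powr p) / p) / (\<integral>y. exp (- (\<bar>y\<bar> powr p) / p) \<partial>lborel)"

definition p_exponential_element ::
  "real \<Rightarrow> (nat \<Rightarrow> real) \<Rightarrow> (nat \<Rightarrow> 'x::real_normed_vector) \<Rightarrow> 'w measure \<Rightarrow> ('w \<Rightarrow> 'x) \<Rightarrow> bool" where
  "p_exponential_element p \<gamma> \<psi> P W \<longleftrightarrow>
     (\<forall>l. 0 < \<gamma> l) \<and> \<gamma> \<longlonglongrightarrow> 0 \<and>
     W \<in> borel_measurable P \<and>
     (\<exists>\<xi>. prob_space.indep_vars P (\<lambda>_. borel) \<xi> UNIV \<and>
          (\<forall>l. distributed P lborel (\<xi> l) (\<lambda>x. ennreal (p_exp_density p x))) \<and>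
          (AE \<omega> in P. (\<lambda>l. (\<gamma> l * \<xi> l \<omega>) *\<^sub>R \<psi> l) sums W \<omega>))"

definition Q_space :: "(nat \<Rightarrow> real) \<Rightarrow> (nat \<Rightarrow> 'x::real_normed_vector) \<Rightarrow> 'x set" where
  "Q_space \<gamma> \<psi> = {h. summable (\<lambda>l. (coef \<psi> h l)\<^sup>2 * \<gamma> l powr (-2))}"

definition Q_norm :: "(nat \<Rightarrow> real) \<Rightarrow> (nat \<Rightarrow> 'x::real_normed_vector) \<Rightarrow> 'x \<Rightarrow> real" where
  "Q_norm \<gamma> \<psi> h = sqrt (\<Sum>l. (coef \<psi> h l)\<^sup>2 * \<gamma> l powr (-2))"

definition Z_space :: "real \<Rightarrow> (nat \<Rightarrow> real) \<Rightarrow> (nat \<Rightarrow> 'x::real_normed_vector) \<Rightarrow> 'x set" where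
  "Z_space p \<gamma> \<psi> = {h. summable (\<lambda>l. \<bar>coef \<psi> h l\<bar> powr p * \<gamma> l powr (-p))}"

definition Z_norm :: "real \<Rightarrow> (nat \<Rightarrow> real) \<Rightarrow> (nat \<Rightarrow> 'x::real_normed_vector) \<Rightarrow> 'x \<Rightarrow> real" where
  "Z_norm p \<gamma> \<psi> h = (\<Sum>l. \<bar>coef \<psi> h l\<bar> powr p * \<gamma> l powr (-p)) powr (1 / p)"

text \<open>The concentration function is extended-real valued: an infimum over the empty set and
  \<open>- log 0\<close> are both \<open>\<infinity>\<close>, whereas \<open>ln 0 = 0\<close> in the library.\<close>

definition concentration_function ::
  "real \<Rightarrow> (nat \<Rightarrow> real) \<Rightarrow> (nat \<Rightarrow> 'x::real_normed_vector) \<Rightarrow> 'x measure \<Rightarrow> 'x \<Rightarrow> real \<Rightarrow> ereal" where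
  "concentration_function p \<gamma> \<psi> \<mu> w \<epsilon> =
     (INF h\<in>{h \<in> Z_space p \<gamma> \<psi>. norm (h - w) \<le> \<epsilon>}. ereal (1 / p * Z_norm p \<gamma> \<psi> h powr p)) +
     (if measure \<mu> (cball 0 \<epsilon>) = 0 then \<infinity> else ereal (- ln (measure \<mu> (cball 0 \<epsilon>))))"

definition measure_support :: "'x::metric_space measure \<Rightarrow> 'x set" where
  "measure_support \<mu> = {w. \<forall>\<epsilon>>0. 0 < emeasure \<mu> (ball w \<epsilon>)}"

definition exp_normalized :: "'a measure \<Rightarrow> ('a \<Rightarrow> real) \<Rightarrow> 'a \<Rightarrow> real" where
  "exp_normalized \<nu> v x = exp (v x) / (\<integral>y. exp (v y) \<partial>\<nu>)"

definition hellinger_dist :: "'a measure \<Rightarrow> ('a \<Rightarrow> real) \<Rightarrow> ('a \<Rightarrow> real) \<Rightarrow> real" where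
  "hellinger_dist \<nu> \<pi> \<pi>' = sqrt (\<integral>x. (sqrt (\<pi> x) - sqrt (\<pi>' x))\<^sup>2 \<partial>\<nu>)"

text \<open>The law of a random function, on the finest sigma-algebra for which it is measurable.
  When \<open>\<Phi> = exp_normalized \<nu> \<circ> J \<circ> W\<close>, that sigma-algebra contains the Hellinger balls and makes
  every evaluation at a point of \<open>T\<close> measurable.\<close>

definition law_of :: "'w measure \<Rightarrow> ('w \<Rightarrow> 'a \<Rightarrow> real) \<Rightarrow> ('a \<Rightarrow> real) measure" where
  "law_of P \<Phi> = distr P (sigma UNIV {B. \<Phi> -` B \<inter> space P \<in> sets P}) \<Phi>"

text \<open>Bayes' formula for the observations \<open>x 0, \<dots>, x (n - 1)\<close>.\<close>

definition posterior :: "('a \<Rightarrow> real) measure \<Rightarrow> nat \<Rightarrow> (nat \<Rightarrow> 'a) \<Rightarrow> ('a \<Rightarrow> real) measure" where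
  "posterior R n x =
     density R (\<lambda>\<pi>. (\<Prod>i<n. ennreal (\<pi> (x i))) / (\<integral>\<^sup>+\<rho>. (\<Prod>i<n. ennreal (\<rho> (x i))) \<partial>R))"

definition sample_law :: "'a measure \<Rightarrow> ('a \<Rightarrow> real) \<Rightarrow> nat \<Rightarrow> (nat \<Rightarrow> 'a) measure" where
  "sample_law \<nu> \<pi> n = PiM {..<n} (\<lambda>_. density \<nu> (\<lambda>x. ennreal (\<pi> x)))"

definition tendsto_zero_in_prob :: "(nat \<Rightarrow> 's measure) \<Rightarrow> (nat \<Rightarrow> 's \<Rightarrow> real) \<Rightarrow> bool" where
  "tendsto_zero_in_prob P Y \<longleftrightarrow>
     (\<forall>\<delta>>0. (\<lambda>n. measure (P n) {s \<in> space (P n). \<bar>Y n s\<bar> > \<delta>}) \<longlonglongrightarrow> 0)"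

end

(*
  The usual three ingredients of a posterior contraction proof are prior mass near w0, a sieve of
  large prior mass, and a small entropy of the sieve.

  Prior mass: the density proportional to exp(-|x|^p/p) satisfies f(x-h) f(x+h) >= exp(-2|h|^p/p) f(x)^2
  (Clarkson's inequality), whence the shift inequality P(|W - h| < 2e) >= exp(-|h|_Z^p/p) P(|W| <= e).

  Sieve: Talagrand's two-level concentration inequality for A + sqrt(r) B_Q + r^(1/p) B_Z. It follows
  from Maurey's property tau, which tensorizes, so it is needed only on the real line, where the
  p-exponential law is the image of the logistic law under a map T with
  |T x - T y| <= C min(|x - y|, |x - y|^(1/p)). For the logistic law property tau is proved by a
  transport argument of Prekopa-Leindler type, interpolating x and y by
  arsinh(sinh((x+y)/2) / cosh((x-y)/4)) instead of their midpoint: the midpoint does not work since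
  the potential is asymptotically linear, and this interpolation is pulled towards 0.

  Entropy: the hypothesis on f and g replaces B_Q by multiples of B_Z, and a Z-ball has a small net by
  the shift inequality and packing.

  Likelihoods: all densities involved have ratios bounded through the sup norm, so chi-square
  divergences control the evidence and likelihood ratio tests at the centres of a sup norm net are
  uniformly powerful. The hypotheses force n eps_n^2 to infinity, because the prior has no atom at 0;
  where the rate is not small the bound is trivial, Hellinger distances being at most sqrt 2.
*)
theory Submission
  imports Defs
begin

section \<open>The logistic distribution\<close>

text \<open>For p < 2 the prior is not Gaussian, and the substitutes for the Cameron-Martin formula
  and for isoperimetry lose constants. The shift inequality doubles a radius. Property tau bounds
  only the product of the masses of a small ball and of the complement of the sieve, so the small
  ball mass exp(-n eps_n^2) has to be divided out. The evidence bound costs a further exp(288 n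
  eps_n^2). All this is absorbed by taking the level of the sieve to be a large multiple of n
  eps_n^2; for this reason the entropy bound has to reach Q-balls larger than the radius sqrt(n)
  eps_n at which the rate condition evaluates f.

  Both prior inequalities are proved for finitely many independent coordinates and carried to W
  along the almost surely convergent series. Ball probabilities pass to the limit only with some
  slack, so each transfer enlarges a radius.\<close>

definition logistic_cdf :: "real \<Rightarrow> real" where
  "logistic_cdf x = 1 / (1 + exp (- x))"

text \<open>The usual exp(-x) / (1 + exp(-x))^2, written with \<open>cosh\<close> so that the
  addition theorems apply to products of densities.\<close>

definition logistic_density :: "real \<Rightarrow> real" where
  "logistic_density x = 1 / (2 * (cosh x + 1))"

lemma logistic_density_pos: "0 < logistic_density x"
proof -
  have "0 < cosh x + 1" using cosh_real_pos[of x] by (rule add_pos_pos) simp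
  then show ?thesis by (simp only: logistic_density_def zero_less_divide_1_iff zero_less_mult_iff) simp
qed

lemma logistic_cdf_bounds: "0 < logistic_cdf x" "logistic_cdf x < 1"
  by (auto simp: logistic_cdf_def divide_simps add_pos_pos)

lemma logistic_cdf_has_derivative:
  "(logistic_cdf has_real_derivative logistic_density x) (at x)"
proof -
  have "1 + exp (- x) \<noteq> (0::real)" by (metis add_pos_pos exp_gt_zero less_irrefl zero_less_one)
  moreover have "exp (-x) / (1 + exp (-x))\<^sup>2 = logistic_density x"
  proof -
    define E where "E = exp x"
    have "E > 0" by (simp add: E_def)
    have "(1 / E) / (1 + 1 / E)\<^sup>2 = E / (E + 1)\<^sup>2"
      using \<open>E > 0\<close> by (simp add: power2_eq_square divide_simps) 
    moreover have "2 * ((E + 1 / E) / 2 + 1) = (E + 1)\<^sup>2 / E"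
      using \<open>E > 0\<close> by (simp add: power2_eq_square field_simps)
    ultimately show ?thesis
      by (simp add: logistic_density_def cosh_def exp_minus E_def[symmetric] inverse_eq_divide)
  qed
  ultimately show ?thesis
    unfolding logistic_cdf_def
    by (auto intro!: derivative_eq_intros simp: power2_eq_square)
qed

text \<open>Separates the midpoint of x and y from their difference: 2 (cosh x + 1) = 4 cosh^2(x/2),
  and 2 cosh(x/2) cosh(y/2) = cosh((x+y)/2) + cosh((x-y)/2). The interpolation is expressed in the
  same two variables.\<close>

lemma logistic_density_prod:
  "logistic_density x * logistic_density y =
     1 / (4 * (cosh ((x + y) / 2) + 1 + 2 * (sinh ((x - y) / 4))\<^sup>2)\<^sup>2)"
proof -
  have h: "logistic_density x = 1 / (4 * (cosh (x / 2))\<^sup>2)" for x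
  proof -
    have "cosh x = 2 * (cosh (x/2))\<^sup>2 - 1"
      using cosh_double_cosh[of "x/2"] by simp
    then show ?thesis by (simp add: logistic_density_def)
  qed
  have "cosh ((x + y) / 2) = cosh (x/2) * cosh (y/2) + sinh (x/2) * sinh (y/2)"
    using cosh_add[of "x/2" "y/2"] by (simp add: add_divide_distrib)
  moreover have "1 + 2 * (sinh ((x - y) / 4))\<^sup>2 = cosh ((x - y) / 2)"
  proof -
    have "2 * ((x - y) / 4) = (x - y) / 2" by (simp add: field_simps)
    then show ?thesis
      using cosh_double_cosh[of "(x-y)/4"] cosh_square_eq[of "(x-y)/4"]
      by (simp only:) simp
  qed
  moreover have "cosh ((x - y) / 2) = cosh (x/2) * cosh (y/2) - sinh (x/2) * sinh (y/2)"
    using cosh_diff[of "x/2" "y/2"] by (simp add: diff_divide_distrib)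
  ultimately have "cosh ((x + y) / 2) + 1 + 2 * (sinh ((x - y) / 4))\<^sup>2 = 2 * cosh (x/2) * cosh (y/2)"
    by simp
  then show ?thesis unfolding h by (simp add: power_mult_distrib)
qed

text \<open>The inequality behind the interpolation with the hyperbolic functions eliminated: c =
  cosh((x+y)/2), K = sinh^2((x-y)/4), d is the hyperbolic cosine of the interpolated point, and
  \<open>eq\<close> is the relation that its definition imposes.\<close>

lemma logistic_interpolation_algebra:
  fixes c K d :: real
  assumes c: "1 \<le> c" and K: "0 \<le> K" and d: "0 \<le> d" and eq: "d\<^sup>2 * (1 + K) = K + c\<^sup>2"
  shows "(1 + 3/4 * K) * ((1 + K)\<^sup>2 * d\<^sup>2 * (d + 1)\<^sup>2)
          \<le> (c\<^sup>2 + 3/4 * K * c\<^sup>2 + K / 4) * (c + 1 + 2 * K)\<^sup>2"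
proof -
  have dc: "d \<le> c"
  proof -
    have "1 \<le> c\<^sup>2" using c by simp
    then have "K * 1 \<le> K * c\<^sup>2" using K by (intro mult_left_mono)
    then have "d\<^sup>2 * (1 + K) \<le> c\<^sup>2 * (1 + K)" using eq by (simp add: algebra_simps)
    then have "d\<^sup>2 \<le> c\<^sup>2" using K by simp
    then show ?thesis using c by (simp add: power2_le_iff_abs_le)
  qed
  have "(1 + K) * (d + 1)\<^sup>2 = K + c\<^sup>2 + 2 * d * (1 + K) + (1 + K)"
    using eq by (simp add: power2_eq_square algebra_simps)
  also have "\<dots> \<le> K + c\<^sup>2 + 2 * c * (1 + K) + (1 + K)"
    using dc K by (intro add_mono mult_right_mono mult_left_mono) auto
  also have "\<dots> = (c + 1) * (c + 1 + 2 * K)"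
    by (simp add: power2_eq_square algebra_simps)
  finally have 1: "(1 + K) * (d + 1)\<^sup>2 \<le> (c + 1) * (c + 1 + 2 * K)" .
  have 2: "(1 + 3/4 * K) * (K + c\<^sup>2) * (c + 1) \<le> (c\<^sup>2 + 3/4 * K * c\<^sup>2 + K / 4) * (c + 1 + 2 * K)"
  proof -
    \<comment> \<open>In b and K the difference of the two sides is a polynomial with nonnegative
      coefficients.\<close>
    define b where "b = c - 1"
    have b: "b \<ge> 0" "c = 1 + b" using c by (auto simp: b_def)
    have "(c\<^sup>2 + 3/4 * K * c\<^sup>2 + K / 4) * (c + 1 + 2 * K) - (1 + 3/4 * K) * (K + c\<^sup>2) * (c + 1)
        = K * (1/2 + 13/4 * b + 2 * b\<^sup>2) + K\<^sup>2 * (1/2 + 9/4 * b + 3/2 * b\<^sup>2)"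
      unfolding b(2) by (simp add: power2_eq_square field_simps)
    moreover have "\<dots> \<ge> 0" using b K by auto
    ultimately show ?thesis by linarith
  qed
  have "(1 + 3/4 * K) * ((1 + K)\<^sup>2 * d\<^sup>2 * (d + 1)\<^sup>2)
      = (1 + 3/4 * K) * (d\<^sup>2 * (1 + K)) * ((1 + K) * (d + 1)\<^sup>2)"
    by (simp only: power2_eq_square mult_ac)
  also have "\<dots> = (1 + 3/4 * K) * (K + c\<^sup>2) * ((1 + K) * (d + 1)\<^sup>2)"
    by (simp only: eq)
  also have "\<dots> \<le> (1 + 3/4 * K) * (K + c\<^sup>2) * ((c + 1) * (c + 1 + 2 * K))"
    using K by (intro mult_left_mono 1) auto
  also have "\<dots> = ((1 + 3/4 * K) * (K + c\<^sup>2) * (c + 1)) * (c + 1 + 2 * K)" by simp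
  also have "\<dots> \<le> ((c\<^sup>2 + 3/4 * K * c\<^sup>2 + K / 4) * (c + 1 + 2 * K)) * (c + 1 + 2 * K)"
    using c K by (intro mult_right_mono 2) auto
  finally show ?thesis by (simp add: power2_eq_square)
qed

text \<open>While x moves at speed 1 and y = T x at speed t, \<open>S\<close> moves at speed zx + zy
  t. The arithmetic-geometric mean inequality bounds this below by 2 sqrt(zx zy t), and the
  algebraic inequality compares the result with the product of the densities. The surplus factor 1 +
  3/4 sinh^2 later pays for the cost in property tau.\<close>

lemma logistic_interpolation:
  fixes T :: "real \<Rightarrow> real"
  assumes T: "(T has_real_derivative t) (at x)" and t: "0 < t"
  defines "S \<equiv> \<lambda>x. sinh ((x + T x) / 2) / cosh ((x - T x) / 4)"
  shows "\<exists>D. ((\<lambda>x. logistic_cdf (arsinh (S x))) has_real_derivative D) (at x) \<and>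
     sqrt ((1 + 3/4 * (sinh ((x - T x) / 4))\<^sup>2) * (logistic_density x * logistic_density (T x)) * t) \<le> D"
proof -
  define c s C \<sigma> where "c = cosh ((x + T x) / 2)" and "s = sinh ((x + T x) / 2)"
    and "C = cosh ((x - T x) / 4)" and "\<sigma> = sinh ((x - T x) / 4)"
  have c: "c \<ge> 1" "c\<^sup>2 = s\<^sup>2 + 1" and C: "C \<ge> 1" "C\<^sup>2 = \<sigma>\<^sup>2 + 1"
    by (auto simp: c_def s_def C_def \<sigma>_def cosh_real_ge_1 sinh_square_eq)
  define d where "d = sqrt ((S x)\<^sup>2 + 1)"
  have Sx: "S x = s / C" by (simp add: S_def s_def C_def)
  have d: "d \<ge> 1" and d2: "d\<^sup>2 = (s / C)\<^sup>2 + 1" by (auto simp: d_def Sx)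
  have dcosh: "cosh (arsinh (S x)) = d"
    by (simp add: d_def cosh_arsinh_real)
  \<comment> \<open>The partial derivatives in x and in y of sinh((x+y)/2) / cosh((x-y)/4), at y = T
    x.\<close>
  define zx zy where "zx = (c * C / 2 - s * \<sigma> / 4) / C\<^sup>2" and "zy = (c * C / 2 + s * \<sigma> / 4) / C\<^sup>2"
  have S': "(S has_real_derivative (zx + zy * t)) (at x)"
    unfolding S_def using C(1)
    by (auto intro!: derivative_eq_intros T
        simp: zx_def zy_def c_def[symmetric] s_def[symmetric] C_def[symmetric] \<sigma>_def[symmetric])
       (simp add: field_simps power2_eq_square)
  have D: "((\<lambda>x. logistic_cdf (arsinh (S x))) has_real_derivative
      (1 / (2 * (d + 1))) * ((zx + zy * t) / d)) (at x)"
    using DERIV_chain2[OF logistic_cdf_has_derivative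
      DERIV_chain2[OF arsinh_real_has_field_derivative S']]
    by (simp add: logistic_density_def dcosh d_def)
  have "\<bar>s\<bar> \<le> c" using c by (metis abs_le_square_iff abs_of_nonneg order.trans le_add_same_cancel1 zero_le_one)
  moreover have "\<bar>\<sigma>\<bar> \<le> C" using C by (metis abs_le_square_iff abs_of_nonneg order.trans le_add_same_cancel1 zero_le_one)
  ultimately have "\<bar>s * \<sigma>\<bar> \<le> c * C" unfolding abs_mult by (intro mult_mono) auto
  then have pos: "zx \<ge> 0" "zy \<ge> 0"
    using c C by (auto simp: zx_def zy_def field_simps abs_le_iff) 
  have amgm: "2 * sqrt (zx * (zy * t)) \<le> zx + zy * t"
    using arith_geo_mean_sqrt[of zx "zy * t"] pos t by simp
  define K where "K = \<sigma>\<^sup>2"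
  have K: "K \<ge> 0" and C2: "C\<^sup>2 = 1 + K" by (auto simp: K_def C)
  have deq: "d\<^sup>2 * (1 + K) = K + c\<^sup>2"
  proof -
    have "d\<^sup>2 * C\<^sup>2 = s\<^sup>2 + C\<^sup>2" using C(1) by (simp add: d2 power_divide field_simps)
    then show ?thesis using c(2) by (simp add: C2)
  qed
  have zz: "4 * (zx * zy) = (c\<^sup>2 + 3/4 * K * c\<^sup>2 + K / 4) / (1 + K)\<^sup>2"
  proof -
    have "4 * (zx * zy) = 4 * ((c * C / 2 - s * \<sigma> / 4) * (c * C / 2 + s * \<sigma> / 4)) / (C\<^sup>2)\<^sup>2"
      by (simp add: zx_def zy_def power2_eq_square)
    also have "4 * ((c * C / 2 - s * \<sigma> / 4) * (c * C / 2 + s * \<sigma> / 4)) = c\<^sup>2 * C\<^sup>2 - s\<^sup>2 * \<sigma>\<^sup>2 / 4"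
      by (simp add: power2_eq_square field_simps)
    also have "\<dots> = c\<^sup>2 + 3/4 * K * c\<^sup>2 + K / 4"
    proof -
      have s2: "s\<^sup>2 = c\<^sup>2 - 1" using c(2) by simp
      show ?thesis unfolding C2 K_def[symmetric] s2 by (simp add: field_simps)
    qed
    finally show ?thesis by (simp add: C2)
  qed
  have "(1 + 3/4 * K) / (c + 1 + 2 * K)\<^sup>2
      \<le> (c\<^sup>2 + 3/4 * K * c\<^sup>2 + K / 4) / ((1 + K)\<^sup>2 * d\<^sup>2 * (d + 1)\<^sup>2)"
  proof -
    have "0 < c + 1 + 2 * K" "0 < 1 + K" "0 < d" "0 < d + 1" using c(1) K d by auto
    then have "0 < (c + 1 + 2 * K)\<^sup>2" "0 < (1 + K)\<^sup>2 * d\<^sup>2 * (d + 1)\<^sup>2" by auto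
    then show ?thesis
      using logistic_interpolation_algebra[OF c(1) K _ deq] d by (simp only: frac_le_eq[of _ _ _ _] pos_le_divide_eq pos_divide_le_eq times_divide_eq_left)
  qed
  also have "\<dots> = 4 * (zx * zy) / (d\<^sup>2 * (d + 1)\<^sup>2)"
    unfolding zz by (simp only: divide_divide_eq_left mult.assoc)
  finally have "(1 + 3/4 * K) / (c + 1 + 2 * K)\<^sup>2 * (t / 4) \<le> 4 * (zx * zy) / (d\<^sup>2 * (d + 1)\<^sup>2) * (t / 4)"
    using t by (intro mult_right_mono) auto
  then have "(1 + 3/4 * K) * (1 / (4 * (c + 1 + 2 * K)\<^sup>2)) * t \<le> zx * zy * t / (d\<^sup>2 * (d + 1)\<^sup>2)"
    by (simp add: mult_ac)
  also have "\<dots> = (2 * sqrt (zx * (zy * t)) / (2 * (d + 1) * d))\<^sup>2"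
  proof -
    have "2 * sqrt (zx * (zy * t)) / (2 * (d + 1) * d) = sqrt (zx * (zy * t)) / ((d + 1) * d)"
      by (simp only: mult.assoc) (rule mult_divide_mult_cancel_left, simp)
    also have "\<dots>\<^sup>2 = zx * zy * t / (d\<^sup>2 * (d + 1)\<^sup>2)"
      using pos t by (simp add: power_divide power_mult_distrib mult.commute mult.left_commute)
    finally show ?thesis by simp
  qed
  finally have "sqrt ((1 + 3/4 * K) * (1 / (4 * (c + 1 + 2 * K)\<^sup>2)) * t) \<le> 2 * sqrt (zx * (zy * t)) / (2 * (d + 1) * d)"
    using pos t d by (intro real_le_lsqrt) auto
  also have "\<dots> \<le> (zx + zy * t) / (2 * (d + 1) * d)"
    using amgm d by (intro divide_right_mono) auto
  finally show ?thesis
    using D by (intro exI[of _ "(1 / (2 * (d + 1))) * ((zx + zy * t) / d)"])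
      (simp add: logistic_density_prod c_def[symmetric] \<sigma>_def[symmetric] K_def)
qed

text \<open>For 1 <= p <= 2 this is u^2 when |u| <= 1 and |u|^p beyond. The first regime produces
  the Q-part of the sieve, the second the Z-part.\<close>

definition two_level :: "real \<Rightarrow> real \<Rightarrow> real" where
  "two_level p u = min (u\<^sup>2) (\<bar>u\<bar> powr p)"

text \<open>Fixes the constant 1/32: the factor gained by the interpolation dominates the
  exponential of the cost. For small u it suffices that |sinh y| >= |y|; for large u both sides are
  compared through exp(|u|/2).\<close>

lemma exp_two_level_le_sinh: "exp (two_level 1 u / 32) \<le> 1 + 3/4 * (sinh (u / 4))\<^sup>2"
proof (cases "\<bar>u\<bar> \<le> 1")
  case True
  define t where "t = u\<^sup>2 / 32"
  have u1: "u\<^sup>2 \<le> 1" using True by (simp add: abs_square_le_1)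
  have t: "0 \<le> t" "t \<le> 1/32" using u1 by (auto simp: t_def)
  have "exp (two_level 1 u / 32) \<le> exp t" by (simp add: two_level_def t_def)
  also have "\<dots> \<le> 1 + t + t\<^sup>2" using t by (intro exp_bound) auto
  also have "\<dots> \<le> 1 + 3/2 * t" 
  proof -
    have "t * t \<le> t * (1/2)" using t by (intro mult_left_mono) auto
    then show ?thesis by (simp add: power2_eq_square)
  qed
  also have "\<dots> = 1 + 3/4 * (u / 4)\<^sup>2" by (simp add: t_def power2_eq_square)
  also have "\<dots> \<le> 1 + 3/4 * (sinh (u / 4))\<^sup>2"
  proof -
    have s: "y \<le> sinh y" if "y \<ge> 0" for y :: real
    proof -
      have "\<exists>D. ((\<lambda>x. sinh x - x) has_real_derivative D) (at x) \<and> 0 \<le> D" for x :: real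
        by (rule exI[of _ "cosh x - 1"]) (auto intro!: derivative_eq_intros simp: cosh_real_ge_1)
      then have "sinh 0 - 0 \<le> sinh y - y"
        by (intro DERIV_nonneg_imp_nondecreasing[OF that]) auto
      then show ?thesis by simp
    qed
    have "\<bar>u/4\<bar> \<le> \<bar>sinh (u/4)\<bar>"
      using s[of "u/4"] s[of "- (u/4)"] by (cases "u \<ge> 0") auto
    then have "(u/4)\<^sup>2 \<le> (sinh (u/4))\<^sup>2" by (simp only: abs_le_square_iff)
    then show ?thesis by simp
  qed
  finally show ?thesis .
next
  case False
  define y where "y = exp (\<bar>u\<bar> / 32)"
  define E where "E = exp (\<bar>u\<bar> / 2)"
  have Ey: "E = y ^ 16" unfolding E_def y_def by (simp add: exp_of_nat_mult[symmetric])
  \<comment> \<open>Bernoulli: \<open>E\<close> is the 16th power of \<open>y\<close>, and the right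
    side of the claim is affine in E + 1/E.\<close>
  have "1 + 16 * (y - 1) \<le> (1 + (y - 1)) ^ 16"
    using Bernoulli_inequality[of "y - 1" 16] by (simp add: y_def)
  then have yE: "y \<le> 1 + (E - 1) / 16" unfolding Ey by (simp add: field_simps)
  have "1 + \<bar>u\<bar>/2 \<le> E" unfolding E_def by (rule exp_ge_add_one_self)
  then have E: "E \<ge> 3/2" using False by simp
  have "0 \<le> (2 * E - 3) * (E - 1)" using E by simp
  then have "y \<le> 5/8 + 3/16 * (E + 1 / E)"
  proof -
    have "5 \<le> 2 * E + 3 / E"
      using \<open>0 \<le> (2 * E - 3) * (E - 1)\<close> E by (simp add: field_simps)
    then show ?thesis using yE by (simp add: field_simps)
  qed
  also have "\<dots> = 5/8 + 3/8 * cosh (\<bar>u\<bar> / 2)"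
    by (simp add: cosh_def E_def exp_minus field_simps)
  also have "\<dots> = 5/8 + 3/8 * cosh (u / 2)" by (simp add: abs_if)
  also have "\<dots> = 1 + 3/4 * (sinh (u / 4))\<^sup>2"
    using cosh_double_cosh[of "u/4"] cosh_square_eq[of "u/4"] by (simp add: field_simps)
  finally have "y \<le> 1 + 3/4 * (sinh (u / 4))\<^sup>2" .
  moreover have "exp (two_level 1 u / 32) \<le> y"
    by (simp add: two_level_def y_def)
  ultimately show ?thesis by linarith
qed

section \<open>Distribution functions and monotone transport\<close>

lemma transport_map:
  fixes \<Phi> \<Psi> :: "real \<Rightarrow> real"
  assumes \<Phi>: "\<And>x. (\<Phi> has_real_derivative \<phi> x) (at x)" "\<And>x. 0 < \<Phi> x" "\<And>x. \<Phi> x < 1"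
    and \<Psi>: "\<And>x. (\<Psi> has_real_derivative \<psi> x) (at x)" "\<And>x. 0 < \<psi> x"
    and lim: "(\<Psi> \<longlongrightarrow> 0) at_bot" "(\<Psi> \<longlongrightarrow> 1) at_top"
  obtains T where "\<And>x. \<Psi> (T x) = \<Phi> x" "\<And>x. (T has_real_derivative \<phi> x / \<psi> (T x)) (at x)"
proof -
  have mono: "\<Psi> x < \<Psi> y" if "x < y" for x y
    by (rule DERIV_pos_imp_increasing[OF that]) (use \<Psi> in blast)
  have cont: "isCont \<Psi> x" for x using \<Psi>(1) by (rule DERIV_isCont)
  have ex: "\<exists>z. \<Psi> z = y" if y: "0 < y" "y < 1" for y
  proof -
    obtain a where a: "\<Psi> a < y"
      using order_tendstoD(2)[OF lim(1) y(1)] by (auto simp: eventually_at_bot_linorder)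
    obtain b where b: "y < \<Psi> b"
      using order_tendstoD(1)[OF lim(2) y(2)] by (auto simp: eventually_at_top_linorder)
    have "a \<le> b" using mono[of b a] a b by (meson less_asym not_le less_trans)
    then show ?thesis using IVT[of \<Psi> a y b] a b cont by auto
  qed
  \<comment> \<open>The transport is the monotone rearrangement \<open>R (\<Phi> x)\<close>. Only
    values of \<open>R\<close> on the open unit interval matter, where \<open>\<Psi>\<close> takes
    every value exactly once.\<close>
  define R where "R y = (SOME z. \<Psi> z = y)" for y
  have R: "\<Psi> (R y) = y" if "0 < y" "y < 1" for y
    unfolding R_def using ex[OF that] by (rule someI_ex)
  have RP: "R (\<Psi> z) = z" for z
  proof -
    have "\<Psi> (R (\<Psi> z)) = \<Psi> z" unfolding R_def by (rule someI) simp
    then show ?thesis using mono by (metis less_irrefl linorder_neqE_linordered_idom)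
  qed
  have dR: "(R has_real_derivative inverse (\<psi> (R y))) (at y)" if y: "0 < y" "y < 1" for y
  proof (rule DERIV_inverse_function)
    show "isCont R y"
      using isCont_inverse_function2[of "R y - 1" "R y" "R y + 1" R \<Psi>] RP cont by (simp add: R[OF y])
    show "(\<Psi> has_real_derivative \<psi> (R y)) (at (R y))" by (rule \<Psi>)
    show "\<psi> (R y) \<noteq> 0" using \<Psi>(2)[of "R y"] by simp
  qed (use y R in auto)
  show ?thesis
  proof
    show "\<Psi> (R (\<Phi> x)) = \<Phi> x" for x using \<Phi> by (intro R)
    show "((\<lambda>x. R (\<Phi> x)) has_real_derivative \<phi> x / \<psi> (R (\<Phi> x))) (at x)" for x
      using DERIV_chain2[OF dR[OF \<Phi>(2,3)] \<Phi>(1), of x] by (simp add: divide_inverse mult.commute)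
  qed
qed

lemma cdf_density_has_derivative:
  fixes f :: "real \<Rightarrow> real"
  assumes cont: "continuous_on UNIV f" and nonneg: "\<And>x. 0 \<le> f x"
    and fin: "(\<integral>\<^sup>+x. f x \<partial>lborel) < \<infinity>"
  shows "(cdf (density lborel f) has_real_derivative f x) (at x)"
proof -
  have [measurable]: "f \<in> borel_measurable borel" using cont by (rule borel_measurable_continuous_onI)
  have int: "integrable lborel f" using fin nonneg by (intro integrableI_nonneg) auto
  have cdf: "cdf (density lborel f) y = (LINT t|lborel. indicator {..y} t * f t)" for y
  proof -
    have "emeasure (density lborel f) {..y} = (\<integral>\<^sup>+t. ennreal (indicator {..y} t * f t) \<partial>lborel)"
      by (subst emeasure_density) (auto intro!: nn_integral_cong simp: indicator_def)
    also have "\<dots> = ennreal (LINT t|lborel. indicator {..y} t * f t)"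
      using nonneg integrable_mult_indicator[OF _ int, of "{..y}"]
      by (intro nn_integral_eq_integral) auto
    finally show ?thesis
      using nonneg by (simp add: cdf_def measure_def integral_nonneg_AE)
  qed
  \<comment> \<open>The derivative is local: splitting the integral over \<open>{..y}\<close> at a
    point left of x leaves a compact interval for the fundamental theorem.\<close>
  define a where "a = x - 1"
  have eq: "cdf (density lborel f) y = cdf (density lborel f) a + integral {a..y} f" if "y \<ge> a" for y
  proof -
    have i: "integrable lborel (\<lambda>t. indicator {..a} t * f t)" "set_integrable lborel {a..y} f"
      using integrable_mult_indicator[OF _ int, of "{..a}"] integrable_mult_indicator[OF _ int, of "{a..y}"]
      by (auto simp: set_integrable_def)
    have "cdf (density lborel f) y = (LINT t|lborel. indicator {..a} t * f t + indicator {a..y} t * f t)"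
      unfolding cdf
      by (intro integral_cong_AE) (use AE_lborel_singleton[of a] that in \<open>auto simp: indicator_def elim!: eventually_mono\<close>)
    also have "\<dots> = cdf (density lborel f) a + (LINT t:{a..y}|lborel. f t)"
      using i by (subst Bochner_Integration.integral_add) (auto simp: cdf set_lebesgue_integral_def set_integrable_def)
    also have "(LINT t:{a..y}|lborel. f t) = integral {a..y} f"
      by (rule set_borel_integral_eq_integral(2)[OF i(2)])
    finally show ?thesis .
  qed
  have "((\<lambda>y. integral {a..y} f) has_real_derivative f x) (at x within {a..x+1})"
    using cont by (intro integral_has_real_derivative continuous_on_subset[OF cont]) (auto simp: a_def)
  moreover have "at x within {a..x+1} = at x" by (intro at_within_interior) (auto simp: a_def)
  ultimately have "((\<lambda>y. cdf (density lborel f) a + integral {a..y} f) has_real_derivative f x) (at x)"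
    by (auto intro!: derivative_eq_intros)
  moreover have "eventually (\<lambda>y. y \<in> {a<..}) (nhds x)" by (intro eventually_nhds_in_open) (auto simp: a_def)
  then have "eventually (\<lambda>y. cdf (density lborel f) y = cdf (density lborel f) a + integral {a..y} f) (nhds x)"
    by eventually_elim (auto intro: eq)
  ultimately show ?thesis
    by (subst DERIV_cong_ev[OF refl _ refl])
qed

lemma density_real_distribution:
  fixes f :: "real \<Rightarrow> real"
  assumes [measurable]: "f \<in> borel_measurable borel" and "(\<integral>\<^sup>+x. f x \<partial>lborel) = 1"
  shows "real_distribution (density lborel f)"
proof -
  interpret prob_space "density lborel f"
    by (rule prob_spaceI) (simp add: emeasure_density assms)
  show ?thesis by unfold_locales auto
qed

lemma cdf_density_bounds:
  fixes f :: "real \<Rightarrow> real"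
  assumes cont: "continuous_on UNIV f" and pos: "\<And>x. 0 < f x" and one: "(\<integral>\<^sup>+x. f x \<partial>lborel) = 1"
  shows "0 < cdf (density lborel f) x" "cdf (density lborel f) x < 1"
proof -
  interpret real_distribution "density lborel f"
    using cont one by (intro density_real_distribution borel_measurable_continuous_onI)
  have mono: "cdf (density lborel f) x < cdf (density lborel f) y" if "x < y" for x y
    by (rule DERIV_pos_imp_increasing[OF that])
       (use cdf_density_has_derivative[OF cont] pos one in \<open>auto intro!: exI less_imp_le\<close>)
  show "0 < cdf (density lborel f) x" using mono[of "x - 1" x] cdf_nonneg[of "x - 1"] by simp
  show "cdf (density lborel f) x < 1" using mono[of x "x + 1"] cdf_bounded_prob[of "x + 1"] by simp
qed

text \<open>Let T transport f to g, and let H x be the logistic distribution function at the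
  interpolation of x and T x. Since T' = f / g(T), the hypothesis turns the interpolation bound into
  H' >= sqrt(kappa) f. As H takes values between 0 and 1, integration over the line gives
  sqrt(kappa) <= 1.\<close>

lemma logistic_prekopa_continuous:
  fixes f g :: "real \<Rightarrow> real"
  assumes f: "continuous_on UNIV f" "\<And>x. 0 < f x" "(\<integral>\<^sup>+x. f x \<partial>lborel) = 1"
    and g: "continuous_on UNIV g" "\<And>x. 0 < g x" "(\<integral>\<^sup>+x. g x \<partial>lborel) = 1"
    and \<kappa>: "0 < \<kappa>"
    and le: "\<And>x y. \<kappa> * (f x * g y) \<le> (1 + 3/4 * (sinh ((x - y) / 4))\<^sup>2) * (logistic_density x * logistic_density y)"
  shows "\<kappa> \<le> 1"
proof -
  interpret f: real_distribution "density lborel f"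
    using f by (intro density_real_distribution borel_measurable_continuous_onI)
  interpret g: real_distribution "density lborel g"
    using g by (intro density_real_distribution borel_measurable_continuous_onI)
  define \<Phi> where "\<Phi> = cdf (density lborel f)"
  have df: "(\<Phi> has_real_derivative f x) (at x)" for x
    unfolding \<Phi>_def using f by (intro cdf_density_has_derivative) (auto intro: less_imp_le)
  have dg: "(cdf (density lborel g) has_real_derivative g x) (at x)" for x
    using g by (intro cdf_density_has_derivative) (auto intro: less_imp_le)
  obtain T where T: "\<And>x. (T has_real_derivative f x / g (T x)) (at x)"
    using transport_map[of \<Phi> f "cdf (density lborel g)" g] df dg cdf_density_bounds[OF f] g(2)
      g.cdf_lim_at_bot g.cdf_lim_at_top_prob unfolding \<Phi>_def by metis
  define H where "H x = logistic_cdf (arsinh (sinh ((x + T x) / 2) / cosh ((x - T x) / 4)))" for x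
  have "\<exists>D. ((\<lambda>x. H x - sqrt \<kappa> * \<Phi> x) has_real_derivative D) (at x) \<and> 0 \<le> D" for x
  proof -
    have t: "0 < f x / g (T x)" using f(2) g(2) by simp
    obtain D where D: "(H has_real_derivative D) (at x)" and
      Dge: "sqrt ((1 + 3/4 * (sinh ((x - T x) / 4))\<^sup>2) * (logistic_density x * logistic_density (T x)) * (f x / g (T x))) \<le> D"
      using logistic_interpolation[OF T t] unfolding H_def by blast
    have "sqrt \<kappa> * f x = sqrt (\<kappa> * (f x * g (T x)) * (f x / g (T x)))"
      using \<kappa> f(2)[of x] g(2)[of "T x"] by (simp add: real_sqrt_mult)
    also have "\<dots> \<le> sqrt ((1 + 3/4 * (sinh ((x - T x) / 4))\<^sup>2) * (logistic_density x * logistic_density (T x)) * (f x / g (T x)))"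
      by (intro real_sqrt_le_mono mult_right_mono le less_imp_le[OF t])
    finally have "0 \<le> D - sqrt \<kappa> * f x" using Dge by simp
    moreover have "((\<lambda>x. H x - sqrt \<kappa> * \<Phi> x) has_real_derivative D - sqrt \<kappa> * f x) (at x)"
      by (intro DERIV_diff D DERIV_cmult df)
    ultimately show ?thesis by blast
  qed
  then have "H x - sqrt \<kappa> * \<Phi> x \<le> H y - sqrt \<kappa> * \<Phi> y" if "x \<le> y" for x y
    by (intro DERIV_nonneg_imp_nondecreasing[OF that]) blast
  moreover have "H y - H x \<le> 1" for x y
    using logistic_cdf_bounds unfolding H_def by (smt (verit))
  ultimately have *: "sqrt \<kappa> * (\<Phi> y - \<Phi> x) \<le> 1" if "x \<le> y" for x y
    using that by (smt (verit) right_diff_distrib)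
  have "((\<lambda>r. sqrt \<kappa> * (\<Phi> r - \<Phi> (- r))) \<longlongrightarrow> sqrt \<kappa> * (1 - 0)) at_top"
    unfolding \<Phi>_def
    by (intro tendsto_intros f.cdf_lim_at_top_prob filterlim_compose[OF f.cdf_lim_at_bot filterlim_uminus_at_bot_at_top])
  then have "sqrt \<kappa> * (1 - 0) \<le> 1"
    by (rule tendsto_upperbound) (auto intro!: eventually_mono[OF eventually_ge_at_top[of 0]] *)
  then show ?thesis by simp
qed

section \<open>The logistic law as a measure\<close>

lemma logistic_density_measurable [measurable]: "logistic_density \<in> borel_measurable borel"
  unfolding logistic_density_def cosh_def by measurable

lemma logistic_cdf_lim: "(logistic_cdf \<longlongrightarrow> 1) at_top" "(logistic_cdf \<longlongrightarrow> 0) at_bot"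
proof -
  have "((\<lambda>x::real. 1 / (1 + exp (- x))) \<longlongrightarrow> 1 / (1 + 0)) at_top"
    by (intro tendsto_intros filterlim_compose[OF exp_at_bot filterlim_uminus_at_bot_at_top]) auto
  then show "(logistic_cdf \<longlongrightarrow> 1) at_top" by (simp add: logistic_cdf_def[abs_def])
  have eq: "logistic_cdf x = 1 - logistic_cdf (- x)" for x
  proof -
    have "exp x + 1 \<noteq> 0" "1 + exp x \<noteq> 0" by (smt (verit) exp_gt_zero)+
    then show ?thesis
      by (simp add: logistic_cdf_def exp_minus field_simps)
  qed
  have "((\<lambda>x. 1 - logistic_cdf (- x)) \<longlongrightarrow> 1 - 1) at_bot"
    by (intro tendsto_intros filterlim_compose[OF \<open>(logistic_cdf \<longlongrightarrow> 1) at_top\<close> filterlim_uminus_at_top_at_bot])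
  then show "(logistic_cdf \<longlongrightarrow> 0) at_bot" by (simp add: eq[symmetric])
qed

definition logistic :: "real measure" where
  "logistic = density lborel logistic_density"

lemma emeasure_logistic_atLeast: "emeasure logistic {a..} = ennreal (1 - logistic_cdf a)"
proof -
  have "(\<integral>\<^sup>+x. ennreal (logistic_density x) * indicator {a..} x \<partial>lborel) = ennreal (1 - logistic_cdf a)"
    by (intro nn_integral_FTC_atLeast logistic_cdf_has_derivative logistic_cdf_lim)
       (auto intro: less_imp_le logistic_density_pos)
  then show ?thesis by (simp add: logistic_def emeasure_density)
qed

lemma sets_logistic [measurable_cong, simp]: "sets logistic = sets borel" "space logistic = UNIV"
  by (auto simp: logistic_def)

lemma emeasure_logistic_UNIV: "emeasure logistic UNIV = 1"
proof -
  have "(\<lambda>n. emeasure logistic {- real n..}) \<longlonglongrightarrow> emeasure logistic (\<Union>n. {- real n..})"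
    by (intro Lim_emeasure_incseq) (auto simp: incseq_def)
  moreover have "(\<Union>n. {- real n..}) = (UNIV :: real set)"
  proof safe
    fix x :: real
    have "- x \<le> real (nat \<lceil>- x\<rceil>)" by (rule real_nat_ceiling_ge)
    then show "x \<in> (\<Union>n. {- real n..})" by (intro UN_I[of "nat \<lceil>- x\<rceil>"]) auto
  qed auto
  moreover have "(\<lambda>n. emeasure logistic {- real n..}) \<longlonglongrightarrow> ennreal (1 - 0)"
    unfolding emeasure_logistic_atLeast
    by (intro tendsto_ennrealI tendsto_intros filterlim_compose[OF logistic_cdf_lim(2)]
      filterlim_compose[OF filterlim_uminus_at_bot_at_top] filterlim_real_sequentially)
  ultimately show ?thesis using LIMSEQ_unique by fastforce
qed

lemma nn_integral_logistic_density: "(\<integral>\<^sup>+x. logistic_density x \<partial>lborel) = 1"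
  using emeasure_logistic_UNIV by (simp add: logistic_def emeasure_density)

lemma real_distribution_logistic: "real_distribution logistic"
  unfolding logistic_def
  by (intro density_real_distribution nn_integral_logistic_density) measurable

lemma cdf_logistic: "cdf logistic x = logistic_cdf x"
proof -
  interpret real_distribution logistic by (rule real_distribution_logistic)
  have "AE t in lborel. t \<noteq> x" by (rule AE_lborel_singleton)
  then have "AE t in logistic. t \<noteq> x" unfolding logistic_def by (subst AE_density) auto
  then have "measure logistic {x<..} = measure logistic {x..}"
    by (intro finite_measure_eq_AE) (auto elim!: eventually_mono)
  moreover have "measure logistic {..x} = 1 - measure logistic {x<..}"
  proof -
    have "{..x} = space logistic - {x<..}" by auto
    then show ?thesis by (metis prob_compl events_eq_borel greaterThan_borel)
  qed
  ultimately show ?thesis using emeasure_logistic_atLeast[of x] logistic_cdf_bounds[of x]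
    by (simp add: cdf_def measure_def)
qed

text \<open>The logarithm of the density is 1-Lipschitz, so moving the argument by at most h costs a
  factor exp h.\<close>

lemma logistic_density_ratio: "logistic_density x \<le> exp \<bar>x - y\<bar> * logistic_density y"
proof -
  have "exp y \<le> exp \<bar>x - y\<bar> * exp x" "exp (- y) \<le> exp \<bar>x - y\<bar> * exp (- x)"
    by (auto simp: exp_add[symmetric])
  then have "cosh y \<le> exp \<bar>x - y\<bar> * cosh x" by (simp add: cosh_def field_simps)
  moreover have "1 \<le> exp \<bar>x - y\<bar>" by simp
  ultimately have "cosh y + 1 \<le> exp \<bar>x - y\<bar> * (cosh x + 1)" by (simp add: distrib_left add_mono)
  moreover have "0 < cosh x + 1" "0 < cosh y + 1" by (intro add_pos_pos cosh_real_pos zero_less_one)+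
  ultimately show ?thesis by (simp add: logistic_density_def field_simps)
qed

text \<open>For p = 1 the cost is steepest at |u| = 1, where u^2 has slope 2. This controls the
  change of the cost under mollification.\<close>

lemma two_level_1_lipschitz: "two_level 1 u \<le> two_level 1 v + 2 * \<bar>u - v\<bar>"
proof -
  have *: "two_level 1 u = (if \<bar>u\<bar> \<le> 1 then u\<^sup>2 else \<bar>u\<bar>)" for u
    using abs_square_le_1[of u] mult_right_mono[of 1 "\<bar>u\<bar>" "\<bar>u\<bar>"] mult_right_mono[of "\<bar>u\<bar>" 1 "\<bar>u\<bar>"]
    by (auto simp: two_level_def min_def power2_eq_square abs_mult[symmetric])
  have sq: "a * a \<le> b * b + 2 * \<bar>a - b\<bar>" if "a \<le> 1" "a \<ge> 0" "b \<ge> 0" for a b :: real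
  proof (cases "a \<le> b")
    case True
    then have "a * a \<le> b * b" using that by (intro mult_mono) auto
    then show ?thesis by (simp add: add_increasing2)
  next
    case False
    then have "(a + b) * (a - b) \<le> 2 * (a - b)" using that by (intro mult_right_mono) auto
    then show ?thesis using False by (simp add: algebra_simps)
  qed
  have key: "\<bar>u\<bar> \<le> \<bar>v\<bar> + 2 * \<bar>\<bar>u\<bar> - \<bar>v\<bar>\<bar>"
    using abs_ge_self[of "\<bar>u\<bar> - \<bar>v\<bar>"] abs_ge_zero[of "\<bar>u\<bar> - \<bar>v\<bar>"] by linarith
  have "two_level 1 u \<le> two_level 1 v + 2 * \<bar>\<bar>u\<bar> - \<bar>v\<bar>\<bar>"
    using sq[of "\<bar>u\<bar>" "\<bar>v\<bar>"] sq[of 1 "\<bar>v\<bar>"] sq[of "\<bar>u\<bar>" 1]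
    by (cases "\<bar>u\<bar> \<le> 1"; cases "\<bar>v\<bar> \<le> 1") (simp_all add: * power2_eq_square key)
  also have "\<dots> \<le> two_level 1 v + 2 * \<bar>u - v\<bar>"
    by (intro add_left_mono mult_left_mono abs_triangle_ineq3) simp
  finally show ?thesis .
qed

section \<open>Mollification, and property tau for the logistic law\<close>

text \<open>Averaging over \<open>{x<..x + h}\<close> keeps the total mass and makes a density continuous.\<close>

definition mollify :: "real \<Rightarrow> (real \<Rightarrow> real) \<Rightarrow> real \<Rightarrow> real" where
  "mollify h f x = (cdf (density lborel f) (x + h) - cdf (density lborel f) x) / h"

context
  fixes f :: "real \<Rightarrow> real" and h :: real
  assumes f [measurable]: "f \<in> borel_measurable borel" and h: "0 < h"
    and fin: "(\<integral>\<^sup>+x. f x \<partial>lborel) < \<infinity>"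
begin

lemma finite_borel_measure_density: "finite_borel_measure (density lborel f)"
proof -
  have "emeasure (density lborel f) (space (density lborel f)) \<noteq> \<infinity>"
    using fin by (simp add: emeasure_density)
  then interpret finite_measure "density lborel f" by (rule finite_measureI)
  show ?thesis by (simp add: finite_borel_measure_def finite_borel_measure_axioms_def finite_measure_axioms)
qed

interpretation finite_borel_measure "density lborel f"
  by (rule finite_borel_measure_density)

lemma ennreal_mollify: "ennreal h * mollify h f x = (\<integral>\<^sup>+r. ennreal (f r) * indicator {x<..x + h} r \<partial>lborel)"
proof -
  have "emeasure (density lborel f) {x<..x + h} = ennreal (cdf (density lborel f) (x + h) - cdf (density lborel f) x)"
    using h by (intro emeasure_Ioc) auto
  also have "\<dots> = ennreal (h * mollify h f x)" using h by (simp add: mollify_def)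
  also have "\<dots> = ennreal h * mollify h f x" using h by (intro ennreal_mult') auto
  finally show ?thesis by (simp add: emeasure_density)
qed

lemma mollify_nonneg: "0 \<le> mollify h f x"
  using h cdf_nondecreasing[of x "x + h"] by (simp add: mollify_def)

lemma continuous_mollify: "continuous_on UNIV (mollify h f)"
proof -
  have "measure (density lborel f) {x} = 0" for x
  proof -
    have "emeasure (density lborel f) {x} = 0"
      by (subst emeasure_density) (auto simp: nn_integral_0_iff_AE AE_lborel_singleton intro: eventually_mono[OF AE_lborel_singleton[of x]])
    then show ?thesis by (simp add: measure_def)
  qed
  then have c: "isCont (cdf (density lborel f)) x" for x by (simp add: isCont_cdf)
  show ?thesis unfolding mollify_def[abs_def]
    by (intro continuous_at_imp_continuous_on ballI continuous_intros isCont_o2[OF _ c]) (use h in auto)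
qed

lemma mollify_pos: assumes "\<And>x. 0 < f x" shows "0 < mollify h f x"
proof (rule ccontr)
  assume "\<not> 0 < mollify h f x"
  then have "mollify h f x = 0" using mollify_nonneg[of x] by simp
  then have "(\<integral>\<^sup>+r. ennreal (f r) * indicator {x<..x + h} r \<partial>lborel) = 0"
    by (simp add: ennreal_mollify[symmetric])
  then have "AE r in lborel. ennreal (f r) * indicator {x<..x + h} r = 0"
    by (subst (asm) nn_integral_0_iff_AE) auto
  then have "AE r in lborel. r \<notin> {x<..x + h}"
    by eventually_elim (use assms in \<open>auto simp: indicator_def ennreal_eq_0_iff not_le[symmetric] split: if_splits\<close>)
  then have "emeasure lborel {x<..x + h} = 0" by (subst (asm) AE_iff_measurable) auto
  then show False using h by simp
qed

text \<open>Fubini: a given r lies in \<open>{x<..x + h}\<close> for a set of x of length h.\<close>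

lemma nn_integral_mollify: "(\<integral>\<^sup>+x. mollify h f x \<partial>lborel) = (\<integral>\<^sup>+x. f x \<partial>lborel)"
proof -
  have [measurable]: "mollify h f \<in> borel_measurable borel"
    by (rule borel_measurable_continuous_onI[OF continuous_mollify])
  have "(\<lambda>(x, r). ennreal (f r) * indicator {z. fst z < snd z \<and> snd z \<le> fst z + h} (x, r)) \<in> borel_measurable (lborel \<Otimes>\<^sub>M lborel)"
    by measurable
  also have "(\<lambda>(x, r). ennreal (f r) * indicator {z. fst z < snd z \<and> snd z \<le> fst z + h} (x, r))
      = (\<lambda>(x, r). ennreal (f r) * indicator {x<..x + h} r)"
    by (auto simp: fun_eq_iff indicator_def)
  finally have M: "(\<lambda>(x, r). ennreal (f r) * indicator {x<..x + h} r) \<in> borel_measurable (lborel \<Otimes>\<^sub>M lborel)" .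
  have "ennreal h * (\<integral>\<^sup>+x. mollify h f x \<partial>lborel) = (\<integral>\<^sup>+x. ennreal h * mollify h f x \<partial>lborel)"
    by (simp add: nn_integral_cmult)
  also have "\<dots> = (\<integral>\<^sup>+x. (\<integral>\<^sup>+r. ennreal (f r) * indicator {x<..x + h} r \<partial>lborel) \<partial>lborel)"
    by (simp add: ennreal_mollify)
  also have "\<dots> = (\<integral>\<^sup>+r. (\<integral>\<^sup>+x. ennreal (f r) * indicator {x<..x + h} r \<partial>lborel) \<partial>lborel)"
    by (rule lborel_pair.Fubini'[OF M, symmetric])
  also have "\<dots> = (\<integral>\<^sup>+r. ennreal (f r) * (\<integral>\<^sup>+x. indicator {r - h..<r} x \<partial>lborel) \<partial>lborel)"
    by (subst nn_integral_cmult[symmetric]) (auto intro!: nn_integral_cong simp: indicator_def)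
  also have "\<dots> = (\<integral>\<^sup>+r. ennreal h * ennreal (f r) \<partial>lborel)"
    using h by (simp add: mult.commute)
  also have "\<dots> = ennreal h * (\<integral>\<^sup>+x. f x \<partial>lborel)" by (rule nn_integral_cmult) auto
  finally show ?thesis using h by (simp add: ennreal_mult_cancel_left)
qed

end

text \<open>The product of the two averages is the average of f r * g s over a square of side
  h.\<close>

lemma mollify_mult_le:
  assumes f: "f \<in> borel_measurable borel" "(\<integral>\<^sup>+x. f x \<partial>lborel) < \<infinity>" "\<And>x. 0 \<le> f x"
    and g: "g \<in> borel_measurable borel" "(\<integral>\<^sup>+x. g x \<partial>lborel) < \<infinity>" "\<And>x. 0 \<le> g x"
    and h: "0 < h" and A: "0 \<le> A"
    and le: "\<And>r s. \<lbrakk>x < r; r \<le> x + h; y < s; s \<le> y + h\<rbrakk> \<Longrightarrow> f r * g s \<le> A"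
  shows "mollify h f x * mollify h g y \<le> A"
proof -
  note [measurable] = f(1) g(1)
  have "ennreal (h * mollify h f x * (h * mollify h g y)) = (ennreal h * mollify h f x) * (ennreal h * mollify h g y)"
    using h mollify_nonneg[OF f(1) h f(2)] mollify_nonneg[OF g(1) h g(2)] by (simp add: ennreal_mult)
  also have "\<dots> = (\<integral>\<^sup>+r. ennreal (f r) * indicator {x<..x + h} r \<partial>lborel) * (\<integral>\<^sup>+s. ennreal (g s) * indicator {y<..y + h} s \<partial>lborel)"
    by (simp add: ennreal_mollify[OF f(1) h f(2)] ennreal_mollify[OF g(1) h g(2)])
  also have "\<dots> = (\<integral>\<^sup>+r. (\<integral>\<^sup>+s. (ennreal (f r) * indicator {x<..x + h} r) * (ennreal (g s) * indicator {y<..y + h} s) \<partial>lborel) \<partial>lborel)"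
    by (simp add: nn_integral_cmult nn_integral_multc)
  also have "\<dots> \<le> (\<integral>\<^sup>+r. (\<integral>\<^sup>+s. ennreal A * indicator {x<..x + h} r * indicator {y<..y + h} s \<partial>lborel) \<partial>lborel)"
    using le f(3) g(3) by (intro nn_integral_mono) (auto simp: indicator_def ennreal_mult[symmetric] intro!: ennreal_leI)
  also have "\<dots> = ennreal A * ennreal h * ennreal h"
    using h by (simp add: nn_integral_cmult nn_integral_multc mult.assoc)
  also have "\<dots> = ennreal (A * h * h)" using h A by (simp add: ennreal_mult)
  finally have "h * mollify h f x * (h * mollify h g y) \<le> A * h * h" using h A by (subst (asm) ennreal_le_iff) auto
  then have "(mollify h f x * mollify h g y) * (h * h) \<le> A * (h * h)" by (simp add: algebra_simps)
  then show ?thesis using h by (simp add: mult_le_cancel_right)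
qed

text \<open>The transport argument wants continuous positive densities of mass 1. Adding h gives
  positivity, mollifying gives continuity, dividing by the masses a and b gives mass 1. The price is
  the factor \<open>C h\<close>, which tends to 1 as h tends to 0.\<close>

lemma logistic_tau_bounded:
  fixes F G :: "real \<Rightarrow> real"
  assumes [measurable]: "F \<in> borel_measurable borel" "G \<in> borel_measurable borel"
    and F: "\<And>x. 0 \<le> F x" "\<And>x. F x \<le> B" and G: "\<And>x. 0 \<le> G x" "\<And>x. G x \<le> B"
    and le: "\<And>x y. F x * G y \<le> exp (two_level 1 (x - y) / 32)"
  shows "(\<integral>\<^sup>+x. F x \<partial>logistic) * (\<integral>\<^sup>+x. G x \<partial>logistic) \<le> 1"
proof -
  have B: "0 \<le> B" using F(1,2) order_trans by blast
  let ?L = logistic_density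
  define I where "I = (\<integral>\<^sup>+x. F x \<partial>logistic) * (\<integral>\<^sup>+x. G x \<partial>logistic)"
  \<comment> \<open>The polynomial factor comes from expanding (F + h) (G + h) with F, G <= B. Of
    the three factors exp h, two belong to the densities and one to the exponent of the cost, which
    changes by at most 2h/32.\<close>
  define C where "C h = (1 + 2 * B * h + h * h) * exp (3 * h)" for h :: real
  have step: "I \<le> ennreal (C h)" if h: "0 < h" for h
  proof -
    define f where "f x = (F x + h) * ?L x" for x
    define g where "g x = (G x + h) * ?L x" for x
    have fpos: "0 < f x" and gpos: "0 < g x" for x
      using F(1)[of x] G(1)[of x] h logistic_density_pos[of x] by (auto simp: f_def g_def)
    have fg [measurable]: "f \<in> borel_measurable borel" "g \<in> borel_measurable borel"
      unfolding f_def g_def by measurable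
    have bound: "\<exists>a>0. (\<integral>\<^sup>+x. k x \<partial>lborel) = ennreal a"
      if k: "\<And>x. k x = (K x + h) * ?L x" "\<And>x. 0 \<le> K x" "\<And>x. K x \<le> B" for k K :: "real \<Rightarrow> real"
    proof -
      have "(\<integral>\<^sup>+x. k x \<partial>lborel) \<le> (\<integral>\<^sup>+x. ennreal (B + h) * ?L x \<partial>lborel)"
        unfolding k(1) using k(2,3) h B
        by (intro nn_integral_mono) (auto simp: ennreal_mult[symmetric] less_imp_le logistic_density_pos simp del: ennreal_plus intro!: ennreal_leI mult_right_mono)
      also have "\<dots> = ennreal (B + h)"
        by (subst nn_integral_cmult) (auto simp: nn_integral_logistic_density)
      finally have up: "(\<integral>\<^sup>+x. k x \<partial>lborel) < \<infinity>" by (auto simp: top_unique less_top[symmetric])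
      have "ennreal h = (\<integral>\<^sup>+x. ennreal h * ?L x \<partial>lborel)"
        by (subst nn_integral_cmult) (auto simp: nn_integral_logistic_density)
      also have "\<dots> \<le> (\<integral>\<^sup>+x. k x \<partial>lborel)"
        unfolding k(1) using k(2,3) h
        by (intro nn_integral_mono) (auto simp: ennreal_mult[symmetric] less_imp_le logistic_density_pos intro!: ennreal_leI mult_right_mono)
      finally have "ennreal h \<le> (\<integral>\<^sup>+x. k x \<partial>lborel)" .
      then show ?thesis using up h
        by (intro exI[of _ "enn2real (\<integral>\<^sup>+x. k x \<partial>lborel)"]) (auto simp: enn2real_positive_iff intro: less_le_trans[of _ "ennreal h"])
    qed
    obtain a where a: "a > 0" "(\<integral>\<^sup>+x. f x \<partial>lborel) = ennreal a" using bound[of f F] F f_def by blast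
    obtain b where b: "b > 0" "(\<integral>\<^sup>+x. g x \<partial>lborel) = ennreal b" using bound[of g G] G g_def by blast
    have ffin: "(\<integral>\<^sup>+x. f x \<partial>lborel) < \<infinity>" and gfin: "(\<integral>\<^sup>+x. g x \<partial>lborel) < \<infinity>" using a b by auto
    have Cpos: "0 < C h" using B h unfolding C_def by (intro mult_pos_pos add_pos_nonneg) auto
    define f' where "f' x = mollify h f x / a" for x
    define g' where "g' x = mollify h g x / b" for x
    have "a * b / C h \<le> 1"
    proof (rule logistic_prekopa_continuous[of f' g'])
      show "continuous_on UNIV f'" "continuous_on UNIV g'" unfolding f'_def[abs_def] g'_def[abs_def]
        by (rule continuous_on_divide continuous_on_const continuous_mollify[OF fg(1) h ffin]
          continuous_mollify[OF fg(2) h gfin] | use a(1) b(1) in simp)+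
      show "0 < f' x" "0 < g' x" for x
        using a(1) b(1) by (auto simp: f'_def g'_def intro!: divide_pos_pos mollify_pos h ffin gfin fpos gpos)
      have [measurable]: "mollify h f \<in> borel_measurable borel" "mollify h g \<in> borel_measurable borel"
        by (auto intro!: borel_measurable_continuous_onI[OF continuous_mollify[OF fg(1) h ffin]]
            borel_measurable_continuous_onI[OF continuous_mollify[OF fg(2) h gfin]])
      have nn: "0 \<le> mollify h f x" "0 \<le> mollify h g x" for x
        by (auto intro!: mollify_nonneg h ffin gfin)
      have "(\<integral>\<^sup>+x. f' x \<partial>lborel) = (\<integral>\<^sup>+x. mollify h f x / ennreal a \<partial>lborel)"
        unfolding f'_def using a(1) nn by (simp add: divide_ennreal)
      also have "\<dots> = 1"
        using a by (subst nn_integral_divide) (auto simp: nn_integral_mollify[OF _ h ffin] divide_ennreal)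
      finally show "(\<integral>\<^sup>+x. f' x \<partial>lborel) = 1" .
      have "(\<integral>\<^sup>+x. g' x \<partial>lborel) = (\<integral>\<^sup>+x. mollify h g x / ennreal b \<partial>lborel)"
        unfolding g'_def using b(1) nn by (simp add: divide_ennreal)
      also have "\<dots> = 1"
        using b by (subst nn_integral_divide) (auto simp: nn_integral_mollify[OF _ h gfin] divide_ennreal)
      finally show "(\<integral>\<^sup>+x. g' x \<partial>lborel) = 1" .
      show "0 < a * b / C h" using a(1) b(1) Cpos by simp
      fix x y
      let ?A = "C h * (exp (two_level 1 (x - y) / 32) * (?L x * ?L y))"
      have "mollify h f x * mollify h g y \<le> ?A"
      proof (rule mollify_mult_le)
        fix r s assume rs: "x < r" "r \<le> x + h" "y < s" "s \<le> y + h"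
        have e1: "1 \<le> exp (two_level 1 (r - s) / 32)" by (simp add: two_level_def)
        have "(F r + h) * (G s + h) = F r * G s + (F r * h + h * G s + h * h)" by (simp add: algebra_simps)
        also have "\<dots> \<le> exp (two_level 1 (r - s) / 32) + (B * h + h * B + h * h) * exp (two_level 1 (r - s) / 32)"
        proof (intro add_mono le)
          have "F r * h + h * G s + h * h \<le> (B * h + h * B + h * h) * 1"
            using F(2)[of r] G(2)[of s] h by (simp only: mult_1_right) (intro add_mono mult_left_mono mult_right_mono, auto)
          also have "\<dots> \<le> (B * h + h * B + h * h) * exp (two_level 1 (r - s) / 32)"
            using B h e1 by (intro mult_left_mono) auto
          finally show "F r * h + h * G s + h * h \<le> (B * h + h * B + h * h) * exp (two_level 1 (r - s) / 32)" .
        qed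
        also have "\<dots> = (1 + 2 * B * h + h * h) * exp (two_level 1 (r - s) / 32)" by (simp add: algebra_simps)
        also have "\<dots> \<le> (1 + 2 * B * h + h * h) * (exp h * exp (two_level 1 (x - y) / 32))"
        proof -
          have "two_level 1 (r - s) \<le> two_level 1 (x - y) + 2 * h"
            using two_level_1_lipschitz[of "r - s" "x - y"] rs by (simp add: abs_if split: if_splits)
          then show ?thesis using B h by (intro mult_left_mono) (auto simp: exp_add[symmetric])
        qed
        finally have FG: "(F r + h) * (G s + h) \<le> (1 + 2 * B * h + h * h) * (exp h * exp (two_level 1 (x - y) / 32))" .
        have "?L r \<le> exp h * ?L x" "?L s \<le> exp h * ?L y"
          using rs by (auto intro!: order_trans[OF logistic_density_ratio] mult_right_mono less_imp_le[OF logistic_density_pos])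
        then have "?L r * ?L s \<le> (exp h * ?L x) * (exp h * ?L y)"
          by (intro mult_mono) (auto intro!: mult_nonneg_nonneg less_imp_le[OF logistic_density_pos])
        then have "((F r + h) * (G s + h)) * (?L r * ?L s)
           \<le> ((1 + 2 * B * h + h * h) * (exp h * exp (two_level 1 (x - y) / 32))) * ((exp h * ?L x) * (exp h * ?L y))"
          by (rule mult_mono[OF FG]) (use B h in \<open>auto intro!: mult_nonneg_nonneg add_nonneg_nonneg less_imp_le[OF logistic_density_pos]\<close>)
        also have "\<dots> = (1 + 2 * B * h + h * h) * (exp h * exp h * exp h) * (exp (two_level 1 (x - y) / 32) * (?L x * ?L y))"
          by (simp add: algebra_simps)
        also have "\<dots> = ?A" by (simp add: C_def exp_add[symmetric])
        finally show "f r * g s \<le> ?A" by (simp add: f_def g_def mult_ac)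
      qed (use ffin gfin h fpos gpos Cpos in \<open>auto intro!: mult_nonneg_nonneg intro: less_imp_le logistic_density_pos\<close>)
      also have "\<dots> \<le> C h * ((1 + 3/4 * (sinh ((x - y) / 4))\<^sup>2) * (?L x * ?L y))"
        using Cpos by (intro mult_left_mono mult_right_mono exp_two_level_le_sinh) (auto intro!: mult_nonneg_nonneg less_imp_le[OF logistic_density_pos])
      finally have "mollify h f x * mollify h g y / C h \<le> (1 + 3/4 * (sinh ((x - y) / 4))\<^sup>2) * (?L x * ?L y)"
        using Cpos by (simp add: pos_divide_le_eq mult.commute)
      moreover have "a * b / C h * (f' x * g' y) = mollify h f x * mollify h g y / C h"
        using a(1) b(1) by (simp add: f'_def g'_def)
      ultimately show "a * b / C h * (f' x * g' y) \<le> (1 + 3/4 * (sinh ((x - y) / 4))\<^sup>2) * (?L x * ?L y)" by (simp only:)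
    qed
    then have ab: "a * b \<le> C h" using Cpos by simp
    have "(\<integral>\<^sup>+x. F x \<partial>logistic) \<le> (\<integral>\<^sup>+x. f x \<partial>lborel)" "(\<integral>\<^sup>+x. G x \<partial>logistic) \<le> (\<integral>\<^sup>+x. g x \<partial>lborel)"
      unfolding logistic_def f_def g_def using F(1) G(1) h
      by (auto simp: nn_integral_density ennreal_mult[symmetric] less_imp_le logistic_density_pos mult.commute
        intro!: nn_integral_mono ennreal_leI mult_left_mono)
    then have "I \<le> ennreal a * ennreal b" unfolding I_def a(2) b(2) by (intro mult_mono) auto
    also have "\<dots> \<le> ennreal (C h)" using ab a(1) b(1) by (simp add: ennreal_mult[symmetric] ennreal_leI)
    finally show ?thesis .
  qed
  have "(C \<longlongrightarrow> (1 + 2 * B * 0 + 0 * 0) * exp (3 * 0)) (at_right 0)"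
    unfolding C_def by (intro tendsto_intros)
  then have "((\<lambda>h. ennreal (C h)) \<longlongrightarrow> ennreal 1) (at_right 0)" by (intro tendsto_ennrealI) simp
  then have "I \<le> ennreal 1"
    by (rule tendsto_lowerbound) (auto simp: eventually_at_filter intro!: always_eventually step)
  then show ?thesis by (simp add: I_def)
qed

text \<open>Truncation at n and monotone convergence remove the boundedness.\<close>

lemma logistic_tau:
  fixes F G :: "real \<Rightarrow> ennreal"
  assumes [measurable]: "F \<in> borel_measurable borel" "G \<in> borel_measurable borel"
    and le: "\<And>x y. F x * G y \<le> ennreal (exp (two_level 1 (x - y) / 32))"
  shows "(\<integral>\<^sup>+x. F x \<partial>logistic) * (\<integral>\<^sup>+x. G x \<partial>logistic) \<le> 1"
proof -
  have trunc: "(\<integral>\<^sup>+x. min (F x) (of_nat n) \<partial>logistic) * (\<integral>\<^sup>+x. min (G x) (of_nat n) \<partial>logistic) \<le> 1" for n :: nat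
  proof -
    define F' G' where "F' x = enn2real (min (F x) (of_nat n))" and "G' x = enn2real (min (G x) (of_nat n))" for x
    have fin: "min a (of_nat n) < top" for a :: ennreal by (auto simp: min_less_iff_disj of_nat_less_top)
    have eq: "ennreal (F' x) = min (F x) (of_nat n)" "ennreal (G' x) = min (G x) (of_nat n)" for x
      using fin by (auto simp: F'_def G'_def)
    have "(\<integral>\<^sup>+x. F' x \<partial>logistic) * (\<integral>\<^sup>+x. G' x \<partial>logistic) \<le> 1"
    proof (rule logistic_tau_bounded[where B = "real n"])
      show "F' \<in> borel_measurable borel" "G' \<in> borel_measurable borel" unfolding F'_def G'_def by measurable
      show "0 \<le> F' x" "0 \<le> G' x" for x by (auto simp: F'_def G'_def)
      show "F' x \<le> real n" "G' x \<le> real n" for x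
        using eq[of x] by (metis ennreal_le_iff ennreal_of_nat_eq_real_of_nat min.cobounded2 of_nat_0_le_iff)+
      fix x y
      have "ennreal (F' x * G' y) = ennreal (F' x) * ennreal (G' y)" by (rule ennreal_mult) (auto simp: F'_def G'_def)
      also have "\<dots> \<le> F x * G y" unfolding eq by (intro mult_mono) auto
      also note le
      finally show "F' x * G' y \<le> exp (two_level 1 (x - y) / 32)" by (subst (asm) ennreal_le_iff) auto
    qed
    then show ?thesis by (simp only: eq)
  qed
  have lim: "(\<lambda>n::nat. \<integral>\<^sup>+x. min (H x) (of_nat n) \<partial>logistic) \<longlonglongrightarrow> (\<integral>\<^sup>+x. H x \<partial>logistic)"
    if [measurable]: "H \<in> borel_measurable borel" for H :: "real \<Rightarrow> ennreal"
  proof (rule nn_integral_LIMSEQ)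
    show "incseq (\<lambda>n x. min (H x) (of_nat n))"
      by (auto simp: incseq_def le_fun_def intro!: min.mono of_nat_mono order_trans[OF min.cobounded2])
    show "(\<lambda>n::nat. min (H x) (of_nat n)) \<longlonglongrightarrow> H x" for x
    proof -
      have "(\<lambda>n::nat. min (H x) (of_nat n)) \<longlonglongrightarrow> min (H x) top"
        by (intro tendsto_min tendsto_const of_nat_tendsto_top_ennreal)
      then show ?thesis by simp
    qed
  qed measurable
  \<comment> \<open>Multiplication of extended reals is not continuous where 0 meets infinity; if
    one of the integrals is 0, the claim is trivial.\<close>
  have "(\<lambda>n::nat. (\<integral>\<^sup>+x. min (F x) (of_nat n) \<partial>logistic) * (\<integral>\<^sup>+x. min (G x) (of_nat n) \<partial>logistic))
      \<longlonglongrightarrow> (\<integral>\<^sup>+x. F x \<partial>logistic) * (\<integral>\<^sup>+x. G x \<partial>logistic)"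
    if "(\<integral>\<^sup>+x. F x \<partial>logistic) \<noteq> 0" "(\<integral>\<^sup>+x. G x \<partial>logistic) \<noteq> 0"
    using that by (intro tendsto_mult_ennreal lim assms) auto
  then show ?thesis
    by (cases "(\<integral>\<^sup>+x. F x \<partial>logistic) = 0 \<or> (\<integral>\<^sup>+x. G x \<partial>logistic) = 0")
       (auto intro: LIMSEQ_le_const2 trunc)
qed

section \<open>Property tau for p-exponential laws and their products\<close>

definition logit :: "real \<Rightarrow> real" where
  "logit q = ln (q / (1 - q))"

lemma logistic_cdf_logit: "0 < q \<Longrightarrow> q < 1 \<Longrightarrow> logistic_cdf (logit q) = q"
  by (simp add: logistic_cdf_def logit_def exp_minus field_simps)

lemma logistic_cdf_strict_mono: "strict_mono logistic_cdf"
proof (rule strict_monoI)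
  fix x y :: real assume "x < y"
  then show "logistic_cdf x < logistic_cdf y"
    by (rule DERIV_pos_imp_increasing) (use logistic_cdf_has_derivative logistic_density_pos in blast)
qed

lemma logit_logistic_cdf: "logit (logistic_cdf x) = x"
  using logistic_cdf_logit[OF logistic_cdf_bounds[of x]] strict_mono_eq[OF logistic_cdf_strict_mono] by blast

lemma logit_has_derivative:
  assumes "0 < q" "q < 1"
  shows "(logit has_real_derivative 1 / q + 1 / (1 - q)) (at q)"
  unfolding logit_def[abs_def] using assms
  by (auto intro!: derivative_eq_intros simp: divide_simps)

text \<open>\<open>p_exp_density\<close> divides by a Bochner integral, and its default value 0
  would make the density vanish. Total mass 1 excludes this; the prior satisfies it because its
  coordinates are random variables with this density.\<close>

locale p_exp_law =
  fixes p :: real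
  assumes p: "1 \<le> p" "p \<le> 2"
    and mass: "(\<integral>\<^sup>+x. p_exp_density p x \<partial>lborel) = 1"
begin

abbreviation "f \<equiv> p_exp_density p"
abbreviation "\<mu> \<equiv> density lborel (\<lambda>x. ennreal (f x))"

definition "Z = (\<integral>y. exp (- (\<bar>y\<bar> powr p) / p) \<partial>lborel)"

lemma f_eq: "f x = exp (- (\<bar>x\<bar> powr p) / p) / Z"
  by (simp add: p_exp_density_def Z_def)

lemma Z_pos: "0 < Z"
proof -
  have "0 \<le> Z" unfolding Z_def by (intro integral_nonneg_AE) auto
  moreover have "Z \<noteq> 0" using mass by (auto simp: f_eq)
  ultimately show ?thesis by simp
qed

lemma f_pos: "0 < f x" using Z_pos by (simp add: f_eq)

lemma f_minus: "f (- x) = f x" by (simp add: f_eq)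

lemma f_continuous: "continuous_on UNIV f"
  unfolding f_eq[abs_def] using Z_pos p
  by (intro continuous_intros continuous_on_powr') auto

lemma f_measurable [measurable]: "f \<in> borel_measurable borel"
  by (rule borel_measurable_continuous_onI[OF f_continuous])

sublocale \<mu>: real_distribution \<mu>
  by (intro density_real_distribution mass) measurable

lemma f_antimono: assumes "\<bar>x\<bar> \<le> \<bar>y\<bar>" shows "f y \<le> f x"
proof -
  have "\<bar>x\<bar> powr p \<le> \<bar>y\<bar> powr p" using assms p by (intro powr_mono2) auto
  then show ?thesis unfolding f_eq using Z_pos p
    by (intro divide_right_mono) (auto simp: divide_right_mono)
qed

lemma cdf_derivative: "(cdf \<mu> has_real_derivative f x) (at x)"
  using mass by (intro cdf_density_has_derivative f_continuous less_imp_le f_pos) auto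

lemma cdf_bounds: "0 < cdf \<mu> x" "cdf \<mu> x < 1"
  using cdf_density_bounds[OF f_continuous f_pos mass] by auto

lemma cdf_less_iff: "cdf \<mu> x < cdf \<mu> y \<longleftrightarrow> x < y"
proof -
  have "cdf \<mu> x < cdf \<mu> y" if "x < y" for x y
    by (rule DERIV_pos_imp_increasing[OF that]) (use cdf_derivative f_pos in blast)
  then show ?thesis by (metis less_asym linorder_neqE_linordered_idom)
qed

text \<open>Away from 0 only: for p = 1 the density has a corner there, so the two signs are treated
  apart.\<close>

lemma f_derivative_pos: assumes "0 < s" shows "(f has_real_derivative - (s powr (p - 1)) * f s) (at s)"
proof -
  have "((\<lambda>s. exp (- (s powr p) / p) / Z) has_real_derivative - (s powr (p - 1)) * f s) (at s)"
    using assms Z_pos p by (auto intro!: derivative_eq_intros simp: f_eq)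
  moreover have "eventually (\<lambda>x. x \<in> {0<..}) (nhds s)" using assms by (intro eventually_nhds_in_open) auto
  then have "eventually (\<lambda>x. f x = exp (- (x powr p) / p) / Z) (nhds s)"
    by eventually_elim (simp add: f_eq)
  ultimately show ?thesis by (subst DERIV_cong_ev[OF refl _ refl])
qed

lemma f_derivative_neg: assumes "s < 0" shows "(f has_real_derivative \<bar>s\<bar> powr (p - 1) * f s) (at s)"
proof -
  have "((\<lambda>s. f (- s)) has_real_derivative (- ((- s) powr (p - 1)) * f (- s)) * (- 1)) (at s)"
    using assms by (intro DERIV_chain2[OF f_derivative_pos]) (auto intro!: derivative_eq_intros)
  then show ?thesis using assms by (simp add: f_minus)
qed

text \<open>A Mills ratio bound. From t on, the function f + t^(p-1) cdf is nonincreasing, because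
  f'(s) = - s^(p-1) f(s) and s^(p-1) >= t^(p-1). Its value at t is therefore at least its limit at
  infinity, which is t^(p-1).\<close>

lemma hazard_right: assumes t: "0 < t" shows "t powr (p - 1) * (1 - cdf \<mu> t) \<le> f t"
proof -
  define k where "k = t powr (p - 1)"
  have "k * cdf \<mu> s \<le> f t + k * cdf \<mu> t" if s: "t \<le> s" for s
  proof -
    have "\<exists>D. ((\<lambda>s. f s + k * cdf \<mu> s) has_real_derivative D) (at r) \<and> D \<le> 0" if r: "t \<le> r" for r
    proof (intro exI conjI)
      show "((\<lambda>s. f s + k * cdf \<mu> s) has_real_derivative - (r powr (p - 1)) * f r + k * f r) (at r)"
        using r t by (intro DERIV_add DERIV_cmult f_derivative_pos cdf_derivative) auto
      have "k \<le> r powr (p - 1)" unfolding k_def using r t p by (intro powr_mono2) auto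
      then have "k * f r \<le> r powr (p - 1) * f r" by (intro mult_right_mono less_imp_le[OF f_pos])
      then show "- (r powr (p - 1)) * f r + k * f r \<le> 0" by simp
    qed
    then have "f s + k * cdf \<mu> s \<le> f t + k * cdf \<mu> t"
      by (intro DERIV_nonpos_imp_nonincreasing[OF s]) blast
    then show ?thesis using f_pos[of s] by simp
  qed
  then have ev: "eventually (\<lambda>s. k * cdf \<mu> s \<le> f t + k * cdf \<mu> t) at_top"
    by (intro eventually_at_top_linorderI)
  have "((\<lambda>s. k * cdf \<mu> s) \<longlongrightarrow> k * 1) at_top" by (intro tendsto_intros \<mu>.cdf_lim_at_top_prob)
  then have "k * 1 \<le> f t + k * cdf \<mu> t" by (rule tendsto_upperbound[OF _ ev]) simp
  then show ?thesis by (simp add: k_def algebra_simps)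
qed

lemma hazard_left: assumes t: "t < 0" shows "\<bar>t\<bar> powr (p - 1) * cdf \<mu> t \<le> f t"
proof -
  define k where "k = \<bar>t\<bar> powr (p - 1)"
  have "k * cdf \<mu> t - f t \<le> k * cdf \<mu> s" if s: "s \<le> t" for s
  proof -
    have "\<exists>D. ((\<lambda>s. f s - k * cdf \<mu> s) has_real_derivative D) (at r) \<and> 0 \<le> D" if r: "r \<le> t" for r
    proof (intro exI conjI)
      show "((\<lambda>s. f s - k * cdf \<mu> s) has_real_derivative \<bar>r\<bar> powr (p - 1) * f r - k * f r) (at r)"
        using r t by (intro DERIV_diff DERIV_cmult f_derivative_neg cdf_derivative) auto
      have "k \<le> \<bar>r\<bar> powr (p - 1)" unfolding k_def using r t p by (intro powr_mono2) auto
      then have "k * f r \<le> \<bar>r\<bar> powr (p - 1) * f r" by (intro mult_right_mono less_imp_le[OF f_pos])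
      then show "0 \<le> \<bar>r\<bar> powr (p - 1) * f r - k * f r" by simp
    qed
    then have "f s - k * cdf \<mu> s \<le> f t - k * cdf \<mu> t"
      by (intro DERIV_nonneg_imp_nondecreasing[OF s]) blast
    then show ?thesis using f_pos[of s] by simp
  qed
  then have ev: "eventually (\<lambda>s. k * cdf \<mu> t - f t \<le> k * cdf \<mu> s) at_bot"
    unfolding eventually_at_bot_linorder by blast
  have "((\<lambda>s. k * cdf \<mu> s) \<longlongrightarrow> k * 0) at_bot" by (intro tendsto_intros \<mu>.cdf_lim_at_bot)
  then have "k * cdf \<mu> t - f t \<le> k * 0" by (rule tendsto_lowerbound[OF _ ev]) simp
  then show ?thesis by (simp add: k_def)
qed

text \<open>Carries \<open>\<mu>\<close> to the logistic law. Its derivative \<open>U'\<close> is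
  the sum of the hazard rates f / cdf and f / (1 - cdf), so lower bounds on these say how much
  \<open>U\<close> expands distances.\<close>

definition "U t = logit (cdf \<mu> t)"
definition "U' t = f t / cdf \<mu> t + f t / (1 - cdf \<mu> t)"

lemma U_derivative: "(U has_real_derivative U' t) (at t)"
  unfolding U_def[abs_def] U'_def
  using DERIV_chain2[OF logit_has_derivative[OF cdf_bounds] cdf_derivative, of t] by (simp add: algebra_simps)

lemma U'_ge_f: "f t \<le> U' t" "0 < U' t"
proof -
  have "f t / 1 \<le> f t / (1 - cdf \<mu> t)"
    using cdf_bounds[of t] f_pos[of t] by (intro divide_left_mono) auto
  moreover have "0 \<le> f t / cdf \<mu> t" using cdf_bounds[of t] f_pos[of t] by auto
  ultimately show "f t \<le> U' t" by (simp add: U'_def)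
  then show "0 < U' t" using f_pos[of t] by simp
qed

lemma U'_ge_powr: "\<bar>t\<bar> powr (p - 1) \<le> U' t"
proof -
  have pos: "0 \<le> f t / cdf \<mu> t" "0 \<le> f t / (1 - cdf \<mu> t)"
    using cdf_bounds[of t] f_pos[of t] by auto
  consider "t = 0" | "t > 0" | "t < 0" by linarith
  then show ?thesis
  proof cases
    case 1 then show ?thesis using U'_ge_f[of t] by simp
  next
    case 2
    then have "t powr (p - 1) \<le> f t / (1 - cdf \<mu> t)"
      using hazard_right[OF 2] cdf_bounds[of t] by (simp add: pos_le_divide_eq)
    then show ?thesis using 2 pos by (simp add: U'_def)
  next
    case 3
    then have "\<bar>t\<bar> powr (p - 1) \<le> f t / cdf \<mu> t"
      using hazard_left[OF 3] cdf_bounds[of t] by (simp add: pos_le_divide_eq)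
    then show ?thesis using 3 pos by (simp add: U'_def)
  qed
qed

text \<open>A lower bound for \<open>U'\<close> on the whole line: the density is at least f 1 on
  [-1, 1], and |t|^(p-1) is at least 1 outside.\<close>

definition "h\<^sub>0 = min 1 (f 1)"

lemma h0: "0 < h\<^sub>0" "h\<^sub>0 \<le> 1" by (auto simp: h\<^sub>0_def f_pos)

lemma U'_ge_h0: "h\<^sub>0 \<le> U' t"
proof (cases "\<bar>t\<bar> \<le> 1")
  case True
  then have "f 1 \<le> f t" by (intro f_antimono) auto
  then show ?thesis using U'_ge_f(1)[of t] by (simp add: h\<^sub>0_def min_le_iff_disj)
next
  case False
  then have "1 \<le> \<bar>t\<bar> powr (p - 1)" using p by (intro ge_one_powr_ge_zero) auto
  then show ?thesis using U'_ge_powr[of t] by (simp add: h\<^sub>0_def)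
qed

lemma U_increment:
  assumes ab: "a \<le> b" and k: "\<And>r. a \<le> r \<Longrightarrow> r \<le> b \<Longrightarrow> k \<le> U' r"
  shows "k * (b - a) \<le> U b - U a"
proof (cases "a = b")
  case False
  then have "a < b" using ab by simp
  from MVT2[OF this, of U U'] U_derivative
  obtain r where "a < r" "r < b" "U b - U a = (b - a) * U' r" by blast
  then show ?thesis using k[of r] ab by (simp add: mult.commute mult_left_mono)
qed simp

lemma U_mono: "a \<le> b \<Longrightarrow> U a \<le> U b"
  using U_increment[of a b 0] U'_ge_f(2) by (auto intro: less_imp_le)

text \<open>The bound |r|^(p-1) on \<open>U'\<close> is weak near 0, so only a quarter of the
  interval is used: its right end if the midpoint is nonnegative, its left end otherwise. All points
  of that quarter have modulus at least (t - s)/4.\<close>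

lemma U_increment_powr:
  assumes st: "s < t" shows "((t - s) / 4) powr p \<le> U t - U s"
proof -
  define d where "d = (t - s) / 4"
  have d: "d > 0" using st by (simp add: d_def)
  have pw: "d powr p = d powr (p - 1) * d" using d by (simp add: powr_diff)
  show ?thesis
  proof (cases "s + t \<ge> 0")
    case True
    have "d powr (p - 1) * (t - (t - d)) \<le> U t - U (t - d)"
    proof (rule U_increment)
      fix r assume "t - d \<le> r" "r \<le> t"
      then have "d \<le> \<bar>r\<bar>" using True d by (simp add: d_def field_simps)
      then have "d powr (p - 1) \<le> \<bar>r\<bar> powr (p - 1)" using d p by (intro powr_mono2) auto
      then show "d powr (p - 1) \<le> U' r" using U'_ge_powr[of r] by simp
    qed (use d in simp)
    moreover have "U s \<le> U (t - d)" using d by (intro U_mono) (simp add: d_def field_simps)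
    ultimately show ?thesis using pw by (simp add: d_def)
  next
    case False
    have "d powr (p - 1) * ((s + d) - s) \<le> U (s + d) - U s"
    proof (rule U_increment)
      fix r assume "s \<le> r" "r \<le> s + d"
      then have "d \<le> \<bar>r\<bar>" using False d by (simp add: d_def field_simps)
      then have "d powr (p - 1) \<le> \<bar>r\<bar> powr (p - 1)" using d p by (intro powr_mono2) auto
      then show "d powr (p - 1) \<le> U' r" using U'_ge_powr[of r] by simp
    qed (use d in simp)
    moreover have "U (s + d) \<le> U t" using d by (intro U_mono) (simp add: d_def field_simps)
    ultimately show ?thesis using pw by (simp add: d_def)
  qed
qed

text \<open>The square of \<open>h\<^sub>0\<close> serves the quadratic regime; 1/16 is a lower
  bound for 4^(-p), the constant lost in \<open>U_increment_powr\<close>.\<close>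

definition "\<kappa> = min (h\<^sub>0\<^sup>2) (1 / 16)"

lemma kappa_pos: "0 < \<kappa>" using h0 by (simp add: \<kappa>_def)

text \<open>Let v be the increment of \<open>U\<close>. If v >= 1, the cost for p = 1 equals v and
  the power bound applies; if v < 1, it equals v^2 and the linear bound with
  \<open>h\<^sub>0\<close> applies.\<close>

lemma two_level_U: "\<kappa> * two_level p (s - t) \<le> two_level 1 (U s - U t)"
proof -
  have *: "\<kappa> * two_level p (t - s) \<le> two_level 1 (U t - U s)" if st: "s < t" for s t
  proof -
    define u v where "u = t - s" and "v = U t - U s"
    have u: "u > 0" using st by (simp add: u_def)
    have v1: "h\<^sub>0 * u \<le> v" unfolding u_def v_def using st U'_ge_h0 by (intro U_increment) auto
    have v0: "0 \<le> v" using v1 u h0 by (smt (verit) mult_nonneg_nonneg)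
    have v2: "(u / 4) powr p \<le> v" unfolding u_def v_def by (rule U_increment_powr[OF st])
    have "(4::real) powr p \<le> 4 powr 2" using p by (intro powr_mono) auto
    then have four: "(4::real) powr p \<le> 16" by simp
    have "u powr p / 16 \<le> u powr p / 4 powr p" using four by (intro divide_left_mono) auto
    also have "\<dots> \<le> v" using v2 u by (simp add: powr_divide)
    finally have v3: "1/16 * u powr p \<le> v" by simp
    have v4: "h\<^sub>0\<^sup>2 * u\<^sup>2 \<le> v\<^sup>2"
      using power_mono[OF v1, of 2] u h0 by (simp add: power_mult_distrib)
    have t0: "0 \<le> two_level p u" by (simp add: two_level_def)
    show ?thesis
    proof (cases "v \<ge> 1")
      case True
      have "\<kappa> * two_level p u \<le> 1/16 * (u powr p)"
        using u t0 by (intro mult_mono) (auto simp: \<kappa>_def two_level_def)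
      also have "\<dots> \<le> two_level 1 v"
        using v3 True v0 mult_right_mono[OF True v0] by (auto simp: two_level_def power2_eq_square)
      finally show ?thesis by (simp add: u_def v_def)
    next
      case False
      have "\<kappa> * two_level p u \<le> h\<^sub>0\<^sup>2 * u\<^sup>2"
        using u t0 by (intro mult_mono) (auto simp: \<kappa>_def two_level_def)
      also have "\<dots> \<le> two_level 1 v"
        using v4 False v0 mult_right_mono[of v 1 v] by (auto simp: two_level_def power2_eq_square)
      finally show ?thesis by (simp add: u_def v_def)
    qed
  qed
  have sym: "two_level q (- x) = two_level q x" for q x by (simp add: two_level_def)
  consider "s = t" | "s < t" | "t < s" by linarith
  then show ?thesis
  proof cases
    case 1 then show ?thesis by (simp add: two_level_def)
  next
    case 2 then show ?thesis using *[OF 2] sym[of p "t - s"] sym[of 1 "U t - U s"] by simp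
  qed (use * in blast)
qed

text \<open>The map T is the inverse of \<open>U\<close>; equality of the laws is checked on
  distribution functions.\<close>

lemma transport_from_logistic:
  obtains T where "T \<in> borel_measurable borel" "distr logistic borel T = \<mu>" "\<And>x. U (T x) = x"
proof -
  obtain T where T: "\<And>x. cdf \<mu> (T x) = logistic_cdf x"
      and dT: "\<And>x. (T has_real_derivative logistic_density x / f (T x)) (at x)"
    using transport_map[of logistic_cdf logistic_density "cdf \<mu>" f] logistic_cdf_has_derivative
      logistic_cdf_bounds cdf_derivative f_pos \<mu>.cdf_lim_at_bot \<mu>.cdf_lim_at_top_prob by metis
  have UT: "U (T x) = x" for x by (simp add: U_def T logit_logistic_cdf)
  have meas [measurable]: "T \<in> borel_measurable borel"
    by (intro borel_measurable_continuous_onI continuous_at_imp_continuous_on ballI DERIV_isCont[OF dT])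
  interpret logistic: real_distribution logistic by (rule real_distribution_logistic)
  interpret T: prob_space "distr logistic borel T" by (rule logistic.prob_space_distr) measurable
  have "distr logistic borel T = \<mu>"
  proof (rule cdf_unique)
    show "real_distribution (distr logistic borel T)" by unfold_locales auto
    show "real_distribution \<mu>" by (rule \<mu>.real_distribution_axioms)
    show "cdf (distr logistic borel T) = cdf \<mu>"
    proof
      fix a
      have "T x \<le> a \<longleftrightarrow> x \<le> U a" for x
      proof -
        have "T x \<le> a \<longleftrightarrow> logistic_cdf x \<le> cdf \<mu> a"
          using cdf_less_iff[of a "T x"] by (simp add: T not_less[symmetric])
        also have "\<dots> \<longleftrightarrow> x \<le> U a"
          using logistic_cdf_logit[OF cdf_bounds] strict_mono_less_eq[OF logistic_cdf_strict_mono]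
          unfolding U_def by metis
        finally show ?thesis .
      qed
      then have "cdf (distr logistic borel T) a = cdf logistic (U a)"
        unfolding cdf_def by (subst measure_distr) (auto intro!: arg_cong[of _ _ "measure logistic"])
      then show "cdf (distr logistic borel T) a = cdf \<mu> a"
        by (simp add: cdf_logistic U_def logistic_cdf_logit cdf_bounds)
    qed
  qed
  then show ?thesis using that meas UT by blast
qed

end

section \<open>Property tau and its passage to products\<close>

text \<open>Maurey's property \<open>(\<tau>)\<close>, with the infimum convolution replaced by a pair of functions: in this
  form no measurability of an infimum is needed and the property passes to products by Fubini.\<close>

definition property_tau :: "'b measure \<Rightarrow> ('b \<Rightarrow> 'b \<Rightarrow> real) \<Rightarrow> bool" where
  "property_tau M c \<longleftrightarrow> (\<forall>F\<in>borel_measurable M. \<forall>G\<in>borel_measurable M.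
     (\<forall>x\<in>space M. \<forall>y\<in>space M. F x * G y \<le> ennreal (exp (c x y))) \<longrightarrow>
     (\<integral>\<^sup>+x. F x \<partial>M) * (\<integral>\<^sup>+x. G x \<partial>M) \<le> 1)"

lemma property_tauD:
  assumes "property_tau M c" "F \<in> borel_measurable M" "G \<in> borel_measurable M"
    and "\<And>x y. x \<in> space M \<Longrightarrow> y \<in> space M \<Longrightarrow> F x * G y \<le> ennreal (exp (c x y))"
  shows "(\<integral>\<^sup>+x. F x \<partial>M) * (\<integral>\<^sup>+x. G x \<partial>M) \<le> 1"
  using assms unfolding property_tau_def by blast

lemma (in p_exp_law) property_tau_p_exp: "property_tau \<mu> (\<lambda>x y. \<kappa> / 32 * two_level p (x - y))"
  unfolding property_tau_def
proof (intro ballI impI)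
  fix F G :: "real \<Rightarrow> ennreal"
  assume "F \<in> borel_measurable \<mu>" "G \<in> borel_measurable \<mu>"
  then have [measurable]: "F \<in> borel_measurable borel" "G \<in> borel_measurable borel" by auto
  assume "\<forall>x\<in>space \<mu>. \<forall>y\<in>space \<mu>. F x * G y \<le> ennreal (exp (\<kappa> / 32 * two_level p (x - y)))"
  then have le: "F x * G y \<le> ennreal (exp (\<kappa> / 32 * two_level p (x - y)))" for x y by auto
  obtain T where T [measurable]: "T \<in> borel_measurable borel" and d: "distr logistic borel T = \<mu>"
    and UT: "\<And>x. U (T x) = x" by (rule transport_from_logistic) blast
  have eq: "(\<integral>\<^sup>+x. H x \<partial>\<mu>) = (\<integral>\<^sup>+x. H (T x) \<partial>logistic)" if [measurable]: "H \<in> borel_measurable borel" for H :: "real \<Rightarrow> ennreal"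
    unfolding d[symmetric] by (rule nn_integral_distr) measurable
  show "(\<integral>\<^sup>+x. F x \<partial>\<mu>) * (\<integral>\<^sup>+x. G x \<partial>\<mu>) \<le> 1"
    unfolding eq[OF \<open>F \<in> borel_measurable borel\<close>] eq[OF \<open>G \<in> borel_measurable borel\<close>]
  proof (rule logistic_tau)
    fix x y
    have "exp (\<kappa> / 32 * two_level p (T x - T y)) \<le> exp (two_level 1 (x - y) / 32)"
      using two_level_U[of "T x" "T y"] by (simp add: UT)
    then show "F (T x) * G (T y) \<le> ennreal (exp (two_level 1 (x - y) / 32))"
      by (intro order_trans[OF le] ennreal_leI)
  qed measurable
qed

lemma property_tau_PiM:
  fixes M :: "'b measure" and c :: "'b \<Rightarrow> 'b \<Rightarrow> real"
  assumes M: "sigma_finite_measure M" and tau: "property_tau M c" and I: "finite I"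
  shows "property_tau (PiM I (\<lambda>_. M)) (\<lambda>x y. \<Sum>i\<in>I. c (x i) (y i))"
  using I
proof (induction I rule: finite_induct)
  case empty
  interpret sigma_finite_measure M by fact
  interpret product_sigma_finite "\<lambda>_. M" by standard
  show ?case unfolding property_tau_def
    by (auto simp: space_PiM nn_integral_empty)
next
  case (insert i I)
  interpret sigma_finite_measure M by fact
  interpret product_sigma_finite "\<lambda>_. M" by standard
  show ?case unfolding property_tau_def
  proof (intro ballI impI)
    fix F G :: "_ \<Rightarrow> ennreal"
    assume F: "F \<in> borel_measurable (PiM (insert i I) (\<lambda>_. M))" and G: "G \<in> borel_measurable (PiM (insert i I) (\<lambda>_. M))"
      and le: "\<forall>x\<in>space (PiM (insert i I) (\<lambda>_. M)). \<forall>y\<in>space (PiM (insert i I) (\<lambda>_. M)).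
          F x * G y \<le> ennreal (exp (\<Sum>i\<in>insert i I. c (x i) (y i)))"
    have upd [measurable]: "(\<lambda>(x, s). x(i := s)) \<in> measurable (PiM I (\<lambda>_. M) \<Otimes>\<^sub>M M) (PiM (insert i I) (\<lambda>_. M))"
      using measurable_add_dim[of i I "\<lambda>_. M"] by (simp add: case_prod_unfold)
    note [measurable] = F G
    have Fm: "(\<lambda>(x, s). F (x(i := s))) \<in> borel_measurable (PiM I (\<lambda>_. M) \<Otimes>\<^sub>M M)"
      and Gm: "(\<lambda>(x, s). G (x(i := s))) \<in> borel_measurable (PiM I (\<lambda>_. M) \<Otimes>\<^sub>M M)"
      using measurable_comp[OF upd F] measurable_comp[OF upd G] by (simp_all add: comp_def case_prod_unfold)
    define F' G' where "F' x = (\<integral>\<^sup>+s. F (x(i := s)) \<partial>M)" and "G' x = (\<integral>\<^sup>+s. G (x(i := s)) \<partial>M)" for x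
    have [measurable]: "F' \<in> borel_measurable (PiM I (\<lambda>_. M))" "G' \<in> borel_measurable (PiM I (\<lambda>_. M))"
      unfolding F'_def[abs_def] G'_def[abs_def]
      using borel_measurable_nn_integral[OF Fm] borel_measurable_nn_integral[OF Gm] by auto
    have "(\<integral>\<^sup>+x. F' x \<partial>PiM I (\<lambda>_. M)) * (\<integral>\<^sup>+x. G' x \<partial>PiM I (\<lambda>_. M)) \<le> 1"
    proof (rule property_tauD[OF insert.IH])
      fix x y assume x: "x \<in> space (PiM I (\<lambda>_. M))" and y: "y \<in> space (PiM I (\<lambda>_. M))"
      define S where "S = (\<Sum>i\<in>I. c (x i) (y i))"
      have [measurable]: "(\<lambda>s. F (x(i := s))) \<in> borel_measurable M" "(\<lambda>s. G (y(i := s))) \<in> borel_measurable M"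
        using measurable_Pair2[OF Fm x] measurable_Pair2[OF Gm y] by auto
      \<comment> \<open>For fixed x and y the cost of the old coordinates is the constant
        \<open>S\<close>. Moving exp(-S) into the first function leaves exactly the one-dimensional
        hypothesis, whose conclusion reads F' x * G' y <= exp S.\<close>
      have "(\<integral>\<^sup>+s. ennreal (exp (- S)) * F (x(i := s)) \<partial>M) * (\<integral>\<^sup>+s. G (y(i := s)) \<partial>M) \<le> 1"
      proof (rule property_tauD[OF tau])
        fix s t assume st: "s \<in> space M" "t \<in> space M"
        have "x(i := s) \<in> space (PiM (insert i I) (\<lambda>_. M))" "y(i := t) \<in> space (PiM (insert i I) (\<lambda>_. M))"
          using x y st by (auto simp: space_PiM PiE_iff extensional_def)
        then have "F (x(i := s)) * G (y(i := t)) \<le> ennreal (exp (\<Sum>j\<in>insert i I. c ((x(i := s)) j) ((y(i := t)) j)))"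
          using le by blast
        moreover have "(\<Sum>j\<in>insert i I. c ((x(i := s)) j) ((y(i := t)) j)) = c s t + S"
          using insert.hyps unfolding S_def by (subst sum.insert) (auto intro!: sum.cong)
        ultimately have le': "F (x(i := s)) * G (y(i := t)) \<le> ennreal (exp (c s t + S))" by (simp only:)
        have "ennreal (exp (- S)) * (F (x(i := s)) * G (y(i := t))) \<le> ennreal (exp (- S)) * ennreal (exp (c s t + S))"
          by (intro mult_left_mono le') simp
        also have "\<dots> = ennreal (exp (c s t))" by (simp add: ennreal_mult[symmetric] exp_add[symmetric])
        finally show "ennreal (exp (- S)) * F (x(i := s)) * G (y(i := t)) \<le> ennreal (exp (c s t))"
          by (simp add: mult.assoc)
      qed measurable
      then have "ennreal (exp (- S)) * (F' x * G' y) \<le> 1"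
        by (simp add: F'_def G'_def nn_integral_cmult mult.assoc)
      then have "ennreal (exp S) * (ennreal (exp (- S)) * (F' x * G' y)) \<le> ennreal (exp S) * 1"
        by (intro mult_left_mono) auto
      then show "F' x * G' y \<le> ennreal (exp (\<Sum>i\<in>I. c (x i) (y i)))"
        by (simp add: S_def mult.assoc[symmetric] ennreal_mult[symmetric] exp_add[symmetric])
    qed measurable
    then show "(\<integral>\<^sup>+x. F x \<partial>PiM (insert i I) (\<lambda>_. M)) * (\<integral>\<^sup>+x. G x \<partial>PiM (insert i I) (\<lambda>_. M)) \<le> 1"
      by (simp add: product_nn_integral_insert[OF insert.hyps F] product_nn_integral_insert[OF insert.hyps G] F'_def G'_def)
  qed
qed

section \<open>Shift inequality\<close>

text \<open>A quasi-invariance of \<open>M\<close> under the map \<open>a\<close>, where \<open>b\<close> is a symmetry of \<open>M\<close>. The quantifier over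
  \<open>s\<close> encodes a product of integrals without square roots, so that the property passes to products.\<close>

definition shift_property :: "'b measure \<Rightarrow> ('b \<Rightarrow> 'b) \<Rightarrow> ('b \<Rightarrow> 'b) \<Rightarrow> real \<Rightarrow> bool" where
  "shift_property M a b k \<longleftrightarrow> (\<forall>F\<^sub>1\<in>borel_measurable M. \<forall>F\<^sub>2\<in>borel_measurable M. \<forall>G\<in>borel_measurable M.
     (\<forall>s>0. \<forall>x\<in>space M. 2 * G x \<le> ennreal s * F\<^sub>1 x + ennreal (1 / s) * F\<^sub>2 (b x)) \<longrightarrow>
     (\<forall>s>0. ennreal (exp (- k)) * (2 * (\<integral>\<^sup>+x. G x \<partial>M))
        \<le> ennreal s * (\<integral>\<^sup>+x. F\<^sub>1 (a x) \<partial>M) + ennreal (1 / s) * (\<integral>\<^sup>+x. F\<^sub>2 (a x) \<partial>M)))"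

lemma shift_propertyD:
  assumes "shift_property M a b k" "F\<^sub>1 \<in> borel_measurable M" "F\<^sub>2 \<in> borel_measurable M" "G \<in> borel_measurable M"
    and "\<And>s x. 0 < s \<Longrightarrow> x \<in> space M \<Longrightarrow> 2 * G x \<le> ennreal s * F\<^sub>1 x + ennreal (1 / s) * F\<^sub>2 (b x)" "0 < s"
  shows "ennreal (exp (- k)) * (2 * (\<integral>\<^sup>+x. G x \<partial>M))
        \<le> ennreal s * (\<integral>\<^sup>+x. F\<^sub>1 (a x) \<partial>M) + ennreal (1 / s) * (\<integral>\<^sup>+x. F\<^sub>2 (a x) \<partial>M)"
  using assms unfolding shift_property_def by blast

section \<open>Power inequalities\<close>

lemma powr_tangent: assumes "0 \<le> t" "0 \<le> q" "q \<le> 1" shows "(t::real) powr q \<le> 1 + q * (t - 1)"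
proof (cases "t = 0")
  case False
  then show ?thesis using Youngs_inequality_0[of q "1 - q" t 1] assms by (simp add: algebra_simps)
qed (use assms in auto)

text \<open>Concavity: after scaling the mean to 1, the tangent bound at 1 is added up over both
  points.\<close>

lemma powr_mean_le:
  assumes "0 \<le> A" "0 \<le> B" "0 \<le> q" "q \<le> 1"
  shows "(A::real) powr q + B powr q \<le> 2 * ((A + B) / 2) powr q"
proof (cases "A + B = 0")
  case True
  then have "A = 0" "B = 0" using assms by auto
  then show ?thesis by simp
next
  case False
  define M where "M = (A + B) / 2"
  have M: "M > 0" using False assms by (simp add: M_def)
  have "(A / M) powr q + (B / M) powr q \<le> (1 + q * (A / M - 1)) + (1 + q * (B / M - 1))"
    using assms M by (intro add_mono powr_tangent) auto
  also have "\<dots> = 2 + q * ((A + B) / M - 2)" by (simp add: algebra_simps add_divide_distrib)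
  also have "(A + B) / M = 2" using M by (simp add: M_def field_simps)
  finally have "(A powr q + B powr q) / M powr q \<le> 2"
    using assms M by (simp add: powr_divide add_divide_distrib)
  then show ?thesis using M by (simp add: pos_divide_le_eq M_def)
qed

lemma powr_subadditive:
  assumes "0 \<le> A" "0 \<le> B" "0 \<le> q" "q \<le> 1"
  shows "((A::real) + B) powr q \<le> A powr q + B powr q"
proof (cases "A = 0 \<or> B = 0")
  case False
  then have AB: "0 < A" "0 < B" using assms by auto
  have *: "x \<le> x powr q" if "0 < x" "x \<le> 1" for x :: real
    using powr_mono'[of q 1 x] that assms by simp
  have "1 = A / (A + B) + B / (A + B)" using AB by (simp add: add_divide_distrib[symmetric])
  also have "\<dots> \<le> (A / (A + B)) powr q + (B / (A + B)) powr q"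
    using AB by (intro add_mono *) auto
  also have "\<dots> = (A powr q + B powr q) / (A + B) powr q"
    using AB by (simp add: powr_divide add_divide_distrib)
  finally show ?thesis using AB by (simp add: pos_le_divide_eq)
qed auto

text \<open>Writing |y|^p = (y^2)^(p/2) with p/2 <= 1, the bound follows from concavity of the
  power, the parallelogram identity and subadditivity of the power.\<close>

lemma clarkson:
  fixes x h :: real
  assumes p: "1 \<le> p" "p \<le> 2"
  shows "\<bar>x + h\<bar> powr p + \<bar>x - h\<bar> powr p \<le> 2 * (\<bar>x\<bar> powr p + \<bar>h\<bar> powr p)"
proof -
  have sq: "\<bar>y\<bar> powr p = (y\<^sup>2) powr (p / 2)" for y :: real
  proof -
    have "\<bar>y\<bar> powr p = (\<bar>y\<bar> powr 2) powr (p / 2)" by (simp only: powr_powr) simp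
    also have "\<bar>y\<bar> powr 2 = y\<^sup>2" by (simp add: powr_numeral)
    finally show ?thesis .
  qed
  have "\<bar>x + h\<bar> powr p + \<bar>x - h\<bar> powr p \<le> 2 * (((x + h)\<^sup>2 + (x - h)\<^sup>2) / 2) powr (p / 2)"
    unfolding sq using p by (intro powr_mean_le) auto
  also have "((x + h)\<^sup>2 + (x - h)\<^sup>2) / 2 = x\<^sup>2 + h\<^sup>2" by (simp add: power2_eq_square algebra_simps)
  also have "2 * (x\<^sup>2 + h\<^sup>2) powr (p / 2) \<le> 2 * ((x\<^sup>2) powr (p / 2) + (h\<^sup>2) powr (p / 2))"
    using p by (intro mult_left_mono powr_subadditive) auto
  finally show ?thesis by (simp add: sq)
qed

context p_exp_law begin

lemma f_shift_product: "exp (- (\<bar>h\<bar> powr p / p)) * f x \<le> sqrt (f (x - h) * f (x + h))"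
proof -
  have "(exp (- (\<bar>h\<bar> powr p / p)) * f x)\<^sup>2 = exp (- (2 * (\<bar>x\<bar> powr p + \<bar>h\<bar> powr p)) / p) / Z\<^sup>2"
    by (simp add: f_eq power2_eq_square exp_add[symmetric] add_divide_distrib diff_divide_distrib)
  also have "\<dots> \<le> exp (- (\<bar>x + h\<bar> powr p + \<bar>x - h\<bar> powr p) / p) / Z\<^sup>2"
    using clarkson[OF p, of x h] p by (intro divide_right_mono iffD2[OF exp_le_cancel_iff]) auto
  also have "\<dots> = f (x - h) * f (x + h)"
    by (simp add: f_eq power2_eq_square exp_add[symmetric] diff_divide_distrib)
  finally show ?thesis by (rule real_le_rsqrt)
qed

text \<open>After a change of variables the two shifted integrals carry the density f(x - h) against
  F1(x) and, by the symmetry of f, the density f(x + h) against F2(-x). Their geometric mean is what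
  \<open>f_shift_product\<close> compares with f.\<close>

lemma shift_property_p_exp: "shift_property \<mu> (\<lambda>x. x + h) uminus (\<bar>h\<bar> powr p / p)"
  unfolding shift_property_def
proof (intro ballI allI impI)
  fix F\<^sub>1 F\<^sub>2 G :: "real \<Rightarrow> ennreal" and s :: real
  assume "F\<^sub>1 \<in> borel_measurable \<mu>" "F\<^sub>2 \<in> borel_measurable \<mu>" "G \<in> borel_measurable \<mu>"
  then have [measurable]: "F\<^sub>1 \<in> borel_measurable borel" "F\<^sub>2 \<in> borel_measurable borel" "G \<in> borel_measurable borel" by auto
  assume s: "0 < s" and "\<forall>s>0. \<forall>x\<in>space \<mu>. 2 * G x \<le> ennreal s * F\<^sub>1 x + ennreal (1 / s) * F\<^sub>2 (- x)"
  then have le: "2 * G x \<le> ennreal s * F\<^sub>1 x + ennreal (1 / s) * F\<^sub>2 (- x)" if "0 < s" for s x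
    using that by auto
  let ?e = "exp (- (\<bar>h\<bar> powr p / p))"
  have F1: "(\<integral>\<^sup>+x. F\<^sub>1 (x + h) \<partial>\<mu>) = (\<integral>\<^sup>+x. ennreal (f (x - h)) * F\<^sub>1 x \<partial>lborel)"
    using nn_integral_real_affine[of "\<lambda>x. ennreal (f (x - h)) * F\<^sub>1 x" 1 h]
    by (simp add: nn_integral_density add.commute)
  have F2: "(\<integral>\<^sup>+x. F\<^sub>2 (x + h) \<partial>\<mu>) = (\<integral>\<^sup>+x. ennreal (f (x + h)) * F\<^sub>2 (- x) \<partial>lborel)"
  proof -
    have fm: "f (- y - h) = f (y + h)" for y using f_minus[of "y + h"] by simp
    have "(\<integral>\<^sup>+x. F\<^sub>2 (x + h) \<partial>\<mu>) = (\<integral>\<^sup>+x. ennreal (f x) * F\<^sub>2 (x + h) \<partial>lborel)"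
      by (simp add: nn_integral_density)
    also have "\<dots> = (\<integral>\<^sup>+x. ennreal (f (- h + - 1 * x)) * F\<^sub>2 (- h + - 1 * x + h) \<partial>lborel)"
      by (subst nn_integral_real_affine[where c = "-1" and t = "- h"]) auto
    also have "\<dots> = (\<integral>\<^sup>+x. ennreal (f (x + h)) * F\<^sub>2 (- x) \<partial>lborel)"
      by (intro nn_integral_cong) (simp add: fm minus_diff_commute)
    finally show ?thesis .
  qed
  have pt: "ennreal ?e * (2 * (ennreal (f x) * G x))
      \<le> ennreal s * (ennreal (f (x - h)) * F\<^sub>1 x) + ennreal (1 / s) * (ennreal (f (x + h)) * F\<^sub>2 (- x))" for x
  proof -
    define A B where "A = f (x - h)" and "B = f (x + h)"
    have AB: "A > 0" "B > 0" by (auto simp: A_def B_def f_pos)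
    \<comment> \<open>Using the hypothesis at s r instead of s gives each term its own density:
      sqrt(A B) r = A and sqrt(A B) / r = B.\<close>
    define r where "r = sqrt (A / B)"
    have r: "r > 0" using AB by (simp add: r_def)
    have 1: "sqrt (A * B) * r = A"
      using AB by (simp add: r_def real_sqrt_mult[symmetric])
    have 2: "sqrt (A * B) * (1 / r) = B"
      using AB by (simp add: r_def real_sqrt_divide[symmetric] real_sqrt_mult[symmetric] field_simps)
    have "ennreal ?e * (2 * (ennreal (f x) * G x)) = ennreal (?e * f x) * (2 * G x)"
      by (simp add: ennreal_mult less_imp_le[OF f_pos] mult_ac)
    also have "\<dots> \<le> ennreal (sqrt (A * B)) * (ennreal (s * r) * F\<^sub>1 x + ennreal (1 / (s * r)) * F\<^sub>2 (- x))"
      unfolding A_def B_def using s r by (intro mult_mono ennreal_leI f_shift_product le) auto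
    also have "\<dots> = (ennreal (sqrt (A * B)) * ennreal (s * r)) * F\<^sub>1 x + (ennreal (sqrt (A * B)) * ennreal (1 / (s * r))) * F\<^sub>2 (- x)"
      by (simp only: distrib_left mult.assoc)
    also have "ennreal (sqrt (A * B)) * ennreal (s * r) = ennreal s * ennreal A"
    proof -
      have "sqrt (A * B) * (s * r) = s * A" using 1 by (metis mult.left_commute)
      then show ?thesis using s r AB by (metis ennreal_mult less_imp_le mult_pos_pos real_sqrt_gt_zero)
    qed
    also have "ennreal (sqrt (A * B)) * ennreal (1 / (s * r)) = ennreal (1 / s) * ennreal B"
    proof -
      have "sqrt (A * B) * (1 / (s * r)) = 1 / s * (sqrt (A * B) * (1 / r))" by simp
      also have "\<dots> = 1 / s * B" by (simp only: 2)
      finally show ?thesis using s r AB by (subst (1 2) ennreal_mult[symmetric]) auto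
    qed
    also have "ennreal s * ennreal A * F\<^sub>1 x + ennreal (1 / s) * ennreal B * F\<^sub>2 (- x)
        = ennreal s * (ennreal A * F\<^sub>1 x) + ennreal (1 / s) * (ennreal B * F\<^sub>2 (- x))"
      by (simp only: mult.assoc)
    finally show ?thesis by (simp add: A_def B_def)
  qed
  have "ennreal ?e * (2 * (\<integral>\<^sup>+x. G x \<partial>\<mu>)) = (\<integral>\<^sup>+x. ennreal ?e * (2 * (ennreal (f x) * G x)) \<partial>lborel)"
    by (simp add: nn_integral_density nn_integral_cmult)
  also have "\<dots> \<le> (\<integral>\<^sup>+x. ennreal s * (ennreal (f (x - h)) * F\<^sub>1 x) + ennreal (1 / s) * (ennreal (f (x + h)) * F\<^sub>2 (- x)) \<partial>lborel)"
    by (intro nn_integral_mono pt)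
  also have "\<dots> = ennreal s * (\<integral>\<^sup>+x. F\<^sub>1 (x + h) \<partial>\<mu>) + ennreal (1 / s) * (\<integral>\<^sup>+x. F\<^sub>2 (x + h) \<partial>\<mu>)"
    unfolding F1 F2 by (simp add: nn_integral_add nn_integral_cmult)
  finally show "ennreal ?e * (2 * (\<integral>\<^sup>+x. G x \<partial>\<mu>)) \<le> ennreal s * (\<integral>\<^sup>+x. F\<^sub>1 (x + h) \<partial>\<mu>) + ennreal (1 / s) * (\<integral>\<^sup>+x. F\<^sub>2 (x + h) \<partial>\<mu>)" .
qed

end

text \<open>For each s the one-dimensional property in coordinate i turns the hypothesis on the
  integrands into the same hypothesis on their partial integrals. It holds again for every s, which
  is what the induction hypothesis demands.\<close>

lemma shift_property_PiM:
  fixes M :: "'b measure" and a :: "'i \<Rightarrow> 'b \<Rightarrow> 'b" and b :: "'b \<Rightarrow> 'b"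
  assumes M: "sigma_finite_measure M"
    and am [measurable]: "\<And>i. a i \<in> measurable M M" and bm [measurable]: "b \<in> measurable M M"
    and shift: "\<And>i. shift_property M (a i) b (k i)" and I: "finite I"
  shows "shift_property (PiM I (\<lambda>_. M)) (\<lambda>x. \<lambda>i\<in>I. a i (x i)) (\<lambda>x. \<lambda>i\<in>I. b (x i)) (\<Sum>i\<in>I. k i)"
  using I
proof (induction I rule: finite_induct)
  case empty
  interpret sigma_finite_measure M by fact
  interpret product_sigma_finite "\<lambda>_. M" by standard
  show ?case unfolding shift_property_def
    by (auto simp: space_PiM nn_integral_empty restrict_def)
next
  case (insert i I)
  interpret sigma_finite_measure M by fact
  interpret product_sigma_finite "\<lambda>_. M" by standard
  let ?P = "PiM I (\<lambda>_. M)" and ?Q = "PiM (insert i I) (\<lambda>_. M)"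
  let ?a = "\<lambda>x. \<lambda>j\<in>I. a j (x j)" and ?b = "\<lambda>x. \<lambda>j\<in>I. b (x j)"
  let ?a' = "\<lambda>x. \<lambda>j\<in>insert i I. a j (x j)" and ?b' = "\<lambda>x. \<lambda>j\<in>insert i I. b (x j)"
  have upd [measurable]: "(\<lambda>(x, s). x(i := s)) \<in> measurable (?P \<Otimes>\<^sub>M M) ?Q"
    using measurable_add_dim[of i I "\<lambda>_. M"] by (simp add: case_prod_unfold)
  have a_upd: "?a' (x(i := s)) = (?a x)(i := a i s)" "?b' (x(i := s)) = (?b x)(i := b s)" for x s
    using insert.hyps by (auto simp: fun_eq_iff)
  have am' [measurable]: "?a \<in> measurable ?P ?P" "?b \<in> measurable ?P ?P" "?a' \<in> measurable ?Q ?Q"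
    by measurable
  show ?case unfolding shift_property_def
  proof (intro ballI allI impI)
    fix F\<^sub>1 F\<^sub>2 G :: "_ \<Rightarrow> ennreal" and s :: real
    assume F1: "F\<^sub>1 \<in> borel_measurable ?Q" and F2: "F\<^sub>2 \<in> borel_measurable ?Q" and G: "G \<in> borel_measurable ?Q"
      and s: "0 < s"
      and le: "\<forall>s>0. \<forall>x\<in>space ?Q. 2 * G x \<le> ennreal s * F\<^sub>1 x + ennreal (1 / s) * F\<^sub>2 (?b' x)"
    have m: "(\<lambda>(x, s). F (x(i := s))) \<in> borel_measurable (?P \<Otimes>\<^sub>M M)" if "F \<in> borel_measurable ?Q" for F :: "_ \<Rightarrow> ennreal"
      using measurable_comp[OF upd that] by (simp add: comp_def case_prod_unfold)
    have ma: "(\<lambda>(x, s). F (x(i := a i s))) \<in> borel_measurable (?P \<Otimes>\<^sub>M M)" if "F \<in> borel_measurable ?Q" for F :: "_ \<Rightarrow> ennreal"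
    proof -
      have "(\<lambda>(x, s). (x, a i s)) \<in> measurable (?P \<Otimes>\<^sub>M M) (?P \<Otimes>\<^sub>M M)" by measurable
      from measurable_comp[OF this m[OF that]] show ?thesis by (simp add: comp_def case_prod_unfold)
    qed
    define G' where "G' x = ennreal (exp (- k i)) * (\<integral>\<^sup>+s. G (x(i := s)) \<partial>M)" for x
    define F\<^sub>1' F\<^sub>2' where "F\<^sub>1' x = (\<integral>\<^sup>+s. F\<^sub>1 (x(i := a i s)) \<partial>M)" and "F\<^sub>2' x = (\<integral>\<^sup>+s. F\<^sub>2 (x(i := a i s)) \<partial>M)" for x
    have meas [measurable]: "F\<^sub>1' \<in> borel_measurable ?P" "F\<^sub>2' \<in> borel_measurable ?P"
        "(\<lambda>x. \<integral>\<^sup>+s. G (x(i := s)) \<partial>M) \<in> borel_measurable ?P"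
      unfolding F\<^sub>1'_def[abs_def] F\<^sub>2'_def[abs_def]
      using borel_measurable_nn_integral[OF ma[OF F1]] borel_measurable_nn_integral[OF ma[OF F2]]
        borel_measurable_nn_integral[OF m[OF G]] by auto
    have [measurable]: "G' \<in> borel_measurable ?P" unfolding G'_def by measurable
    have "ennreal (exp (- (\<Sum>i\<in>I. k i))) * (2 * (\<integral>\<^sup>+x. G' x \<partial>?P))
        \<le> ennreal s * (\<integral>\<^sup>+x. F\<^sub>1' (?a x) \<partial>?P) + ennreal (1 / s) * (\<integral>\<^sup>+x. F\<^sub>2' (?a x) \<partial>?P)"
    proof (rule shift_propertyD[OF insert.IH])
      fix s :: real and x assume s: "0 < s" and x: "x \<in> space ?P"
      have bx: "?b x \<in> space ?P" using measurable_space[OF am'(2) x] .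
      have [measurable]: "(\<lambda>s. F\<^sub>1 (x(i := s))) \<in> borel_measurable M" "(\<lambda>s. F\<^sub>2 ((?b x)(i := s))) \<in> borel_measurable M"
          "(\<lambda>s. G (x(i := s))) \<in> borel_measurable M"
        using measurable_Pair2[OF m[OF F1] x] measurable_Pair2[OF m[OF F2] bx] measurable_Pair2[OF m[OF G] x] by auto
      have "ennreal (exp (- k i)) * (2 * (\<integral>\<^sup>+t. G (x(i := t)) \<partial>M))
        \<le> ennreal s * (\<integral>\<^sup>+t. F\<^sub>1 (x(i := a i t)) \<partial>M) + ennreal (1 / s) * (\<integral>\<^sup>+t. F\<^sub>2 ((?b x)(i := a i t)) \<partial>M)"
      proof (rule shift_propertyD[OF shift, of "\<lambda>t. F\<^sub>1 (x(i := t))" "\<lambda>t. F\<^sub>2 ((?b x)(i := t))"])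
        fix r :: real and t assume r: "0 < r" and t: "t \<in> space M"
        have "x(i := t) \<in> space ?Q" using x t by (auto simp: space_PiM PiE_iff extensional_def)
        then show "2 * G (x(i := t)) \<le> ennreal r * F\<^sub>1 (x(i := t)) + ennreal (1 / r) * F\<^sub>2 ((?b x)(i := b t))"
          using le r a_upd(2)[of x t] by metis
      qed (use s in measurable)
      then show "2 * G' x \<le> ennreal s * F\<^sub>1' x + ennreal (1 / s) * F\<^sub>2' (?b x)"
        by (simp add: G'_def F\<^sub>1'_def F\<^sub>2'_def mult_ac)
    qed (use s in measurable)
    note IH = this
    have eqa: "(\<integral>\<^sup>+x. F (?a' x) \<partial>?Q) = (\<integral>\<^sup>+x. (\<integral>\<^sup>+s. F ((?a x)(i := a i s)) \<partial>M) \<partial>?P)"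
      if F: "F \<in> borel_measurable ?Q" for F :: "_ \<Rightarrow> ennreal"
    proof -
      have "(\<lambda>x. F (?a' x)) \<in> borel_measurable ?Q" using measurable_comp[OF am'(3) F] by (simp add: comp_def)
      then show ?thesis
        using product_nn_integral_insert[OF insert.hyps, of "\<lambda>x. F (?a' x)"] by (simp only: a_upd)
    qed
    have "(\<integral>\<^sup>+x. F\<^sub>1' (?a x) \<partial>?P) = (\<integral>\<^sup>+x. F\<^sub>1 (?a' x) \<partial>?Q)" "(\<integral>\<^sup>+x. F\<^sub>2' (?a x) \<partial>?P) = (\<integral>\<^sup>+x. F\<^sub>2 (?a' x) \<partial>?Q)"
      by (simp_all only: F\<^sub>1'_def F\<^sub>2'_def eqa[OF F1] eqa[OF F2])
    moreover have "(\<integral>\<^sup>+x. G' x \<partial>?P) = ennreal (exp (- k i)) * (\<integral>\<^sup>+x. G x \<partial>?Q)"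
      by (simp add: product_nn_integral_insert[OF insert.hyps G] G'_def nn_integral_cmult)
    moreover have "ennreal (exp (- (\<Sum>i\<in>insert i I. k i))) * (2 * X)
        = ennreal (exp (- (\<Sum>i\<in>I. k i))) * (2 * (ennreal (exp (- k i)) * X))" for X
    proof -
      have "exp (- (\<Sum>i\<in>insert i I. k i)) = exp (- (\<Sum>i\<in>I. k i)) * exp (- k i)"
        using insert.hyps by (simp add: exp_add[symmetric])
      then show ?thesis by (simp add: ennreal_mult mult_ac)
    qed
    ultimately show "ennreal (exp (- (\<Sum>i\<in>insert i I. k i))) * (2 * (\<integral>\<^sup>+x. G x \<partial>?Q))
        \<le> ennreal s * (\<integral>\<^sup>+x. F\<^sub>1 (?a' x) \<partial>?Q) + ennreal (1 / s) * (\<integral>\<^sup>+x. F\<^sub>2 (?a' x) \<partial>?Q)"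
      using IH by (simp only:)
  qed
qed

text \<open>For a symmetric set the indicator can play the role of all three functions, since s +
  1/s >= 2; the conclusion is used at s = 1.\<close>

lemma (in p_exp_law) shift_measure:
  fixes h :: "nat \<Rightarrow> real"
  assumes C: "C \<in> sets (PiM {..<N} (\<lambda>_. \<mu>))" and sym: "\<And>x. x \<in> C \<Longrightarrow> (\<lambda>i\<in>{..<N}. - x i) \<in> C"
  shows "exp (- (\<Sum>i<N. \<bar>h i\<bar> powr p / p)) * measure (PiM {..<N} (\<lambda>_. \<mu>)) C
    \<le> measure (PiM {..<N} (\<lambda>_. \<mu>)) {x \<in> space (PiM {..<N} (\<lambda>_. \<mu>)). (\<lambda>i\<in>{..<N}. x i + h i) \<in> C}"
proof -
  let ?P = "PiM {..<N} (\<lambda>_. \<mu>)"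
  interpret P: prob_space ?P by (intro prob_space_PiM \<mu>.prob_space_axioms)
  note [measurable] = C
  define a where "a x = (\<lambda>i\<in>{..<N}. x i + h i)" for x :: "nat \<Rightarrow> real"
  have [measurable]: "a \<in> measurable ?P ?P" unfolding a_def[abs_def] by measurable
  have sp: "shift_property ?P (\<lambda>x. \<lambda>i\<in>{..<N}. x i + h i) (\<lambda>x. \<lambda>i\<in>{..<N}. - x i) (\<Sum>i<N. \<bar>h i\<bar> powr p / p)"
    by (rule shift_property_PiM[OF \<mu>.sigma_finite_measure_axioms _ _ shift_property_p_exp]) auto
  have ind: "indicator C x = (indicator C (\<lambda>i\<in>{..<N}. - x i) :: ennreal)" if "x \<in> space ?P" for x
  proof -
    have "(\<lambda>i\<in>{..<N}. - (\<lambda>i\<in>{..<N}. - x i) i) = x"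
      using that by (auto simp: space_PiM PiE_def extensional_def fun_eq_iff)
    then show ?thesis using sym[of x] sym[of "\<lambda>i\<in>{..<N}. - x i"] by (auto simp: indicator_def)
  qed
  have "ennreal (exp (- (\<Sum>i<N. \<bar>h i\<bar> powr p / p))) * (2 * (\<integral>\<^sup>+x. indicator C x \<partial>?P))
      \<le> ennreal 1 * (\<integral>\<^sup>+x. indicator C (a x) \<partial>?P) + ennreal (1 / 1) * (\<integral>\<^sup>+x. indicator C (a x) \<partial>?P)"
    unfolding a_def
  proof (rule shift_propertyD[OF sp])
    fix s :: real and x assume s: "0 < s" and x: "x \<in> space ?P"
    have "0 \<le> (s - 1)\<^sup>2 / s" using s by simp
    also have "(s - 1)\<^sup>2 / s = s + 1 / s - 2" using s by (simp add: power2_eq_square field_simps)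
    finally have "ennreal 2 \<le> ennreal s + ennreal (1 / s)" using s by (simp add: ennreal_plus[symmetric] del: ennreal_plus)
    then show "2 * indicator C x \<le> ennreal s * indicator C x + ennreal (1 / s) * (indicator C (\<lambda>i\<in>{..<N}. - x i) :: ennreal)"
      unfolding ind[OF x, symmetric] by (simp add: indicator_def)
  qed auto
  also have "\<dots> = 2 * emeasure ?P {x \<in> space ?P. a x \<in> C}"
  proof -
    have "(\<integral>\<^sup>+x. indicator C (a x) \<partial>?P) = (\<integral>\<^sup>+x. indicator {x \<in> space ?P. a x \<in> C} x \<partial>?P)"
      by (intro nn_integral_cong) (auto simp: indicator_def)
    also have "\<dots> = emeasure ?P {x \<in> space ?P. a x \<in> C}" by (rule nn_integral_indicator) measurable
    finally show ?thesis by (simp add: mult_2)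
  qed
  finally have "ennreal 2 * ennreal (exp (- (\<Sum>i<N. \<bar>h i\<bar> powr p / p)) * measure ?P C) \<le> ennreal 2 * ennreal (measure ?P {x \<in> space ?P. a x \<in> C})"
    by (simp add: P.emeasure_eq_measure ennreal_mult mult_ac)
  then have "2 * (exp (- (\<Sum>i<N. \<bar>h i\<bar> powr p / p)) * measure ?P C) \<le> 2 * measure ?P {x \<in> space ?P. a x \<in> C}"
    by (simp only: ennreal_mult[symmetric] measure_nonneg zero_le_numeral mult_nonneg_nonneg exp_ge_zero ennreal_le_iff)
  then show ?thesis by (simp add: a_def)
qed

text \<open>Property tau for exp r times the indicator of A, and the indicator of B.\<close>

lemma (in p_exp_law) tau_measure:
  fixes N :: nat
  assumes A: "A \<in> sets (PiM {..<N} (\<lambda>_. \<mu>))" and B: "B \<in> sets (PiM {..<N} (\<lambda>_. \<mu>))"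
    and far: "\<And>x y. x \<in> A \<Longrightarrow> y \<in> B \<Longrightarrow> r \<le> (\<Sum>i<N. \<kappa> / 32 * two_level p (x i - y i))"
  shows "measure (PiM {..<N} (\<lambda>_. \<mu>)) A * measure (PiM {..<N} (\<lambda>_. \<mu>)) B \<le> exp (- r)"
proof -
  let ?P = "PiM {..<N} (\<lambda>_. \<mu>)"
  interpret P: prob_space ?P by (intro prob_space_PiM \<mu>.prob_space_axioms)
  note [measurable] = A B
  have tau: "property_tau ?P (\<lambda>x y. \<Sum>i<N. \<kappa> / 32 * two_level p (x i - y i))"
    by (rule property_tau_PiM[OF \<mu>.sigma_finite_measure_axioms property_tau_p_exp]) simp
  have "(\<integral>\<^sup>+x. ennreal (exp r) * indicator A x \<partial>?P) * (\<integral>\<^sup>+x. indicator B x \<partial>?P) \<le> 1"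
  proof (rule property_tauD[OF tau])
    show "ennreal (exp r) * indicator A x * indicator B y
      \<le> ennreal (exp (\<Sum>i<N. \<kappa> / 32 * two_level p (x i - y i)))" for x y
      using far[of x y] by (auto simp: indicator_def)
  qed auto
  then have "ennreal (exp r * (measure ?P A * measure ?P B)) \<le> 1"
    by (simp add: nn_integral_cmult P.emeasure_eq_measure ennreal_mult mult.assoc)
  then have "exp r * (measure ?P A * measure ?P B) \<le> 1" by (simp add: ennreal_le_1)
  then show ?thesis by (simp add: exp_minus field_simps)
qed

section \<open>The prior on the Banach space\<close>

text \<open>The p-th power of \<open>Z_norm\<close> on \<open>Z_space\<close>. It is a plain sum
  over the coordinates, and it is the quantity in the shift inequality and in the hypothesis on
  \<open>f\<close> and \<open>g\<close>.\<close>

definition Z_sum :: "real \<Rightarrow> (nat \<Rightarrow> real) \<Rightarrow> (nat \<Rightarrow> 'x::real_normed_vector) \<Rightarrow> 'x \<Rightarrow> real" where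
  "Z_sum p \<gamma> \<psi> h = (\<Sum>l. \<bar>coef \<psi> h l\<bar> powr p * \<gamma> l powr (- p))"

lemma Z_sum_nonneg: "h \<in> Z_space p \<gamma> \<psi> \<Longrightarrow> 0 \<le> Z_sum p \<gamma> \<psi> h"
  unfolding Z_sum_def Z_space_def by (intro suminf_nonneg) auto

lemma Z_norm_powr: "0 < p \<Longrightarrow> h \<in> Z_space p \<gamma> \<psi> \<Longrightarrow> Z_norm p \<gamma> \<psi> h powr p = Z_sum p \<gamma> \<psi> h"
  using Z_sum_nonneg[of h p \<gamma> \<psi>] by (simp add: Z_norm_def Z_sum_def[symmetric] powr_powr)

lemma coef_unique:
  assumes "schauder_basis \<psi>" "(\<lambda>l. c l *\<^sub>R \<psi> l) sums v"
  shows "coef \<psi> v = c"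
  using assms unfolding coef_def schauder_basis_def by (intro the1_equality) auto

lemma coef_sums:
  assumes "schauder_basis \<psi>"
  shows "(\<lambda>l. coef \<psi> v l *\<^sub>R \<psi> l) sums v"
  using theI'[OF spec[OF assms[unfolded schauder_basis_def], of v]] by (simp add: coef_def)

lemma coef_add:
  assumes "schauder_basis \<psi>"
  shows "coef \<psi> (u + v) l = coef \<psi> u l + coef \<psi> v l"
proof -
  have "(\<lambda>l. (coef \<psi> u l + coef \<psi> v l) *\<^sub>R \<psi> l) sums (u + v)"
    using sums_add[OF coef_sums[OF assms] coef_sums[OF assms]] by (simp add: scaleR_add_left)
  then show ?thesis using coef_unique[OF assms] by metis
qed

lemma coef_scaleR:
  assumes "schauder_basis \<psi>"
  shows "coef \<psi> (a *\<^sub>R v) l = a * coef \<psi> v l"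
proof -
  have "(\<lambda>l. (a * coef \<psi> v l) *\<^sub>R \<psi> l) sums (a *\<^sub>R v)"
    using bounded_linear.sums[OF bounded_linear_scaleR_right[of a] coef_sums[OF assms, of v]] by simp
  then show ?thesis using coef_unique[OF assms] by metis
qed

text \<open>The quasi-triangle inequality is Clarkson's inequality with the term of u - v
  dropped.\<close>

lemma Z_space_add:
  assumes b: "schauder_basis \<psi>" and p: "1 \<le> p" "p \<le> 2"
    and u: "u \<in> Z_space p \<gamma> \<psi>" and v: "v \<in> Z_space p \<gamma> \<psi>"
  shows "u + v \<in> Z_space p \<gamma> \<psi>" "Z_sum p \<gamma> \<psi> (u + v) \<le> 2 * (Z_sum p \<gamma> \<psi> u + Z_sum p \<gamma> \<psi> v)"
proof -
  let ?t = "\<lambda>h l. \<bar>coef \<psi> h l\<bar> powr p * \<gamma> l powr (- p)"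
  have s: "summable (?t u)" "summable (?t v)" using u v by (auto simp: Z_space_def)
  have s2: "summable (\<lambda>l. 2 * (?t u l + ?t v l))" by (intro summable_mult summable_add s)
  have le: "?t (u + v) l \<le> 2 * (?t u l + ?t v l)" for l
  proof -
    have "\<bar>coef \<psi> (u + v) l\<bar> powr p \<le> 2 * (\<bar>coef \<psi> u l\<bar> powr p + \<bar>coef \<psi> v l\<bar> powr p)"
    proof -
      have "0 \<le> \<bar>coef \<psi> u l - coef \<psi> v l\<bar> powr p" by simp
      then show ?thesis using clarkson[OF p, of "coef \<psi> u l" "coef \<psi> v l"]
        unfolding coef_add[OF b] by linarith
    qed
    then have "?t (u + v) l \<le> 2 * (\<bar>coef \<psi> u l\<bar> powr p + \<bar>coef \<psi> v l\<bar> powr p) * \<gamma> l powr (- p)"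
      by (intro mult_right_mono) auto
    then show ?thesis by (simp add: algebra_simps)
  qed
  have s3: "summable (?t (u + v))" by (rule summable_comparison_test'[OF s2, of 0]) (use le in auto)
  then show "u + v \<in> Z_space p \<gamma> \<psi>" by (simp add: Z_space_def)
  have "Z_sum p \<gamma> \<psi> (u + v) \<le> (\<Sum>l. 2 * (?t u l + ?t v l))"
    unfolding Z_sum_def by (intro suminf_le le s3 s2)
  also have "\<dots> = 2 * (Z_sum p \<gamma> \<psi> u + Z_sum p \<gamma> \<psi> v)"
    unfolding Z_sum_def suminf_mult[OF summable_add[OF s]] suminf_add[OF s] ..
  finally show "Z_sum p \<gamma> \<psi> (u + v) \<le> 2 * (Z_sum p \<gamma> \<psi> u + Z_sum p \<gamma> \<psi> v)" .
qed

lemma Z_space_scaleR: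
  assumes b: "schauder_basis \<psi>" and u: "u \<in> Z_space p \<gamma> \<psi>"
  shows "a *\<^sub>R u \<in> Z_space p \<gamma> \<psi>" "Z_sum p \<gamma> \<psi> (a *\<^sub>R u) = \<bar>a\<bar> powr p * Z_sum p \<gamma> \<psi> u"
proof -
  have eq: "\<bar>coef \<psi> (a *\<^sub>R u) l\<bar> powr p * \<gamma> l powr (- p) = \<bar>a\<bar> powr p * (\<bar>coef \<psi> u l\<bar> powr p * \<gamma> l powr (- p))" for l
    by (simp add: coef_scaleR[OF b] abs_mult powr_mult)
  have s: "summable (\<lambda>l. \<bar>coef \<psi> u l\<bar> powr p * \<gamma> l powr (- p))" using u by (simp add: Z_space_def)
  show "a *\<^sub>R u \<in> Z_space p \<gamma> \<psi>" unfolding Z_space_def by (simp only: mem_Collect_eq eq summable_mult[OF s])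
  show "Z_sum p \<gamma> \<psi> (a *\<^sub>R u) = \<bar>a\<bar> powr p * Z_sum p \<gamma> \<psi> u"
    unfolding Z_sum_def eq by (rule suminf_mult[OF s])
qed

lemma Q_space_scaleR:
  assumes b: "schauder_basis \<psi>" and u: "u \<in> Q_space \<gamma> \<psi>"
  shows "a *\<^sub>R u \<in> Q_space \<gamma> \<psi>" "Q_norm \<gamma> \<psi> (a *\<^sub>R u) = \<bar>a\<bar> * Q_norm \<gamma> \<psi> u"
proof -
  have eq: "(coef \<psi> (a *\<^sub>R u) l)\<^sup>2 * \<gamma> l powr (-2) = a\<^sup>2 * ((coef \<psi> u l)\<^sup>2 * \<gamma> l powr (-2))" for l
    by (simp add: coef_scaleR[OF b] power_mult_distrib)
  have s: "summable (\<lambda>l. (coef \<psi> u l)\<^sup>2 * \<gamma> l powr (-2))" using u by (simp add: Q_space_def)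
  show "a *\<^sub>R u \<in> Q_space \<gamma> \<psi>" unfolding Q_space_def by (simp only: mem_Collect_eq eq summable_mult[OF s])
  show "Q_norm \<gamma> \<psi> (a *\<^sub>R u) = \<bar>a\<bar> * Q_norm \<gamma> \<psi> u"
    unfolding Q_norm_def eq suminf_mult[OF s] by (simp add: real_sqrt_mult)
qed

text \<open>Coordinates are measured in units of \<open>\<gamma>\<close>: those of the prior become
  identically distributed, and the Q- and Z-norms become the Euclidean and the l^p norm of
  x.\<close>

definition basis_sum :: "(nat \<Rightarrow> real) \<Rightarrow> (nat \<Rightarrow> 'x::real_normed_vector) \<Rightarrow> nat \<Rightarrow> (nat \<Rightarrow> real) \<Rightarrow> 'x" where
  "basis_sum \<gamma> \<psi> N x = (\<Sum>l<N. (\<gamma> l * x l) *\<^sub>R \<psi> l)"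

lemma coef_basis_sum:
  assumes "schauder_basis \<psi>"
  shows "coef \<psi> (basis_sum \<gamma> \<psi> N x) = (\<lambda>l. if l < N then \<gamma> l * x l else 0)"
proof (rule coef_unique[OF assms])
  have "(\<lambda>l. if l \<in> {..<N} then (\<gamma> l * x l) *\<^sub>R \<psi> l else 0) sums basis_sum \<gamma> \<psi> N x"
    unfolding basis_sum_def by (rule sums_If_finite_set) simp
  then show "(\<lambda>l. (if l < N then \<gamma> l * x l else 0) *\<^sub>R \<psi> l) sums basis_sum \<gamma> \<psi> N x"
    by (rule sums_cong[THEN iffD1, rotated]) simp
qed

lemma basis_sum_Z:
  assumes b: "schauder_basis \<psi>" and \<gamma>: "\<And>l. 0 < \<gamma> l" and p: "0 < p"
  shows "basis_sum \<gamma> \<psi> N x \<in> Z_space p \<gamma> \<psi>" "Z_sum p \<gamma> \<psi> (basis_sum \<gamma> \<psi> N x) = (\<Sum>l<N. \<bar>x l\<bar> powr p)"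
proof -
  have "\<bar>coef \<psi> (basis_sum \<gamma> \<psi> N x) l\<bar> powr p * \<gamma> l powr (- p) = (if l \<in> {..<N} then \<bar>x l\<bar> powr p else 0)" for l
    using \<gamma>[of l] p by (simp add: coef_basis_sum[OF b] abs_mult powr_mult powr_minus field_simps)
  moreover have "(\<lambda>l. if l \<in> {..<N} then \<bar>x l\<bar> powr p else 0) sums (\<Sum>l<N. \<bar>x l\<bar> powr p)"
    by (rule sums_If_finite_set) simp
  ultimately have "(\<lambda>l. \<bar>coef \<psi> (basis_sum \<gamma> \<psi> N x) l\<bar> powr p * \<gamma> l powr (- p)) sums (\<Sum>l<N. \<bar>x l\<bar> powr p)"
    by simp
  then show "basis_sum \<gamma> \<psi> N x \<in> Z_space p \<gamma> \<psi>" "Z_sum p \<gamma> \<psi> (basis_sum \<gamma> \<psi> N x) = (\<Sum>l<N. \<bar>x l\<bar> powr p)"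
    by (auto simp: Z_space_def Z_sum_def sums_iff)
qed

lemma basis_sum_Q:
  assumes b: "schauder_basis \<psi>" and \<gamma>: "\<And>l. 0 < \<gamma> l"
  shows "basis_sum \<gamma> \<psi> N x \<in> Q_space \<gamma> \<psi>" "Q_norm \<gamma> \<psi> (basis_sum \<gamma> \<psi> N x) = sqrt (\<Sum>l<N. (x l)\<^sup>2)"
proof -
  have "(coef \<psi> (basis_sum \<gamma> \<psi> N x) l)\<^sup>2 * \<gamma> l powr (-2) = (if l \<in> {..<N} then (x l)\<^sup>2 else 0)" for l
  proof -
    have "\<gamma> l powr (-2) = 1 / (\<gamma> l)\<^sup>2" using \<gamma>[of l] by (simp add: powr_minus powr_numeral inverse_eq_divide)
    then show ?thesis using \<gamma>[of l] by (simp add: coef_basis_sum[OF b] power_mult_distrib)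
  qed
  moreover have "(\<lambda>l. if l \<in> {..<N} then (x l)\<^sup>2 else 0) sums (\<Sum>l<N. (x l)\<^sup>2)"
    by (rule sums_If_finite_set) simp
  ultimately have "(\<lambda>l. (coef \<psi> (basis_sum \<gamma> \<psi> N x) l)\<^sup>2 * \<gamma> l powr (-2)) sums (\<Sum>l<N. (x l)\<^sup>2)"
    by simp
  then show "basis_sum \<gamma> \<psi> N x \<in> Q_space \<gamma> \<psi>" "Q_norm \<gamma> \<psi> (basis_sum \<gamma> \<psi> N x) = sqrt (\<Sum>l<N. (x l)\<^sup>2)"
    by (auto simp: Q_space_def Q_norm_def sums_iff)
qed

section \<open>The prior, its truncations and its concentration\<close>

locale p_exp_prior = prob_space P
  for P :: "'w measure" +
  fixes p :: real and \<gamma> :: "nat \<Rightarrow> real" and \<psi> :: "nat \<Rightarrow> 'x::{banach, second_countable_topology}"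
    and W :: "'w \<Rightarrow> 'x"
  assumes p: "1 \<le> p" "p \<le> 2"
    and basis: "schauder_basis \<psi>"
    and W: "p_exponential_element p \<gamma> \<psi> P W"
begin

definition "\<xi> = (SOME \<xi>. prob_space.indep_vars P (\<lambda>_. borel) \<xi> UNIV \<and>
          (\<forall>l. distributed P lborel (\<xi> l) (\<lambda>x. ennreal (p_exp_density p x))) \<and>
          (AE \<omega> in P. (\<lambda>l. (\<gamma> l * \<xi> l \<omega>) *\<^sub>R \<psi> l) sums W \<omega>))"

lemma \<gamma>_pos: "0 < \<gamma> l" using W by (simp add: p_exponential_element_def)

lemma W_measurable [measurable]: "W \<in> borel_measurable P"
  using W by (simp add: p_exponential_element_def)

lemma \<xi>: "indep_vars (\<lambda>_. borel) \<xi> UNIV" "distributed P lborel (\<xi> l) (\<lambda>x. ennreal (p_exp_density p x))"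
    "AE \<omega> in P. (\<lambda>l. (\<gamma> l * \<xi> l \<omega>) *\<^sub>R \<psi> l) sums W \<omega>"
proof -
  have "\<exists>\<xi>. prob_space.indep_vars P (\<lambda>_. borel) \<xi> UNIV \<and>
          (\<forall>l. distributed P lborel (\<xi> l) (\<lambda>x. ennreal (p_exp_density p x))) \<and>
          (AE \<omega> in P. (\<lambda>l. (\<gamma> l * \<xi> l \<omega>) *\<^sub>R \<psi> l) sums W \<omega>)"
    using W by (simp add: p_exponential_element_def)
  from someI_ex[OF this] show "indep_vars (\<lambda>_. borel) \<xi> UNIV" "distributed P lborel (\<xi> l) (\<lambda>x. ennreal (p_exp_density p x))"
    "AE \<omega> in P. (\<lambda>l. (\<gamma> l * \<xi> l \<omega>) *\<^sub>R \<psi> l) sums W \<omega>"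
    unfolding \<xi>_def[symmetric] by auto
qed

lemma \<xi>_measurable [measurable]: "\<xi> l \<in> borel_measurable P"
  using distributed_measurable[OF \<xi>(2)[of l]] by simp

lemma distr_\<xi>: "distr P borel (\<xi> l) = density lborel (\<lambda>x. ennreal (p_exp_density p x))"
proof -
  have "distr P borel (\<xi> l) = distr P lborel (\<xi> l)" by (rule distr_cong) auto
  then show ?thesis using distributed_distr_eq_density[OF \<xi>(2)[of l]] by simp
qed

sublocale law: p_exp_law p
proof
  show "1 \<le> p" "p \<le> 2" by (fact p)+
  have "emeasure (distr P borel (\<xi> 0)) UNIV = 1" using emeasure_space_1 by (simp add: emeasure_distr)
  moreover have "(\<lambda>x. ennreal (p_exp_density p x)) \<in> borel_measurable lborel"
    using \<xi>(2)[of 0] by (simp add: distributed_def)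
  ultimately show "(\<integral>\<^sup>+x. ennreal (p_exp_density p x) \<partial>lborel) = 1"
    by (simp add: distr_\<xi> emeasure_density)
qed

abbreviation "\<mu>N N \<equiv> PiM {..<N} (\<lambda>_::nat. density lborel (\<lambda>x. ennreal (p_exp_density p x)))"

lemma distr_\<xi>_PiM: "distr P (\<mu>N N) (\<lambda>\<omega>. \<lambda>i\<in>{..<N}. \<xi> i \<omega>) = \<mu>N N"
\<comment> \<open>The characterization of independence by the joint law concerns nonempty index
  sets; for N = 0 both sides are the probability measure on a one-point space.\<close>
proof (cases "N = 0")
  case True
  interpret \<mu>N: prob_space "\<mu>N N" by (intro prob_space_PiM law.\<mu>.prob_space_axioms)
  show ?thesis
  proof (rule measure_eqI)
    fix A assume A: "A \<in> sets (distr P (\<mu>N N) (\<lambda>\<omega>. \<lambda>i\<in>{..<N}. \<xi> i \<omega>))"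
    have "(\<lambda>\<omega>. \<lambda>i\<in>{..<N}. \<xi> i \<omega>) \<in> measurable P (\<mu>N N)" by measurable
    moreover have "A = {} \<or> A = {\<lambda>_. undefined}" using A True by (auto simp: sets_PiM_empty)
    ultimately show "emeasure (distr P (\<mu>N N) (\<lambda>\<omega>. \<lambda>i\<in>{..<N}. \<xi> i \<omega>)) A = emeasure (\<mu>N N) A"
      using True A emeasure_space_1 \<mu>N.emeasure_space_1
      by (auto simp: emeasure_distr space_PiM restrict_def)
  qed simp
next
  case False
  have ind: "indep_vars (\<lambda>_. borel) \<xi> {..<N}" by (rule indep_vars_subset[OF \<xi>(1)]) auto
  have "distr P (PiM {..<N} (\<lambda>_. borel)) (\<lambda>\<omega>. \<lambda>i\<in>{..<N}. \<xi> i \<omega>) = PiM {..<N} (\<lambda>i. distr P borel (\<xi> i))"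
    using indep_vars_iff_distr_eq_PiM[of "{..<N}" \<xi> "\<lambda>_. borel"] ind False by auto
  also have "\<dots> = \<mu>N N" by (simp only: distr_\<xi>)
  also have "distr P (PiM {..<N} (\<lambda>_. borel)) (\<lambda>\<omega>. \<lambda>i\<in>{..<N}. \<xi> i \<omega>) = distr P (\<mu>N N) (\<lambda>\<omega>. \<lambda>i\<in>{..<N}. \<xi> i \<omega>)"
    by (intro distr_cong sets_PiM_cong) auto
  finally show ?thesis .
qed

abbreviation "S \<equiv> basis_sum \<gamma> \<psi>"

definition "WN N \<omega> = S N (\<lambda>i. \<xi> i \<omega>)"

lemma S_measurable [measurable]: "S N \<in> borel_measurable (PiM {..<N} (\<lambda>_. borel))"
  unfolding basis_sum_def[abs_def] by measurable

lemma WN_measurable [measurable]: "WN N \<in> borel_measurable P"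
  unfolding WN_def[abs_def] basis_sum_def by measurable

lemma prob_WN:
  assumes [measurable]: "B \<in> sets borel"
  shows "prob {\<omega> \<in> space P. WN N \<omega> \<in> B} = measure (\<mu>N N) {x \<in> space (\<mu>N N). S N x \<in> B}"
proof -
  have "measure (distr P (\<mu>N N) (\<lambda>\<omega>. \<lambda>i\<in>{..<N}. \<xi> i \<omega>)) {x \<in> space (\<mu>N N). S N x \<in> B}
      = prob ((\<lambda>\<omega>. \<lambda>i\<in>{..<N}. \<xi> i \<omega>) -` {x \<in> space (\<mu>N N). S N x \<in> B} \<inter> space P)"
    by (intro measure_distr) measurable
  also have "(\<lambda>\<omega>. \<lambda>i\<in>{..<N}. \<xi> i \<omega>) -` {x \<in> space (\<mu>N N). S N x \<in> B} \<inter> space P = {\<omega> \<in> space P. WN N \<omega> \<in> B}"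
    by (auto simp: WN_def basis_sum_def space_PiM)
  finally show ?thesis by (simp only: distr_\<xi>_PiM)
qed

text \<open>Almost sure convergence of the series implies convergence in probability, by dominated
  convergence of the indicators.\<close>

lemma truncation:
  assumes \<delta>: "0 < \<delta>"
  shows "(\<lambda>N. prob {\<omega> \<in> space P. \<delta> \<le> norm (W \<omega> - WN N \<omega>)}) \<longlonglongrightarrow> 0"
proof -
  let ?A = "\<lambda>N. {\<omega> \<in> space P. \<delta> \<le> norm (W \<omega> - WN N \<omega>)}"
  have "(\<lambda>N. LINT \<omega>|P. indicator (?A N) \<omega>) \<longlonglongrightarrow> (LINT \<omega>|P. (0::real))"
  proof (rule integral_dominated_convergence[where w = "\<lambda>_. 1"])
    show "AE \<omega> in P. (\<lambda>N. indicator (?A N) \<omega> :: real) \<longlonglongrightarrow> 0"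
      using \<xi>(3)
    proof eventually_elim
      fix \<omega> assume "(\<lambda>l. (\<gamma> l * \<xi> l \<omega>) *\<^sub>R \<psi> l) sums W \<omega>"
      then have "(\<lambda>N. WN N \<omega>) \<longlonglongrightarrow> W \<omega>" by (simp add: sums_def WN_def basis_sum_def)
      then have "eventually (\<lambda>N. dist (WN N \<omega>) (W \<omega>) < \<delta>) sequentially" using \<delta> by (rule tendstoD)
      then have "eventually (\<lambda>N. indicator (?A N) \<omega> = (0::real)) sequentially"
        by eventually_elim (auto simp: indicator_def dist_norm norm_minus_commute)
      then show "(\<lambda>N. indicator (?A N) \<omega> :: real) \<longlonglongrightarrow> 0" by (rule tendsto_eventually)
    qed
  qed (auto simp: indicator_def)
  then show ?thesis by simp
qed

end

declare borel_closed[OF closed_cball, measurable]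

context p_exp_prior begin

lemma prob_WN_ge:
  assumes \<epsilon>: "0 < \<epsilon>"
  shows "prob {\<omega> \<in> space P. norm (W \<omega>) \<le> \<epsilon>} - prob {\<omega> \<in> space P. \<epsilon> / 2 \<le> norm (W \<omega> - WN N \<omega>)}
     \<le> prob {\<omega> \<in> space P. WN N \<omega> \<in> cball 0 (3 / 2 * \<epsilon>)}"
proof -
  have "prob {\<omega> \<in> space P. norm (W \<omega>) \<le> \<epsilon>}
      \<le> prob ({\<omega> \<in> space P. WN N \<omega> \<in> cball 0 (3 / 2 * \<epsilon>)} \<union> {\<omega> \<in> space P. \<epsilon> / 2 \<le> norm (W \<omega> - WN N \<omega>)})"
  proof (rule finite_measure_mono)
    have "norm (WN N \<omega>) \<le> 3 / 2 * \<epsilon>" if "norm (W \<omega>) \<le> \<epsilon>" "\<not> \<epsilon> / 2 \<le> norm (W \<omega> - WN N \<omega>)" for \<omega>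
      using norm_triangle_ineq4[of "W \<omega>" "W \<omega> - WN N \<omega>"] that by simp
    then show "{\<omega> \<in> space P. norm (W \<omega>) \<le> \<epsilon>} \<subseteq> {\<omega> \<in> space P. WN N \<omega> \<in> cball 0 (3 / 2 * \<epsilon>)} \<union> {\<omega> \<in> space P. \<epsilon> / 2 \<le> norm (W \<omega> - WN N \<omega>)}"
      by auto
  qed measurable
  also have "\<dots> \<le> prob {\<omega> \<in> space P. WN N \<omega> \<in> cball 0 (3 / 2 * \<epsilon>)} + prob {\<omega> \<in> space P. \<epsilon> / 2 \<le> norm (W \<omega> - WN N \<omega>)}"
    by (rule measure_Un_le) measurable
  finally show ?thesis by simp
qed

text \<open>The radius doubles because of the truncation: eps/2 is spent on passing from W to a
  partial sum, eps/4 on passing back, and eps/4 on the tail of the series of h.\<close>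

lemma prob_shift:
  assumes h: "h \<in> Z_space p \<gamma> \<psi>" and \<epsilon>: "0 < \<epsilon>"
  shows "exp (- (Z_sum p \<gamma> \<psi> h / p)) * prob {\<omega> \<in> space P. norm (W \<omega>) \<le> \<epsilon>}
    \<le> prob {\<omega> \<in> space P. norm (W \<omega> - h) < 2 * \<epsilon>}"
proof -
  define E where "E = exp (- (Z_sum p \<gamma> \<psi> h / p))"
  \<comment> \<open>The sign is negative because the shift acts inside the event: x + k in a centred
    ball means that the partial sum of the prior is near \<open>- S N k\<close>, which is a partial
    sum of h.\<close>
  define k where "k l = - (coef \<psi> h l / \<gamma> l)" for l
  define t1 where "t1 N = prob {\<omega> \<in> space P. \<epsilon> / 2 \<le> norm (W \<omega> - WN N \<omega>)}" for N
  define t2 where "t2 N = prob {\<omega> \<in> space P. \<epsilon> / 4 \<le> norm (W \<omega> - WN N \<omega>)}" for N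
  have Sk: "S N k = - (\<Sum>l<N. coef \<psi> h l *\<^sub>R \<psi> l)" for N
    unfolding basis_sum_def k_def sum_negf[symmetric] using \<gamma>_pos by (intro sum.cong) (auto simp: less_imp_neq[symmetric])
  have lim: "(\<lambda>N. - S N k) \<longlonglongrightarrow> h"
    using coef_sums[OF basis, of h] by (simp add: Sk sums_def)
  have zle: "(\<Sum>i<N. \<bar>k i\<bar> powr p / p) \<le> Z_sum p \<gamma> \<psi> h / p" for N
  proof -
    have "(\<Sum>i<N. \<bar>k i\<bar> powr p) = (\<Sum>l<N. \<bar>coef \<psi> h l\<bar> powr p * \<gamma> l powr (- p))"
      proof (intro sum.cong refl)
      fix l
      have "\<bar>k l\<bar> = \<bar>coef \<psi> h l\<bar> / \<gamma> l" using \<gamma>_pos[of l] by (simp add: k_def abs_divide)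
      then show "\<bar>k l\<bar> powr p = \<bar>coef \<psi> h l\<bar> powr p * \<gamma> l powr (- p)"
        using \<gamma>_pos[of l] by (simp add: powr_divide powr_minus_divide)
    qed
    also have "\<dots> \<le> Z_sum p \<gamma> \<psi> h"
      unfolding Z_sum_def using h by (intro sum_le_suminf) (auto simp: Z_space_def)
    finally show ?thesis using p by (simp add: sum_divide_distrib[symmetric] divide_right_mono)
  qed
  have main: "E * (prob {\<omega> \<in> space P. norm (W \<omega>) \<le> \<epsilon>} - t1 N) \<le> prob {\<omega> \<in> space P. norm (W \<omega> - h) < 2 * \<epsilon>} + t2 N"
    if N: "norm (- S N k - h) < \<epsilon> / 4" for N
  proof -
    define C where "C = {x \<in> space (\<mu>N N). S N x \<in> cball 0 (3 / 2 * \<epsilon>)}"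
    have C: "C \<in> sets (\<mu>N N)" unfolding C_def by measurable
    have "E * (prob {\<omega> \<in> space P. norm (W \<omega>) \<le> \<epsilon>} - t1 N) \<le> E * prob {\<omega> \<in> space P. WN N \<omega> \<in> cball 0 (3 / 2 * \<epsilon>)}"
      unfolding t1_def E_def by (intro mult_left_mono prob_WN_ge \<epsilon>) auto
    also have "\<dots> = E * measure (\<mu>N N) C" unfolding C_def by (simp only: prob_WN[OF borel_closed[OF closed_cball]])
    also have "\<dots> \<le> exp (- (\<Sum>i<N. \<bar>k i\<bar> powr p / p)) * measure (\<mu>N N) C"
      unfolding E_def using zle by (intro mult_right_mono) auto
    also have "\<dots> \<le> measure (\<mu>N N) {x \<in> space (\<mu>N N). (\<lambda>i\<in>{..<N}. x i + k i) \<in> C}"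
    proof (rule law.shift_measure[OF C])
      fix x assume x: "x \<in> C"
      have "S N (\<lambda>i\<in>{..<N}. - x i) = - S N x" by (simp add: basis_sum_def sum_negf)
      then show "(\<lambda>i\<in>{..<N}. - x i) \<in> C" using x by (auto simp: C_def space_PiM)
    qed
    also have "{x \<in> space (\<mu>N N). (\<lambda>i\<in>{..<N}. x i + k i) \<in> C} = {x \<in> space (\<mu>N N). S N x \<in> cball (- S N k) (3 / 2 * \<epsilon>)}"
    proof -
      have "S N (\<lambda>i\<in>{..<N}. x i + k i) = S N x + S N k" for x
        by (simp add: basis_sum_def sum.distrib[symmetric] algebra_simps)
      moreover have "norm (S N x + S N k) = dist (- S N k) (S N x)" for x
        by (metis add.commute diff_minus_eq_add dist_commute dist_norm)
      ultimately show ?thesis by (auto simp: C_def space_PiM)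
    qed
    also have "measure (\<mu>N N) \<dots> = prob {\<omega> \<in> space P. WN N \<omega> \<in> cball (- S N k) (3 / 2 * \<epsilon>)}"
      by (simp only: prob_WN[OF borel_closed[OF closed_cball]])
    also have "\<dots> \<le> prob ({\<omega> \<in> space P. norm (W \<omega> - h) < 2 * \<epsilon>} \<union> {\<omega> \<in> space P. \<epsilon> / 4 \<le> norm (W \<omega> - WN N \<omega>)})"
    proof (rule finite_measure_mono)
      have "norm (W \<omega> - h) < 2 * \<epsilon>" if "dist (- S N k) (WN N \<omega>) \<le> 3 / 2 * \<epsilon>" "\<not> \<epsilon> / 4 \<le> norm (W \<omega> - WN N \<omega>)" for \<omega>
      proof -
        have "W \<omega> - h = (W \<omega> - WN N \<omega>) + (WN N \<omega> - - S N k) + (- S N k - h)" by simp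
        then have "norm (W \<omega> - h) \<le> norm (W \<omega> - WN N \<omega>) + norm (WN N \<omega> - - S N k) + norm (- S N k - h)"
          using norm_triangle_ineq[of "(W \<omega> - WN N \<omega>) + (WN N \<omega> - - S N k)" "- S N k - h"]
            norm_triangle_ineq[of "W \<omega> - WN N \<omega>" "WN N \<omega> - - S N k"] by (simp only:)
        moreover have "norm (WN N \<omega> - - S N k) \<le> 3 / 2 * \<epsilon>"
          using that(1) by (metis dist_commute dist_norm)
        ultimately show ?thesis using that(2) N by linarith
      qed
      then show "{\<omega> \<in> space P. WN N \<omega> \<in> cball (- S N k) (3 / 2 * \<epsilon>)}
         \<subseteq> {\<omega> \<in> space P. norm (W \<omega> - h) < 2 * \<epsilon>} \<union> {\<omega> \<in> space P. \<epsilon> / 4 \<le> norm (W \<omega> - WN N \<omega>)}" by auto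
    qed measurable
    also have "\<dots> \<le> prob {\<omega> \<in> space P. norm (W \<omega> - h) < 2 * \<epsilon>} + t2 N"
      unfolding t2_def by (rule measure_Un_le) measurable
    finally show ?thesis .
  qed
  have ev: "eventually (\<lambda>N. norm (- S N k - h) < \<epsilon> / 4) sequentially"
    using tendstoD[OF lim, of "\<epsilon> / 4"] \<epsilon> by (simp add: dist_norm)
  have 1: "(\<lambda>N. E * (prob {\<omega> \<in> space P. norm (W \<omega>) \<le> \<epsilon>} - t1 N)) \<longlonglongrightarrow> E * (prob {\<omega> \<in> space P. norm (W \<omega>) \<le> \<epsilon>} - 0)"
    unfolding t1_def using \<epsilon> by (intro tendsto_intros truncation) simp
  have 2: "(\<lambda>N. prob {\<omega> \<in> space P. norm (W \<omega> - h) < 2 * \<epsilon>} + t2 N) \<longlonglongrightarrow> prob {\<omega> \<in> space P. norm (W \<omega> - h) < 2 * \<epsilon>} + 0"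
    unfolding t2_def using \<epsilon> by (intro tendsto_intros truncation) simp
  have "E * (prob {\<omega> \<in> space P. norm (W \<omega>) \<le> \<epsilon>} - 0) \<le> prob {\<omega> \<in> space P. norm (W \<omega> - h) < 2 * \<epsilon>} + 0"
    by (rule tendsto_le[OF sequentially_bot 2 1 eventually_mono[OF ev main]])
  then show ?thesis by (simp add: E_def)
qed

text \<open>The strict inequality makes this a union of open balls, hence a Borel set, whatever the
  Q- and Z-balls look like.\<close>

definition sieve :: "real \<Rightarrow> real \<Rightarrow> 'x set" where
  "sieve R \<epsilon> = {v. \<exists>q z. q \<in> Q_space \<gamma> \<psi> \<and> (Q_norm \<gamma> \<psi> q)\<^sup>2 \<le> R \<and> z \<in> Z_space p \<gamma> \<psi> \<and> Z_sum p \<gamma> \<psi> z \<le> R \<and> norm (v - (q + z)) < \<epsilon>}"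

lemma open_sieve: "open (sieve R \<epsilon>)"
proof -
  have b: "ball c \<epsilon> = {v. norm (v - c) < \<epsilon>}" for c :: 'x
    by (simp add: ball_def dist_norm norm_minus_commute)
  have "sieve R \<epsilon> = (\<Union>q\<in>{q \<in> Q_space \<gamma> \<psi>. (Q_norm \<gamma> \<psi> q)\<^sup>2 \<le> R}. \<Union>z\<in>{z \<in> Z_space p \<gamma> \<psi>. Z_sum p \<gamma> \<psi> z \<le> R}. ball (q + z) \<epsilon>)"
    unfolding sieve_def b by blast
  then show ?thesis by auto
qed

lemma sieve_borel [measurable]: "sieve R \<epsilon> \<in> sets borel"
  using open_sieve by simp

definition "k\<^sub>0 = law.\<kappa> / 32"

lemma k0_pos: "0 < k\<^sub>0" using law.kappa_pos by (simp add: k\<^sub>0_def)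

text \<open>The coordinates of y - x are split at modulus 1. On the small ones, collected in a, the
  cost is the square; on the others, collected in b, it is the p-th power. If the total cost were
  below r, a and b would place y in the sieve.\<close>

lemma sieve_decomposition:
  assumes y: "S N y \<notin> sieve (r / k\<^sub>0) (7 / 4 * \<epsilon>)" and x: "norm (S N x) \<le> 3 / 2 * \<epsilon>" and \<epsilon>: "0 < \<epsilon>"
  shows "r \<le> (\<Sum>i<N. k\<^sub>0 * two_level p (x i - y i))"
proof (rule ccontr)
  assume "\<not> ?thesis"
  then have small: "(\<Sum>i<N. two_level p (x i - y i)) < r / k\<^sub>0"
    using k0_pos by (simp add: sum_distrib_left[symmetric] pos_less_divide_eq mult.commute)
  define a where "a i = (if \<bar>y i - x i\<bar> \<le> 1 then y i - x i else 0)" for i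
  define b where "b i = (if \<bar>y i - x i\<bar> \<le> 1 then 0 else y i - x i)" for i
  have ab: "(a i)\<^sup>2 \<le> two_level p (x i - y i)" "\<bar>b i\<bar> powr p \<le> two_level p (x i - y i)" for i
  proof -
    define u where "u = \<bar>y i - x i\<bar>"
    have u0: "u \<ge> 0" by (simp add: u_def)
    have tl: "two_level p (x i - y i) = min (u\<^sup>2) (u powr p)"
      by (simp add: two_level_def u_def abs_minus_commute power2_commute)
    have "u\<^sup>2 \<le> u powr p" if "u \<le> 1"
    proof (cases "u = 0")
      case False
      then have "u powr 2 \<le> u powr p" using that u0 p by (intro powr_mono') auto
      then show ?thesis using False u0 by (simp add: powr_numeral)
    qed auto
    moreover have "u powr p \<le> u\<^sup>2" if "\<not> u \<le> 1"
    proof -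
      have "u powr p \<le> u powr 2" using that p by (intro powr_mono) auto
      then show ?thesis using that by (simp add: powr_numeral)
    qed
    moreover have "(y i - x i)\<^sup>2 = u\<^sup>2" by (simp add: u_def)
    ultimately show "(a i)\<^sup>2 \<le> two_level p (x i - y i)" "\<bar>b i\<bar> powr p \<le> two_level p (x i - y i)"
      unfolding tl a_def b_def using u0 by (auto simp: u_def[symmetric])
  qed
  have "(\<Sum>i<N. (a i)\<^sup>2) \<le> (\<Sum>i<N. two_level p (x i - y i))" by (intro sum_mono ab)
  then have "(\<Sum>i<N. (a i)\<^sup>2) \<le> r / k\<^sub>0" using small by linarith
  then have "(Q_norm \<gamma> \<psi> (S N a))\<^sup>2 \<le> r / k\<^sub>0" by (simp add: basis_sum_Q[OF basis \<gamma>_pos] sum_nonneg)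
  moreover have "(\<Sum>i<N. \<bar>b i\<bar> powr p) \<le> (\<Sum>i<N. two_level p (x i - y i))" by (intro sum_mono ab)
  then have "(\<Sum>i<N. \<bar>b i\<bar> powr p) \<le> r / k\<^sub>0" using small by linarith
  then have "Z_sum p \<gamma> \<psi> (S N b) \<le> r / k\<^sub>0" using p by (subst basis_sum_Z[OF basis \<gamma>_pos]) auto
  moreover have "S N y - (S N a + S N b) = S N x"
  proof -
    have "a i + b i = y i - x i" for i by (simp add: a_def b_def)
    then have "S N a + S N b = S N (\<lambda>i. y i - x i)"
      by (simp add: basis_sum_def sum.distrib[symmetric] scaleR_add_left[symmetric] distrib_left[symmetric])
    then show ?thesis by (simp add: basis_sum_def sum_subtractf[symmetric] algebra_simps)
  qed
  then have "norm (S N y - (S N a + S N b)) < 7 / 4 * \<epsilon>" using x \<epsilon> by simp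
  moreover have "S N a \<in> Q_space \<gamma> \<psi>" by (rule basis_sum_Q(1)[OF basis \<gamma>_pos])
  moreover have "S N b \<in> Z_space p \<gamma> \<psi>" by (rule basis_sum_Z(1)[OF basis \<gamma>_pos]) (use p in simp)
  ultimately have "S N y \<in> sieve (r / k\<^sub>0) (7 / 4 * \<epsilon>)"
    unfolding sieve_def by blast
  then show False using y by contradiction
qed

text \<open>A point outside the sieve is at cost at least r from every point of the small ball, so
  property tau bounds the product of the masses. The radii 3/2 eps and 7/4 eps used for the partial
  sums leave room for the truncation on both sides.\<close>

lemma two_level_concentration:
  assumes \<epsilon>: "0 < \<epsilon>"
  shows "prob {\<omega> \<in> space P. norm (W \<omega>) \<le> \<epsilon>} * prob {\<omega> \<in> space P. W \<omega> \<notin> sieve (r / k\<^sub>0) (2 * \<epsilon>)} \<le> exp (- r)"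
proof -
  define b where "b = prob {\<omega> \<in> space P. norm (W \<omega>) \<le> \<epsilon>}"
  define a where "a = prob {\<omega> \<in> space P. W \<omega> \<notin> sieve (r / k\<^sub>0) (2 * \<epsilon>)}"
  define t1 where "t1 N = prob {\<omega> \<in> space P. \<epsilon> / 2 \<le> norm (W \<omega> - WN N \<omega>)}" for N
  define t2 where "t2 N = prob {\<omega> \<in> space P. \<epsilon> / 4 \<le> norm (W \<omega> - WN N \<omega>)}" for N
  have lim: "t1 \<longlonglongrightarrow> 0" "t2 \<longlonglongrightarrow> 0" unfolding t1_def t2_def by (rule truncation; use \<epsilon> in simp)+
  \<comment> \<open>The lower bounds for the two masses can be multiplied if one of them is
    nonnegative; this one is so for large N unless b = 0.\<close>
  have main: "(b - t1 N) * (a - t2 N) \<le> exp (- r)" if N: "0 \<le> b - t1 N" for N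
  proof -
    define A where "A = {x \<in> space (\<mu>N N). S N x \<in> cball 0 (3 / 2 * \<epsilon>)}"
    define B where "B = {x \<in> space (\<mu>N N). S N x \<in> - sieve (r / k\<^sub>0) (7 / 4 * \<epsilon>)}"
    have AB: "A \<in> sets (\<mu>N N)" "B \<in> sets (\<mu>N N)" unfolding A_def B_def by measurable
    have "measure (\<mu>N N) A * measure (\<mu>N N) B \<le> exp (- r)"
    proof (rule law.tau_measure[OF AB])
      fix x y assume "x \<in> A" "y \<in> B"
      then have "norm (S N x) \<le> 3 / 2 * \<epsilon>" "S N y \<notin> sieve (r / k\<^sub>0) (7 / 4 * \<epsilon>)"
        unfolding A_def B_def mem_Collect_eq Compl_iff mem_cball dist_0_norm by blast+
      from sieve_decomposition[OF this(2,1) \<epsilon>]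
      show "r \<le> (\<Sum>i<N. law.\<kappa> / 32 * two_level p (x i - y i))" unfolding k\<^sub>0_def .
    qed
    moreover have bA: "b - t1 N \<le> measure (\<mu>N N) A"
      using prob_WN_ge[OF \<epsilon>, of N] unfolding b_def t1_def A_def by (simp only: prob_WN[OF borel_closed[OF closed_cball]])
    moreover have "a - t2 N \<le> measure (\<mu>N N) B"
    proof -
      have "a \<le> prob ({\<omega> \<in> space P. WN N \<omega> \<in> - sieve (r / k\<^sub>0) (7 / 4 * \<epsilon>)} \<union> {\<omega> \<in> space P. \<epsilon> / 4 \<le> norm (W \<omega> - WN N \<omega>)})"
        unfolding a_def
      proof (rule finite_measure_mono)
        have "W \<omega> \<in> sieve (r / k\<^sub>0) (2 * \<epsilon>)" if in_sieve: "WN N \<omega> \<in> sieve (r / k\<^sub>0) (7 / 4 * \<epsilon>)" and close: "\<not> \<epsilon> / 4 \<le> norm (W \<omega> - WN N \<omega>)" for \<omega>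
        proof -
          obtain q z where qz: "q \<in> Q_space \<gamma> \<psi>" "(Q_norm \<gamma> \<psi> q)\<^sup>2 \<le> r / k\<^sub>0" "z \<in> Z_space p \<gamma> \<psi>" "Z_sum p \<gamma> \<psi> z \<le> r / k\<^sub>0"
            "norm (WN N \<omega> - (q + z)) < 7 / 4 * \<epsilon>" using in_sieve unfolding sieve_def by blast
          have "norm (W \<omega> - (q + z)) \<le> norm (W \<omega> - WN N \<omega>) + norm (WN N \<omega> - (q + z))"
          proof -
            have "W \<omega> - (q + z) = (W \<omega> - WN N \<omega>) + (WN N \<omega> - (q + z))" by simp
            then show ?thesis by (simp only: norm_triangle_ineq)
          qed
          then have "norm (W \<omega> - (q + z)) < 2 * \<epsilon>" using qz(5) close by simp
          then show ?thesis using qz unfolding sieve_def by blast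
        qed
        then show "{\<omega> \<in> space P. W \<omega> \<notin> sieve (r / k\<^sub>0) (2 * \<epsilon>)} \<subseteq>
          {\<omega> \<in> space P. WN N \<omega> \<in> - sieve (r / k\<^sub>0) (7 / 4 * \<epsilon>)} \<union> {\<omega> \<in> space P. \<epsilon> / 4 \<le> norm (W \<omega> - WN N \<omega>)}" by auto
      qed measurable
      also have "\<dots> \<le> prob {\<omega> \<in> space P. WN N \<omega> \<in> - sieve (r / k\<^sub>0) (7 / 4 * \<epsilon>)} + t2 N"
        unfolding t2_def by (rule measure_Un_le) measurable
      also have "prob {\<omega> \<in> space P. WN N \<omega> \<in> - sieve (r / k\<^sub>0) (7 / 4 * \<epsilon>)} = measure (\<mu>N N) B"
        unfolding B_def by (rule prob_WN) measurable
      finally show ?thesis by simp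
    qed
    ultimately have "(b - t1 N) * (a - t2 N) \<le> measure (\<mu>N N) A * measure (\<mu>N N) B"
      using N by (meson measure_nonneg mult_left_mono mult_right_mono order_trans)
    then show ?thesis using \<open>measure (\<mu>N N) A * measure (\<mu>N N) B \<le> exp (- r)\<close> by simp
  qed
  show ?thesis
  proof (cases "b = 0")
    case False
    then have "0 < b" by (simp add: b_def zero_less_measure_iff)
    then have "eventually (\<lambda>N. t1 N < b) sequentially" by (rule order_tendstoD(2)[OF lim(1)])
    then have ev: "eventually (\<lambda>N. (b - t1 N) * (a - t2 N) \<le> exp (- r)) sequentially"
      by eventually_elim (use main in auto)
    have "(\<lambda>N. (b - t1 N) * (a - t2 N)) \<longlonglongrightarrow> (b - 0) * (a - 0)" by (intro tendsto_intros lim)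
    then have "(b - 0) * (a - 0) \<le> exp (- r)" by (rule tendsto_upperbound[OF _ ev]) simp
    then show ?thesis by (simp add: a_def b_def)
  qed (simp add: b_def)
qed

text \<open>A maximal \<open>4\<epsilon>\<close>-separated subset is a net, and the disjoint \<open>2\<epsilon>\<close>-balls around its points all have
  the prior mass guaranteed by the shift inequality.\<close>

lemma Z_ball_net:
  assumes \<epsilon>: "0 < \<epsilon>" and pos: "0 < prob {\<omega> \<in> space P. norm (W \<omega>) \<le> \<epsilon>}"
  obtains D where "finite D" "real (card D) \<le> exp (R / p) / prob {\<omega> \<in> space P. norm (W \<omega>) \<le> \<epsilon>}"
    "\<And>z. z \<in> Z_space p \<gamma> \<psi> \<Longrightarrow> Z_sum p \<gamma> \<psi> z \<le> R \<Longrightarrow> \<exists>d\<in>D. norm (z - d) < 4 * \<epsilon>"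
proof -
  define b where "b = prob {\<omega> \<in> space P. norm (W \<omega>) \<le> \<epsilon>}"
  define ZB where "ZB = {z \<in> Z_space p \<gamma> \<psi>. Z_sum p \<gamma> \<psi> z \<le> R}"
  define sep where "sep D \<longleftrightarrow> finite D \<and> D \<subseteq> ZB \<and> (\<forall>x\<in>D. \<forall>y\<in>D. x \<noteq> y \<longrightarrow> 4 * \<epsilon> \<le> norm (x - y))" for D
  have bound: "real (card D) \<le> exp (R / p) / b" if D: "sep D" for D
  proof -
    let ?B = "\<lambda>d. {\<omega> \<in> space P. norm (W \<omega> - d) < 2 * \<epsilon>}"
    have "real (card D) * (exp (- (R / p)) * b) = (\<Sum>d\<in>D. exp (- (R / p)) * b)" by simp
    also have "\<dots> \<le> (\<Sum>d\<in>D. prob (?B d))"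
    proof (rule sum_mono)
      fix d assume "d \<in> D"
      then have d: "d \<in> Z_space p \<gamma> \<psi>" "Z_sum p \<gamma> \<psi> d \<le> R" using D by (auto simp: sep_def ZB_def)
      have "exp (- (R / p)) * b \<le> exp (- (Z_sum p \<gamma> \<psi> d / p)) * b"
        using d(2) p by (intro mult_right_mono) (auto simp: b_def divide_right_mono)
      also have "\<dots> \<le> prob (?B d)" unfolding b_def by (rule prob_shift[OF d(1) \<epsilon>])
      finally show "exp (- (R / p)) * b \<le> prob (?B d)" .
    qed
    also have "\<dots> = prob (\<Union>d\<in>D. ?B d)"
    proof (rule finite_measure_finite_Union[symmetric])
      show "disjoint_family_on ?B D"
        unfolding disjoint_family_on_def
      proof (intro ballI impI)
        fix x y assume "x \<in> D" "y \<in> D" "x \<noteq> y"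
        then have far: "4 * \<epsilon> \<le> norm (x - y)" using D by (auto simp: sep_def)
        have False if "norm (W \<omega> - x) < 2 * \<epsilon>" "norm (W \<omega> - y) < 2 * \<epsilon>" for \<omega>
        proof -
          have "norm (x - y) \<le> norm (W \<omega> - y) + norm (W \<omega> - x)"
            using norm_triangle_ineq4[of "W \<omega> - y" "W \<omega> - x"] by simp
          then show False using far that by linarith
        qed
        then show "?B x \<inter> ?B y = {}" by blast
      qed
    qed (use D in \<open>auto simp: sep_def\<close>)
    also have "\<dots> \<le> 1" by (rule prob_le_1)
    finally have "real (card D) * (exp (- (R / p)) * b) \<le> 1" .
    then show ?thesis using pos by (simp add: b_def exp_minus field_simps)
  qed
  define n where "n = Max (card ` {D. sep D})"
  have fin: "finite (card ` {D. sep D})"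
  proof (rule finite_subset)
    show "card ` {D. sep D} \<subseteq> {.. nat \<lfloor>exp (R / p) / b\<rfloor>}"
      using bound by (auto simp: le_nat_floor)
  qed simp
  have "sep {}" by (simp add: sep_def)
  then have "n \<in> card ` {D. sep D}" unfolding n_def using fin by (intro Max_in) auto
  then obtain D where D: "sep D" "card D = n" by auto
  show ?thesis
  proof
    show "finite D" using D by (simp add: sep_def)
    show "real (card D) \<le> exp (R / p) / prob {\<omega> \<in> space P. norm (W \<omega>) \<le> \<epsilon>}" using bound[OF D(1)] by (simp add: b_def)
    fix z assume z: "z \<in> Z_space p \<gamma> \<psi>" "Z_sum p \<gamma> \<psi> z \<le> R"
    show "\<exists>d\<in>D. norm (z - d) < 4 * \<epsilon>"
    proof (rule ccontr)
      assume far: "\<not> ?thesis"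
      then have "z \<notin> D" using \<epsilon> by force
      moreover have "sep (insert z D)" using D(1) z far
        by (auto simp: sep_def ZB_def not_less norm_minus_commute)
      ultimately have "Suc n \<in> card ` {D. sep D}" using D by (intro image_eqI[of _ _ "insert z D"]) (auto simp: sep_def)
      then have "Suc n \<le> n" unfolding n_def using fin by (intro Max_ge)
      then show False by simp
    qed
  qed
qed

text \<open>By uniqueness of coefficients, W = 0 almost surely forces the coordinate
  \<open>\<xi> 0\<close> to vanish, and that coordinate has a density.\<close>

lemma prob_W_zero: "prob {\<omega> \<in> space P. W \<omega> = 0} = 0"
proof -
  have "AE \<omega> in distr P borel (\<xi> 0). \<omega> \<noteq> 0"
    unfolding distr_\<xi> by (subst AE_density) (auto intro: eventually_mono[OF AE_lborel_singleton[of 0]])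
  then have "AE \<omega> in P. \<xi> 0 \<omega> \<noteq> 0" by (subst (asm) AE_distr_iff) auto
  then have "AE \<omega> in P. W \<omega> \<noteq> 0" using \<xi>(3)
  proof eventually_elim
    fix \<omega> assume *: "\<xi> 0 \<omega> \<noteq> 0" "(\<lambda>l. (\<gamma> l * \<xi> l \<omega>) *\<^sub>R \<psi> l) sums W \<omega>"
    show "W \<omega> \<noteq> 0"
    proof
      assume "W \<omega> = 0"
      then have "coef \<psi> 0 = (\<lambda>l. \<gamma> l * \<xi> l \<omega>)" using * by (intro coef_unique[OF basis]) simp
      moreover have "coef \<psi> 0 = (\<lambda>l. 0)" by (intro coef_unique[OF basis]) simp
      ultimately have "\<gamma> 0 * \<xi> 0 \<omega> = 0" by metis
      then show False using *(1) \<gamma>_pos[of 0] by simp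
    qed
  qed
  then show ?thesis by (simp add: prob_eq_0)
qed

lemma small_ball_tendsto: 
  assumes "0 < \<eta>"
  obtains c where "0 < c" "prob {\<omega> \<in> space P. norm (W \<omega>) \<le> c} < \<eta>"
proof -
  have "(\<lambda>n. prob {\<omega> \<in> space P. norm (W \<omega>) \<le> 1 / real (Suc n)}) \<longlonglongrightarrow> prob (\<Inter>n. {\<omega> \<in> space P. norm (W \<omega>) \<le> 1 / real (Suc n)})"
  proof (rule finite_Lim_measure_decseq)
    show "decseq (\<lambda>n. {\<omega> \<in> space P. norm (W \<omega>) \<le> 1 / real (Suc n)})"
      by (auto simp: decseq_def intro: order_trans[OF _ divide_left_mono])
  qed auto
  also have "(\<Inter>n. {\<omega> \<in> space P. norm (W \<omega>) \<le> 1 / real (Suc n)}) = {\<omega> \<in> space P. W \<omega> = 0}"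
  proof -
    have "W \<omega> = 0" if "\<And>n. norm (W \<omega>) \<le> 1 / real (Suc n)" for \<omega>
    proof (rule ccontr)
      assume "W \<omega> \<noteq> 0"
      then obtain n where "1 / real (Suc n) < norm (W \<omega>)" using nat_approx_posE[of "norm (W \<omega>)"] by auto
      then show False using that[of n] by simp
    qed
    then show ?thesis by auto
  qed
  finally have "eventually (\<lambda>n. prob {\<omega> \<in> space P. norm (W \<omega>) \<le> 1 / real (Suc n)} < \<eta>) sequentially"
    using assms by (intro order_tendstoD(2)) (auto simp: prob_W_zero)
  then obtain n where "prob {\<omega> \<in> space P. norm (W \<omega>) \<le> 1 / real (Suc n)} < \<eta>"
    by (auto simp: eventually_sequentially)
  then show ?thesis by (intro that[of "1 / real (Suc n)"]) auto
qed

end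

section \<open>Likelihood ratios and the Hellinger distance\<close>

text \<open>\<open>nontrivial\<close> keeps the normalizing integral positive, so that
  \<open>exp_normalized\<close> is a probability density.\<close>

locale density_model = finite_measure \<nu> for \<nu> :: "'a measure" +
  fixes J :: "'x::{real_normed_vector, second_countable_topology} \<Rightarrow> 'a \<Rightarrow> real"
  assumes J: "Linf_subspace \<nu> J"
    and nontrivial: "0 < measure \<nu> (space \<nu>)"
begin

lemma J_measurable [measurable]: "J v \<in> borel_measurable \<nu>"
  using J by (simp add: Linf_subspace_def)

lemma abs_J_le: assumes "x \<in> space \<nu>" shows "\<bar>J v x\<bar> \<le> norm v"
proof -
  have "bdd_above ((\<lambda>x. \<bar>J v x\<bar>) ` space \<nu>)" "norm v = (SUP x\<in>space \<nu>. \<bar>J v x\<bar>)"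
    using J by (auto simp: Linf_subspace_def)
  then show ?thesis using cSUP_upper[OF assms, of "\<lambda>x. \<bar>J v x\<bar>"] by simp
qed

lemma abs_J_diff_le: assumes "x \<in> space \<nu>" shows "\<bar>J u x - J v x\<bar> \<le> norm (u - v)"
proof -
  have "linear (\<lambda>v. J v x)" using J assms by (simp add: Linf_subspace_def)
  then have "J (u - v) x = J u x - J v x" by (rule linear_diff)
  then show ?thesis using abs_J_le[OF assms, of "u - v"] by simp
qed

definition normalizer :: "'x \<Rightarrow> real" where "normalizer v = (\<integral>y. exp (J v y) \<partial>\<nu>)"

abbreviation pd :: "'x \<Rightarrow> 'a \<Rightarrow> real" where "pd v \<equiv> exp_normalized \<nu> (J v)"

lemma pd_eq: "pd v x = exp (J v x) / normalizer v"
  by (simp add: exp_normalized_def normalizer_def)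

lemma integrable_bounded:
  assumes "g \<in> borel_measurable \<nu>" "\<And>x. x \<in> space \<nu> \<Longrightarrow> \<bar>g x :: real\<bar> \<le> B"
  shows "integrable \<nu> g"
  using assms by (intro integrable_const_bound[where B = B]) (auto intro!: AE_I2)

lemma integrable_exp_J: "integrable \<nu> (\<lambda>x. exp (J v x))"
  by (rule integrable_bounded[where B = "exp (norm v)"]) (auto dest: abs_J_le[of _ v])

lemma normalizer_pos: "0 < normalizer v"
proof -
  have "0 < measure \<nu> (space \<nu>) * exp (- norm v)" using nontrivial by simp
  also have "\<dots> = (\<integral>x. exp (- norm v) \<partial>\<nu>)" by simp
  also have "\<dots> \<le> normalizer v" unfolding normalizer_def
    by (intro integral_mono integrable_exp_J integrable_bounded[where B = "exp (- norm v)"]) (auto dest: abs_J_le[of _ v])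
  finally show ?thesis .
qed

lemma pd_pos: "0 < pd v x" by (simp add: pd_eq normalizer_pos)

lemma pd_measurable [measurable]: "pd v \<in> borel_measurable \<nu>"
  unfolding pd_eq[abs_def] by measurable

lemma integrable_pd: "integrable \<nu> (pd v)"
  unfolding pd_eq[abs_def] by (intro integrable_divide_zero integrable_exp_J)

lemma integral_pd: "(\<integral>x. pd v x \<partial>\<nu>) = 1"
  using normalizer_pos[of v] by (simp add: pd_eq) (simp add: normalizer_def)

lemma nn_integral_pd: "(\<integral>\<^sup>+x. pd v x \<partial>\<nu>) = 1"
  using nn_integral_eq_integral[OF integrable_pd] pd_pos integral_pd by (auto simp: less_imp_le)

lemma normalizer_le: "normalizer u \<le> exp (norm (u - v)) * normalizer v"
proof -
  have "normalizer u \<le> (\<integral>x. exp (norm (u - v)) * exp (J v x) \<partial>\<nu>)"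
    unfolding normalizer_def
  proof (intro integral_mono integrable_exp_J integrable_mult_right)
    fix x assume "x \<in> space \<nu>"
    then show "exp (J u x) \<le> exp (norm (u - v)) * exp (J v x)"
      using abs_J_diff_le[of x u v] by (simp add: exp_add[symmetric])
  qed
  then show ?thesis by (simp add: normalizer_def)
qed

text \<open>One factor exp(norm(u - v)) comes from the exponential, the other from the normalizing
  constant.\<close>

lemma pd_ratio: assumes x: "x \<in> space \<nu>" shows "pd u x \<le> exp (2 * norm (u - v)) * pd v x"
proof -
  let ?d = "norm (u - v)"
  have "exp (J u x) * normalizer v \<le> (exp ?d * exp (J v x)) * (exp ?d * normalizer u)"
  proof (intro mult_mono)
    show "exp (J u x) \<le> exp ?d * exp (J v x)"
      using abs_J_diff_le[OF x, of u v] by (simp add: exp_add[symmetric])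
    show "normalizer v \<le> exp ?d * normalizer u" using normalizer_le[of v u] by (simp add: norm_minus_commute)
  qed (auto intro: less_imp_le[OF normalizer_pos])
  also have "\<dots> = exp (2 * ?d) * exp (J v x) * normalizer u"
    by (simp add: exp_double power2_eq_square)
  finally show ?thesis
    using normalizer_pos[of u] normalizer_pos[of v] by (simp add: pd_eq field_simps)
qed

text \<open>For d <= 1/2 one has exp(2d) <= 1 + 4d, which makes the ratio bound linear. The later
  conditions with 1/2 go back to this one.\<close>

lemma pd_diff_le:
  assumes x: "x \<in> space \<nu>" and d: "norm (u - v) \<le> 1 / 2"
  shows "\<bar>pd u x - pd v x\<bar> \<le> 4 * norm (u - v) * pd v x"
proof -
  define d where "d = norm (u - v)"
  have d: "0 \<le> d" "d \<le> 1/2" using d by (auto simp: d_def)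
  have e: "exp (2 * d) \<le> 1 + 4 * d"
  proof -
    have "exp (2 * d) \<le> 1 + 2 * d + (2 * d)\<^sup>2" using d by (intro exp_bound) auto
    moreover have "(2 * d) * (2 * d) \<le> 1 * (2 * d)" using d by (intro mult_right_mono) auto
    ultimately show ?thesis by (simp add: power2_eq_square)
  qed
  have "pd u x \<le> exp (2 * d) * pd v x" unfolding d_def by (rule pd_ratio[OF x])
  also have "\<dots> \<le> (1 + 4 * d) * pd v x" by (intro mult_right_mono e less_imp_le[OF pd_pos])
  finally have 1: "pd u x - pd v x \<le> 4 * d * pd v x" by (simp add: algebra_simps)
  have "1 - 2 * d \<le> exp (- (2 * d))" using exp_ge_add_one_self[of "- (2 * d)"] by simp
  then have "(1 - 2 * d) * pd v x \<le> exp (- (2 * d)) * pd v x" by (intro mult_right_mono less_imp_le[OF pd_pos])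
  also have "\<dots> \<le> pd u x"
  proof -
    have "exp (- (2 * d)) * pd v x \<le> exp (- (2 * d)) * (exp (2 * d) * pd u x)"
      using pd_ratio[OF x, of v u] by (intro mult_left_mono) (auto simp: d_def norm_minus_commute)
    then show ?thesis by (simp add: mult.assoc[symmetric] exp_add[symmetric])
  qed
  finally have "pd v x - pd u x \<le> 2 * d * pd v x" by (simp add: algebra_simps)
  moreover have "2 * d * pd v x \<le> 4 * d * pd v x" using d pd_pos[of v x] by simp
  ultimately show ?thesis using 1 by (simp add: d_def)
qed

lemma integrable_pd_dominated:
  assumes [measurable]: "g \<in> borel_measurable \<nu>" and "\<And>x. x \<in> space \<nu> \<Longrightarrow> \<bar>g x\<bar> \<le> C * pd v x"
  shows "integrable \<nu> g"
  by (rule Bochner_Integration.integrable_bound[where f = "\<lambda>x. C * pd v x"])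
     (use assms integrable_pd in \<open>auto intro!: AE_I2 integrable_mult_right intro: order_trans[OF _ abs_ge_self]\<close>)

section \<open>The squared Hellinger distance and integrals of likelihood ratios\<close>

definition hell2 :: "'x \<Rightarrow> 'x \<Rightarrow> real" where
  "hell2 u v = (\<integral>x. (sqrt (pd u x) - sqrt (pd v x))\<^sup>2 \<partial>\<nu>)"

lemma integrable_sqrt_pd: "integrable \<nu> (\<lambda>x. sqrt (pd u x) * sqrt (pd v x))"
proof (rule integrable_pd_dominated)
  fix x assume x: "x \<in> space \<nu>"
  have "sqrt (pd u x) \<le> sqrt ((exp (norm (u - v)) * sqrt (pd v x))\<^sup>2)"
    using pd_ratio[OF x, of u v] pd_pos[of v x] by (intro real_sqrt_le_mono) (simp add: power_mult_distrib exp_double)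
  then have "sqrt (pd u x) \<le> exp (norm (u - v)) * sqrt (pd v x)" using pd_pos[of v x] by simp
  then have "sqrt (pd u x) * sqrt (pd v x) \<le> exp (norm (u - v)) * sqrt (pd v x) * sqrt (pd v x)"
    using pd_pos[of u x] pd_pos[of v x] by (intro mult_right_mono) auto
  also have "\<dots> = exp (norm (u - v)) * pd v x" using pd_pos[of v x] by (simp add: mult.assoc)
  finally show "\<bar>sqrt (pd u x) * sqrt (pd v x)\<bar> \<le> exp (norm (u - v)) * pd v x"
    using pd_pos[of v x] pd_pos[of u x] by (simp add: abs_mult)
qed measurable

lemma hell2_expand: "(sqrt (pd u x) - sqrt (pd v x))\<^sup>2 = pd u x + pd v x - 2 * (sqrt (pd u x) * sqrt (pd v x))"
  using pd_pos[of u x] pd_pos[of v x] by (simp add: power2_diff)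

lemma integrable_hell2: "integrable \<nu> (\<lambda>x. (sqrt (pd u x) - sqrt (pd v x))\<^sup>2)"
  unfolding hell2_expand by (intro Bochner_Integration.integrable_diff Bochner_Integration.integrable_add integrable_pd integrable_mult_right integrable_sqrt_pd)

lemma affinity: "(\<integral>x. sqrt (pd u x) * sqrt (pd v x) \<partial>\<nu>) = 1 - hell2 u v / 2"
proof -
  have "hell2 u v = (\<integral>x. pd u x + pd v x - 2 * (sqrt (pd u x) * sqrt (pd v x)) \<partial>\<nu>)"
    by (simp add: hell2_def hell2_expand)
  also have "\<dots> = 2 - 2 * (\<integral>x. sqrt (pd u x) * sqrt (pd v x) \<partial>\<nu>)"
    by (subst Bochner_Integration.integral_diff)
       (auto simp: integrable_pd integrable_sqrt_pd integral_pd)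
  finally show ?thesis by (simp add: field_simps)
qed

lemma hell2_nonneg: "0 \<le> hell2 u v" by (simp add: hell2_def)

lemma hell2_le_2: "hell2 u v \<le> 2"
proof -
  have "0 \<le> (\<integral>x. sqrt (pd u x) * sqrt (pd v x) \<partial>\<nu>)"
    using pd_pos by (intro integral_nonneg_AE AE_I2) (auto simp: less_imp_le)
  then show ?thesis by (simp add: affinity)
qed

lemma hell2_triangle: "hell2 u w \<le> 2 * hell2 u v + 2 * hell2 v w"
proof -
  have "hell2 u w \<le> (\<integral>x. 2 * (sqrt (pd u x) - sqrt (pd v x))\<^sup>2 + 2 * (sqrt (pd v x) - sqrt (pd w x))\<^sup>2 \<partial>\<nu>)"
    unfolding hell2_def
  proof (intro integral_mono integrable_hell2 Bochner_Integration.integrable_add integrable_mult_right)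
    fix x
    have "0 \<le> ((sqrt (pd u x) - sqrt (pd v x)) - (sqrt (pd v x) - sqrt (pd w x)))\<^sup>2" by simp
    then show "(sqrt (pd u x) - sqrt (pd w x))\<^sup>2
      \<le> 2 * (sqrt (pd u x) - sqrt (pd v x))\<^sup>2 + 2 * (sqrt (pd v x) - sqrt (pd w x))\<^sup>2"
      by (simp add: power2_eq_square algebra_simps)
  qed
  also have "\<dots> = 2 * hell2 u v + 2 * hell2 v w"
    unfolding hell2_def by (subst Bochner_Integration.integral_add) (auto intro: integrable_hell2)
  finally show ?thesis .
qed

text \<open>If a and b are the roots of the densities and d is the norm distance, then b |a - b| <=
  |a^2 - b^2| <= 4 d b^2. Dividing by b and squaring gives a multiple of the density.\<close>

lemma hell2_le_norm: assumes d: "norm (u - v) \<le> 1 / 2" shows "hell2 u v \<le> 16 * (norm (u - v))\<^sup>2"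
proof -
  let ?d = "norm (u - v)"
  have "hell2 u v \<le> (\<integral>x. 16 * ?d\<^sup>2 * pd v x \<partial>\<nu>)"
    unfolding hell2_def
  proof (intro integral_mono integrable_hell2 integrable_mult_right integrable_pd)
    fix x assume x: "x \<in> space \<nu>"
    have p: "0 < pd u x" "0 < pd v x" by (rule pd_pos)+
    define a b where "a = sqrt (pd u x)" and "b = sqrt (pd v x)"
    have ab: "a > 0" "b > 0" "pd u x = a\<^sup>2" "pd v x = b\<^sup>2" using p by (auto simp: a_def b_def)
    have "b * \<bar>a - b\<bar> \<le> (a + b) * \<bar>a - b\<bar>" using ab by (intro mult_right_mono) auto
    also have "\<dots> = \<bar>(a + b) * (a - b)\<bar>" using ab by (simp add: abs_mult)
    also have "(a + b) * (a - b) = pd u x - pd v x" using ab by (simp add: power2_eq_square algebra_simps)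
    also have "\<bar>pd u x - pd v x\<bar> \<le> 4 * ?d * b\<^sup>2" using pd_diff_le[OF x d] ab by simp
    finally have "b * \<bar>a - b\<bar> \<le> b * (4 * ?d * b)" by (simp add: power2_eq_square algebra_simps)
    then have "\<bar>a - b\<bar> \<le> 4 * ?d * b" using ab by simp
    then have "\<bar>a - b\<bar>\<^sup>2 \<le> (4 * ?d * b)\<^sup>2" by (intro power_mono) auto
    then show "(sqrt (pd u x) - sqrt (pd v x))\<^sup>2 \<le> 16 * ?d\<^sup>2 * pd v x"
      using ab by (simp add: a_def[symmetric] b_def[symmetric] power_mult_distrib)
  qed
  then show ?thesis by (simp add: integral_pd)
qed

text \<open>The likelihood ratio test against a single density \<open>pd v\<close> also detects every \<open>pd u\<close> with \<open>u\<close>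
  close to \<open>v\<close> in sup norm: the term linear in \<open>norm (u - v)\<close> vanishes because \<open>pd u - pd v\<close> has integral 0.\<close>

lemma test_integral:
  assumes d: "norm (u - v) \<le> 1 / 2"
  shows "(\<integral>\<^sup>+x. ennreal (pd u x) * ennreal (sqrt (pd w x / pd v x)) \<partial>\<nu>)
    \<le> ennreal (1 - hell2 v w / 4 + 16 * (norm (u - v))\<^sup>2)"
proof -
  let ?d = "norm (u - v)"
  let ?g = "\<lambda>x. sqrt (pd v x) * sqrt (pd w x) + (pd u x - pd v x) + ((sqrt (pd v x) - sqrt (pd w x))\<^sup>2 / 4 + 16 * ?d\<^sup>2 * pd v x)"
  have int: "integrable \<nu> ?g"
    by (intro Bochner_Integration.integrable_add Bochner_Integration.integrable_diff integrable_sqrt_pd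
       integrable_pd integrable_divide_zero integrable_hell2 integrable_mult_right)
  have le: "pd u x * sqrt (pd w x / pd v x) \<le> ?g x" if x: "x \<in> space \<nu>" for x
  proof -
    define a b where "a = sqrt (pd v x)" and "b = sqrt (pd w x)"
    have ab: "a > 0" "b > 0" "pd v x = a\<^sup>2" "pd w x = b\<^sup>2" using pd_pos by (auto simp: a_def b_def less_imp_le)
    define D where "D = pd u x - a\<^sup>2"
    have D: "\<bar>D\<bar> \<le> 4 * ?d * a\<^sup>2" using pd_diff_le[OF x d] ab by (simp add: D_def)
    have "pd u x * sqrt (pd w x / pd v x) = (a\<^sup>2 + D) * (b / a)"
      using ab by (simp add: D_def real_sqrt_divide)
    also have "\<dots> = a * b + D + D * (b - a) / a"
      using ab by (simp add: field_simps power2_eq_square)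
    also have "D * (b - a) / a \<le> \<bar>D\<bar> * \<bar>b - a\<bar> / a"
      using ab by (intro divide_right_mono) (auto simp: abs_mult[symmetric])
    also have "\<dots> \<le> 4 * ?d * a\<^sup>2 * \<bar>b - a\<bar> / a"
      using D ab by (intro divide_right_mono mult_right_mono) auto
    \<comment> \<open>The factors are weighted so that 2xy <= x^2 + y^2 produces a quarter of the
      Hellinger integrand. Against the affinity 1 - hell2/2 this leaves hell2/4 of
      separation.\<close>
    also have "\<dots> = 2 * (\<bar>a - b\<bar> / 2) * (4 * ?d * a)"
      using ab by (simp add: power2_eq_square abs_minus_commute)
    also have "\<dots> \<le> (\<bar>a - b\<bar> / 2)\<^sup>2 + (4 * ?d * a)\<^sup>2" by (rule sum_squares_bound)
    also have "\<dots> = (a - b)\<^sup>2 / 4 + 16 * ?d\<^sup>2 * a\<^sup>2"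
      by (simp add: power_divide power_mult_distrib)
    finally have "pd u x * sqrt (pd w x / pd v x) \<le> a * b + D + ((a - b)\<^sup>2 / 4 + 16 * ?d\<^sup>2 * a\<^sup>2)" by simp
    then show ?thesis using pd_pos[of v x] by (simp add: D_def a_def b_def)
  qed
  have "(\<integral>\<^sup>+x. ennreal (pd u x) * ennreal (sqrt (pd w x / pd v x)) \<partial>\<nu>) \<le> (\<integral>\<^sup>+x. ennreal (?g x) \<partial>\<nu>)"
    using le pd_pos by (intro nn_integral_mono) (auto simp: ennreal_mult[symmetric] less_imp_le intro!: ennreal_leI)
  also have "\<dots> = ennreal (\<integral>x. ?g x \<partial>\<nu>)"
  proof (intro nn_integral_eq_integral int AE_I2)
    fix x assume "x \<in> space \<nu>"
    have "0 \<le> pd u x * sqrt (pd w x / pd v x)" using pd_pos by (simp add: less_imp_le)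
    also have "\<dots> \<le> ?g x" by (rule le) fact
    finally show "0 \<le> ?g x" .
  qed
  also have "(\<integral>x. ?g x \<partial>\<nu>) = (1 - hell2 v w / 2) + (1 - 1) + (hell2 v w / 4 + 16 * ?d\<^sup>2)"
    by (simp add: affinity integral_pd integrable_pd integrable_sqrt_pd integrable_hell2 hell2_def[symmetric])
  also have "\<dots> = 1 - hell2 v w / 4 + 16 * ?d\<^sup>2" by simp
  finally show ?thesis .
qed

text \<open>For densities a and b, a^2 / b = 2a - b + (a - b)^2 / b. The first two terms integrate
  to 1, and the last is the chi-square integrand, of second order in the distance.\<close>

lemma chi_square_integral:
  assumes d: "norm (u - w) \<le> 1 / 2"
  shows "(\<integral>\<^sup>+x. ennreal (pd w x) * ennreal (pd w x / pd u x) \<partial>\<nu>) \<le> ennreal (1 + 16 * (norm (u - w))\<^sup>2)"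
proof -
  let ?d = "norm (u - w)"
  let ?g = "\<lambda>x. 2 * pd w x - pd u x + 16 * ?d\<^sup>2 * pd u x"
  have int: "integrable \<nu> ?g" by (intro Bochner_Integration.integrable_add Bochner_Integration.integrable_diff integrable_pd integrable_mult_right)
  have le: "pd w x * (pd w x / pd u x) \<le> ?g x" if x: "x \<in> space \<nu>" for x
  proof -
    define a b where "a = pd w x" and "b = pd u x"
    have ab: "a > 0" "b > 0" by (auto simp: a_def b_def pd_pos)
    have "\<bar>a - b\<bar> \<le> 4 * ?d * b" using pd_diff_le[OF x, of w u] d by (simp add: a_def b_def norm_minus_commute)
    then have "\<bar>a - b\<bar>\<^sup>2 \<le> (4 * ?d * b)\<^sup>2" by (intro power_mono) auto
    then have "(a - b)\<^sup>2 / b \<le> (4 * ?d * b)\<^sup>2 / b" using ab by (intro divide_right_mono) auto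
    also have "\<dots> = 16 * ?d\<^sup>2 * b" using ab by (simp add: power2_eq_square)
    finally have 1: "(a - b)\<^sup>2 / b \<le> 16 * ?d\<^sup>2 * b" .
    have "a * (a / b) = 2 * a - b + (a - b)\<^sup>2 / b" using ab by (simp add: power2_eq_square field_simps)
    then show ?thesis using 1 by (simp add: a_def b_def)
  qed
  have "(\<integral>\<^sup>+x. ennreal (pd w x) * ennreal (pd w x / pd u x) \<partial>\<nu>) \<le> (\<integral>\<^sup>+x. ennreal (?g x) \<partial>\<nu>)"
    using le pd_pos by (intro nn_integral_mono) (auto simp: ennreal_mult[symmetric] less_imp_le intro!: ennreal_leI)
  also have "\<dots> = ennreal (\<integral>x. ?g x \<partial>\<nu>)"
  proof (intro nn_integral_eq_integral int AE_I2)
    fix x assume "x \<in> space \<nu>"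
    have "0 \<le> pd w x * (pd w x / pd u x)" using pd_pos by (simp add: less_imp_le)
    also have "\<dots> \<le> ?g x" by (rule le) fact
    finally show "0 \<le> ?g x" .
  qed
  also have "(\<integral>x. ?g x \<partial>\<nu>) = 1 + 16 * ?d\<^sup>2" by (simp add: integral_pd integrable_pd)
  finally show ?thesis .
qed

lemma sqrt_ratio_integral:
  "(\<integral>\<^sup>+x. ennreal (pd w x) * ennreal (sqrt (pd v x / pd w x)) \<partial>\<nu>) = ennreal (1 - hell2 v w / 2)"
proof -
  have "pd w x * sqrt (pd v x / pd w x) = sqrt (pd v x) * sqrt (pd w x)" for x
    using pd_pos[of w x] by (simp add: real_sqrt_divide) (metis less_eq_real_def real_div_sqrt times_divide_eq_right mult.commute)
  then have "(\<integral>\<^sup>+x. ennreal (pd w x) * ennreal (sqrt (pd v x / pd w x)) \<partial>\<nu>) = (\<integral>\<^sup>+x. ennreal (sqrt (pd v x) * sqrt (pd w x)) \<partial>\<nu>)"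
    using pd_pos by (intro nn_integral_cong) (simp add: ennreal_mult[symmetric] less_imp_le)
  also have "\<dots> = ennreal (1 - hell2 v w / 2)"
    unfolding affinity[symmetric] using pd_pos by (intro nn_integral_eq_integral integrable_sqrt_pd) (auto simp: less_imp_le)
  finally show ?thesis .
qed

end

text \<open>J is Lipschitz in the vector and measurable in the point. Approximating the identity of
  the separable space by simple functions exhibits J as a pointwise limit of finite sums of
  products.\<close>

lemma (in density_model) J_joint_measurable [measurable]:
  "(\<lambda>z. J (fst z) (snd z)) \<in> borel_measurable (borel \<Otimes>\<^sub>M \<nu>)"
proof -
  obtain F where F: "\<And>i. simple_function borel (F i)" "\<And>v. (\<lambda>i. F i v) \<longlonglongrightarrow> (v::'x)"
    using borel_measurable_implies_sequence_metric[of "\<lambda>v::'x. v" borel 0] by auto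
  show ?thesis
  proof (rule borel_measurable_LIMSEQ_real)
    fix z :: "'x \<times> 'a" assume z: "z \<in> space (borel \<Otimes>\<^sub>M \<nu>)"
    then have x: "snd z \<in> space \<nu>" by (auto simp: space_pair_measure)
    have "(\<lambda>i. norm (F i (fst z) - fst z)) \<longlonglongrightarrow> 0" using F(2)[of "fst z"] by (rule tendsto_norm_zero[OF LIM_zero])
    then have "(\<lambda>i. J (F i (fst z)) (snd z) - J (fst z) (snd z)) \<longlonglongrightarrow> 0"
      by (rule Lim_null_comparison[rotated]) (auto intro!: always_eventually abs_J_diff_le[OF x])
    then show "(\<lambda>i. J (F i (fst z)) (snd z)) \<longlonglongrightarrow> J (fst z) (snd z)" by (rule LIM_zero_cancel)
  next
    fix i
    have fin: "finite (range (F i))" using simple_functionD(1)[OF F(1)[of i]] by simp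
    have Fm [measurable]: "F i \<in> borel_measurable borel" using F(1) by (rule borel_measurable_simple_function)
    have "(\<lambda>z. \<Sum>y\<in>range (F i). indicator (F i -` {y}) (fst z) * J y (snd z)) \<in> borel_measurable (borel \<Otimes>\<^sub>M \<nu>)"
    proof (intro borel_measurable_sum borel_measurable_times)
      fix y
      have [measurable]: "F i -` {y} \<in> sets borel" using measurable_sets[OF Fm, of "{y}"] by simp
      show "(\<lambda>z. indicator (F i -` {y}) (fst z) :: real) \<in> borel_measurable (borel \<Otimes>\<^sub>M \<nu>)" by measurable
      show "(\<lambda>z. J y (snd z)) \<in> borel_measurable (borel \<Otimes>\<^sub>M \<nu>)" by measurable
    qed
    moreover have "(\<Sum>y\<in>range (F i). indicator (F i -` {y}) v * J y x) = J (F i v) x" for v x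
    proof -
      have "(\<Sum>y\<in>range (F i). indicator (F i -` {y}) v * J y x) = (\<Sum>y\<in>range (F i). if y = F i v then J y x else 0)"
        by (intro sum.cong) (auto simp: indicator_def)
      then show ?thesis using fin by simp
    qed
    ultimately show "(\<lambda>z. J (F i (fst z)) (snd z)) \<in> borel_measurable (borel \<Otimes>\<^sub>M \<nu>)" by simp
  qed
qed

context density_model begin

lemma normalizer_measurable [measurable]: "normalizer \<in> borel_measurable borel"
proof -
  have "(\<lambda>v. \<integral>y. exp (J v y) \<partial>\<nu>) \<in> borel_measurable borel"
    by (rule borel_measurable_lebesgue_integral) (simp add: case_prod_unfold)
  then show ?thesis by (simp add: normalizer_def[abs_def])
qed

lemma pd_joint_measurable [measurable]:
  "(\<lambda>z. pd (fst z) (snd z)) \<in> borel_measurable (borel \<Otimes>\<^sub>M \<nu>)"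
  unfolding pd_eq by measurable

lemma hell2_measurable [measurable]: "(\<lambda>v. hell2 v w) \<in> borel_measurable borel"
proof -
  have "(\<lambda>v. \<integral>x. (sqrt (pd v x) - sqrt (pd w x))\<^sup>2 \<partial>\<nu>) \<in> borel_measurable borel"
    by (rule borel_measurable_lebesgue_integral) (simp add: case_prod_unfold)
  then show ?thesis by (simp add: hell2_def)
qed

end

section \<open>Bayes' formula in terms of likelihood ratios\<close>

locale posterior_model = density_model \<nu> J + P: prob_space P
  for \<nu> :: "'a measure" and J :: "'x::{real_normed_vector, second_countable_topology} \<Rightarrow> 'a \<Rightarrow> real"
    and P :: "'w measure" +
  fixes W :: "'w \<Rightarrow> 'x" and w :: 'x
  assumes W_meas [measurable]: "W \<in> borel_measurable P"
begin

abbreviation "\<nu>0 \<equiv> density \<nu> (\<lambda>x. ennreal (pd w x))"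
abbreviation "P0 n \<equiv> PiM {..<n} (\<lambda>_::nat. density \<nu> (\<lambda>x. ennreal (pd w x)))"

lemma prob_space_\<nu>0: "prob_space \<nu>0"
  by (rule prob_spaceI) (simp add: emeasure_density nn_integral_pd cong: nn_integral_cong)

lemma prob_space_P0: "prob_space (P0 n)"
  by (intro prob_space_PiM prob_space_\<nu>0)

lemma space_P0: "X \<in> space (P0 n) \<Longrightarrow> i < n \<Longrightarrow> X i \<in> space \<nu>"
  by (auto simp: space_PiM PiE_iff)

lemma nn_integral_P0_prod:
  assumes [measurable]: "g \<in> borel_measurable \<nu>"
  shows "(\<integral>\<^sup>+X. (\<Prod>i<n. g (X i)) \<partial>P0 n) = (\<integral>\<^sup>+x. ennreal (pd w x) * g x \<partial>\<nu>) ^ n"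
proof -
  interpret \<nu>0: prob_space \<nu>0 by (rule prob_space_\<nu>0)
  interpret product_sigma_finite "\<lambda>_::nat. \<nu>0" by standard
  have "(\<integral>\<^sup>+X. (\<Prod>i<n. g (X i)) \<partial>P0 n) = (\<Prod>i<n. \<integral>\<^sup>+x. g x \<partial>\<nu>0)"
    by (rule product_nn_integral_prod) auto
  then show ?thesis by (simp add: nn_integral_density)
qed

text \<open>Dividing by the likelihood of the true density leaves the posterior unchanged and gives
  expectation 1 under \<open>P0 n\<close>.\<close>

definition "LR n v X = (\<Prod>i<n. ennreal (pd v (X i) / pd w (X i)))"

lemma LR_measurable [measurable]: "LR n v \<in> borel_measurable (PiM {..<n} (\<lambda>_. \<nu>))"
  unfolding LR_def[abs_def] by measurable

lemma LR_joint_measurable [measurable]: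
  "(\<lambda>z. LR n (W (fst z)) (snd z)) \<in> borel_measurable (P \<Otimes>\<^sub>M PiM {..<n} (\<lambda>_. \<nu>))"
proof -
  have "(\<lambda>z. pd (W (fst z)) (snd z i)) \<in> borel_measurable (P \<Otimes>\<^sub>M PiM {..<n} (\<lambda>_. \<nu>))" if "i \<in> {..<n}" for i
  proof -
    have "(\<lambda>z. (W (fst z), snd z i)) \<in> measurable (P \<Otimes>\<^sub>M PiM {..<n} (\<lambda>_. \<nu>)) (borel \<Otimes>\<^sub>M \<nu>)"
      using that by measurable
    from measurable_compose[OF this pd_joint_measurable] show ?thesis by simp
  qed
  moreover have "(\<lambda>z. pd w (snd z i)) \<in> borel_measurable (P \<Otimes>\<^sub>M PiM {..<n} (\<lambda>_. \<nu>))" if "i \<in> {..<n}" for i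
    using that by measurable
  ultimately show ?thesis unfolding LR_def
    by (intro borel_measurable_prod_ennreal measurable_compose[OF _ measurable_ennreal] borel_measurable_divide) auto
qed

definition "far \<rho> v \<longleftrightarrow> \<rho> < sqrt (hell2 v w)"

lemma far_measurable [measurable]: "Measurable.pred borel (far \<rho>)"
  unfolding far_def[abs_def] by measurable

text \<open>Pulls Bayes' formula back to \<open>P\<close>. On the sigma-algebra of
  \<open>law_of\<close> a function is measurable as soon as its composition with the random density
  is. The likelihood c of the true density is positive and finite, so it cancels.\<close>

lemma emeasure_posterior:
  assumes X: "X \<in> space (P0 n)"
  shows "emeasure (posterior (law_of P (\<lambda>\<omega>. pd (W \<omega>))) n X) {\<pi>. hellinger_dist \<nu> \<pi> (pd w) > \<rho>}
    = (\<integral>\<^sup>+\<omega>. LR n (W \<omega>) X * indicator {\<omega> \<in> space P. far \<rho> (W \<omega>)} \<omega> \<partial>P) / (\<integral>\<^sup>+\<omega>. LR n (W \<omega>) X \<partial>P)"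
proof -
  define \<Phi> where "\<Phi> \<omega> = pd (W \<omega>)" for \<omega>
  define \<Sigma> where "\<Sigma> = {B. \<Phi> -` B \<inter> space P \<in> sets P}"
  define R where "R = law_of P \<Phi>"
  have R: "R = distr P (sigma UNIV \<Sigma>) \<Phi>" by (simp add: R_def law_of_def \<Sigma>_def)
  have setsR: "B \<in> sets R" if "\<Phi> -` B \<inter> space P \<in> sets P" for B
    using that by (simp add: R \<Sigma>_def sigma_sets.Basic)
  have \<Phi>m [measurable]: "\<Phi> \<in> measurable P (sigma UNIV \<Sigma>)"
    by (rule measurable_measure_of) (auto simp: \<Sigma>_def)
  have m: "g \<in> borel_measurable (sigma UNIV \<Sigma>)" if "(\<lambda>\<omega>. g (\<Phi> \<omega>)) \<in> borel_measurable P" for g :: "('a \<Rightarrow> real) \<Rightarrow> ennreal"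
  proof (rule measurableI)
    fix A :: "ennreal set" assume "A \<in> sets borel"
    then have "(\<lambda>\<omega>. g (\<Phi> \<omega>)) -` A \<inter> space P \<in> sets P" using that by (rule measurable_sets[rotated])
    then have "g -` A \<in> \<Sigma>" by (simp add: \<Sigma>_def vimage_def)
    then show "g -` A \<inter> space (sigma UNIV \<Sigma>) \<in> sets (sigma UNIV \<Sigma>)" by (simp add: sigma_sets.Basic)
  qed simp
  have Xi: "X i \<in> space \<nu>" if "i < n" for i using space_P0[OF X that] .
  have [measurable]: "(\<lambda>\<omega>. \<Phi> \<omega> (X i)) \<in> borel_measurable P" if "i < n" for i
  proof -
    have "(\<lambda>\<omega>. (W \<omega>, X i)) \<in> measurable P (borel \<Otimes>\<^sub>M \<nu>)" using Xi[OF that] by measurable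
    from measurable_compose[OF this pd_joint_measurable] show ?thesis by (simp add: \<Phi>_def)
  qed
  have Lm: "(\<lambda>\<omega>. \<Prod>i<n. ennreal (\<Phi> \<omega> (X i))) \<in> borel_measurable P"
    by (intro borel_measurable_prod_ennreal) measurable
  define c where "c = (\<Prod>i<n. ennreal (pd w (X i)))"
  have c: "c \<noteq> 0" "c \<noteq> \<infinity>"
    by (auto simp: c_def ennreal_prod_eq_top pd_pos less_imp_neq[symmetric] not_le)
  have eq: "(\<Prod>i<n. ennreal (\<Phi> \<omega> (X i))) = c * LR n (W \<omega>) X" for \<omega>
    unfolding c_def LR_def \<Phi>_def prod.distrib[symmetric]
    using pd_pos by (intro prod.cong refl) (simp add: ennreal_mult[symmetric] less_imp_le less_imp_neq[symmetric])
  define U where "U = {\<pi>. hellinger_dist \<nu> \<pi> (pd w) > \<rho>}"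
  have U\<Phi>: "\<Phi> \<omega> \<in> U \<longleftrightarrow> far \<rho> (W \<omega>)" for \<omega>
    by (simp add: U_def \<Phi>_def far_def hellinger_dist_def hell2_def)
  have UR: "U \<in> sets R"
  proof (rule setsR)
    have "\<Phi> -` U \<inter> space P = {\<omega> \<in> space P. far \<rho> (W \<omega>)}" by (auto simp: U\<Phi>)
    then show "\<Phi> -` U \<inter> space P \<in> sets P" by simp
  qed
  have LRm [measurable]: "(\<lambda>\<omega>. LR n (W \<omega>) X) \<in> borel_measurable P"
  proof -
    have "X \<in> space (PiM {..<n} (\<lambda>_. \<nu>))" using X by (simp add: space_PiM)
    then show ?thesis using measurable_compose[OF measurable_Pair2' LR_joint_measurable] by (simp add: measurable_Pair1')
  qed
  define Den where "Den = (\<integral>\<^sup>+\<rho>. (\<Prod>i<n. ennreal (\<rho> (X i))) \<partial>R)"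
  have Den: "Den = c * (\<integral>\<^sup>+\<omega>. LR n (W \<omega>) X \<partial>P)"
    unfolding Den_def R by (subst nn_integral_distr) (auto simp: eq nn_integral_cmult intro!: m Lm[unfolded eq])
  have "emeasure (posterior R n X) U = (\<integral>\<^sup>+\<pi>. (\<Prod>i<n. ennreal (\<pi> (X i))) / Den * indicator U \<pi> \<partial>R)"
    unfolding posterior_def Den_def[symmetric]
    by (rule emeasure_density[OF _ UR]) (simp add: R, rule m, use Lm in simp)
  also have "\<dots> = (\<integral>\<^sup>+\<omega>. (\<Prod>i<n. ennreal (\<Phi> \<omega> (X i))) / Den * indicator U (\<Phi> \<omega>) \<partial>P)"
    unfolding R
  proof (rule nn_integral_distr[OF \<Phi>m])
    have [measurable]: "U \<in> sets (sigma UNIV \<Sigma>)" using UR by (simp add: R)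
    have [measurable]: "(\<lambda>\<pi>. (\<Prod>i<n. ennreal (\<pi> (X i)))) \<in> borel_measurable (sigma UNIV \<Sigma>)" by (rule m[OF Lm])
    have "(\<lambda>\<pi>. (\<Prod>i<n. ennreal (\<pi> (X i))) / Den * indicator U \<pi>) \<in> borel_measurable (sigma UNIV \<Sigma>)" by measurable
    then show "(\<lambda>\<pi>. (\<Prod>i<n. ennreal (\<pi> (X i))) / Den * indicator U \<pi>) \<in> borel_measurable (distr P (sigma UNIV \<Sigma>) \<Phi>)" by simp
  qed
  also have "\<dots> = (\<integral>\<^sup>+\<omega>. c * (LR n (W \<omega>) X * indicator {\<omega> \<in> space P. far \<rho> (W \<omega>)} \<omega>) / Den \<partial>P)"
    by (intro nn_integral_cong) (auto simp: eq indicator_def U\<Phi>)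
  also have "\<dots> = c * (\<integral>\<^sup>+\<omega>. LR n (W \<omega>) X * indicator {\<omega> \<in> space P. far \<rho> (W \<omega>)} \<omega> \<partial>P) / Den"
    by (simp add: nn_integral_divide nn_integral_cmult)
  also have "\<dots> = (\<integral>\<^sup>+\<omega>. LR n (W \<omega>) X * indicator {\<omega> \<in> space P. far \<rho> (W \<omega>)} \<omega> \<partial>P) / (\<integral>\<^sup>+\<omega>. LR n (W \<omega>) X \<partial>P)"
    unfolding Den mult.commute[of c] by (rule divide_mult_eq[OF c])
  finally show ?thesis unfolding R_def U_def \<Phi>_def .
qed

end

context posterior_model begin

section \<open>Expectations of likelihood ratios, tests and the evidence\<close>

lemma nn_integral_LR: "(\<integral>\<^sup>+X. LR n v X \<partial>P0 n) = 1"
proof -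
  have "(\<integral>\<^sup>+X. LR n v X \<partial>P0 n) = (\<integral>\<^sup>+x. ennreal (pd w x) * ennreal (pd v x / pd w x) \<partial>\<nu>) ^ n"
    unfolding LR_def by (rule nn_integral_P0_prod) measurable
  also have "(\<integral>\<^sup>+x. ennreal (pd w x) * ennreal (pd v x / pd w x) \<partial>\<nu>) = (\<integral>\<^sup>+x. ennreal (pd v x) \<partial>\<nu>)"
    using pd_pos by (intro nn_integral_cong) (simp add: ennreal_mult[symmetric] less_imp_le less_imp_neq[symmetric])
  finally show ?thesis by (simp add: nn_integral_pd)
qed

text \<open>Its expectation under \<open>P0 n\<close> is the n-th power of the Hellinger affinity.
  The test against v rejects when this statistic reaches 1.\<close>

definition "LR_sqrt n v X = (\<Prod>i<n. ennreal (sqrt (pd v (X i) / pd w (X i))))"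
definition "LR_inv n v X = (\<Prod>i<n. ennreal (pd w (X i) / pd v (X i)))"

lemma LR_sqrt_measurable [measurable]: "LR_sqrt n v \<in> borel_measurable (PiM {..<n} (\<lambda>_. \<nu>))"
  unfolding LR_sqrt_def[abs_def] by measurable

lemma LR_inv_joint_measurable [measurable]:
  "(\<lambda>z. LR_inv n (W (fst z)) (snd z)) \<in> borel_measurable (P \<Otimes>\<^sub>M PiM {..<n} (\<lambda>_. \<nu>))"
proof -
  have "(\<lambda>z. pd (W (fst z)) (snd z i)) \<in> borel_measurable (P \<Otimes>\<^sub>M PiM {..<n} (\<lambda>_. \<nu>))" if "i \<in> {..<n}" for i
  proof -
    have "(\<lambda>z. (W (fst z), snd z i)) \<in> measurable (P \<Otimes>\<^sub>M PiM {..<n} (\<lambda>_. \<nu>)) (borel \<Otimes>\<^sub>M \<nu>)"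
      using that by measurable
    from measurable_compose[OF this pd_joint_measurable] show ?thesis by simp
  qed
  moreover have "(\<lambda>z. pd w (snd z i)) \<in> borel_measurable (P \<Otimes>\<^sub>M PiM {..<n} (\<lambda>_. \<nu>))" if "i \<in> {..<n}" for i
    using that by measurable
  ultimately show ?thesis unfolding LR_inv_def
    by (intro borel_measurable_prod_ennreal measurable_compose[OF _ measurable_ennreal] borel_measurable_divide) auto
qed

text \<open>From 1 + y <= exp y. A negative z is harmless, since \<open>ennreal\<close> sends it to
  0.\<close>

lemma power_exp_bound:
  assumes "(z::real) \<le> 1 + y" shows "ennreal z ^ n \<le> ennreal (exp (real n * y))"
proof -
  have "ennreal z \<le> ennreal (exp y)"
    using assms exp_ge_add_one_self[of y] by (intro ennreal_leI) linarith
  then have "ennreal z ^ n \<le> ennreal (exp y) ^ n" by (intro power_mono) auto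
  also have "\<dots> = ennreal (exp (real n * y))"
    by (simp add: ennreal_power exp_of_nat_mult)
  finally show ?thesis .
qed

lemma nn_integral_LR_sqrt: "(\<integral>\<^sup>+X. LR_sqrt n v X \<partial>P0 n) \<le> ennreal (exp (real n * - (hell2 v w / 2)))"
proof -
  have "(\<integral>\<^sup>+X. LR_sqrt n v X \<partial>P0 n) = ennreal (1 - hell2 v w / 2) ^ n"
    unfolding LR_sqrt_def sqrt_ratio_integral[symmetric] by (rule nn_integral_P0_prod) measurable
  also have "\<dots> \<le> ennreal (exp (real n * - (hell2 v w / 2)))" by (rule power_exp_bound) simp
  finally show ?thesis .
qed

lemma nn_integral_LR_inv:
  assumes "norm (v - w) \<le> 1 / 2"
  shows "(\<integral>\<^sup>+X. LR_inv n v X \<partial>P0 n) \<le> ennreal (exp (real n * (16 * (norm (v - w))\<^sup>2)))"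
proof -
  have "(\<integral>\<^sup>+X. LR_inv n v X \<partial>P0 n) = (\<integral>\<^sup>+x. ennreal (pd w x) * ennreal (pd w x / pd v x) \<partial>\<nu>) ^ n"
    unfolding LR_inv_def by (rule nn_integral_P0_prod) measurable
  also have "\<dots> \<le> ennreal (1 + 16 * (norm (v - w))\<^sup>2) ^ n"
    by (intro power_mono chi_square_integral assms) simp
  also have "\<dots> \<le> ennreal (exp (real n * (16 * (norm (v - w))\<^sup>2)))" by (rule power_exp_bound) simp
  finally show ?thesis .
qed

text \<open>The error of the second kind at u of the test against v. Where the test accepts, the
  reciprocal R of \<open>LR_sqrt n v X\<close> is at least 1 and may be inserted as a factor; the
  product then factorizes over the observations into powers of the integral in
  \<open>test_integral\<close>.\<close>

lemma nn_integral_LR_accept: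
  assumes d: "norm (u - v) \<le> 1 / 2"
  shows "(\<integral>\<^sup>+X. LR n u X * indicator {X. LR_sqrt n v X < 1} X \<partial>P0 n)
    \<le> ennreal (exp (real n * (16 * (norm (u - v))\<^sup>2 - hell2 v w / 4)))"
proof -
  let ?g = "\<lambda>x. ennreal (pd u x / pd w x) * ennreal (sqrt (pd w x / pd v x))"
  have le: "LR n u X * indicator {X. LR_sqrt n v X < 1} X \<le> (\<Prod>i<n. ?g (X i))" for X
  proof (cases "LR_sqrt n v X < 1")
    case True
    define R where "R = (\<Prod>i<n. ennreal (sqrt (pd w (X i) / pd v (X i))))"
    have "ennreal (sqrt (pd v (X i) / pd w (X i))) * ennreal (sqrt (pd w (X i) / pd v (X i))) = 1" for i
      using pd_pos by (simp add: ennreal_mult[symmetric] real_sqrt_mult[symmetric] less_imp_le less_imp_neq[symmetric])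
    then have 1: "LR_sqrt n v X * R = 1"
      by (simp add: LR_sqrt_def R_def prod.distrib[symmetric])
    have "1 \<le> R"
    proof -
      have "LR_sqrt n v X * R \<le> 1 * R" using True by (intro mult_right_mono) auto
      then show ?thesis using 1 by simp
    qed
    then have "LR n u X * 1 \<le> LR n u X * R" by (intro mult_left_mono) auto
    also have "\<dots> = (\<Prod>i<n. ?g (X i))" by (simp add: LR_def R_def prod.distrib)
    finally show ?thesis using True by simp
  qed auto
  have "(\<integral>\<^sup>+X. LR n u X * indicator {X. LR_sqrt n v X < 1} X \<partial>P0 n) \<le> (\<integral>\<^sup>+X. (\<Prod>i<n. ?g (X i)) \<partial>P0 n)"
    by (intro nn_integral_mono le)
  also have "\<dots> = (\<integral>\<^sup>+x. ennreal (pd w x) * ?g x \<partial>\<nu>) ^ n" by (rule nn_integral_P0_prod) measurable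
  also have "(\<integral>\<^sup>+x. ennreal (pd w x) * ?g x \<partial>\<nu>) = (\<integral>\<^sup>+x. ennreal (pd u x) * ennreal (sqrt (pd w x / pd v x)) \<partial>\<nu>)"
  proof (intro nn_integral_cong)
    fix x
    have "ennreal (pd w x) * ennreal (pd u x / pd w x) = ennreal (pd u x)"
      using pd_pos by (simp add: ennreal_mult[symmetric] less_imp_le less_imp_neq[symmetric])
    then show "ennreal (pd w x) * ?g x = ennreal (pd u x) * ennreal (sqrt (pd w x / pd v x))"
      by (metis mult.assoc)
  qed
  also have "\<dots> ^ n \<le> ennreal (1 - hell2 v w / 4 + 16 * (norm (u - v))\<^sup>2) ^ n"
    by (intro power_mono test_integral d) simp
  also have "\<dots> \<le> ennreal (exp (real n * (16 * (norm (u - v))\<^sup>2 - hell2 v w / 4)))"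
    by (rule power_exp_bound) simp
  finally show ?thesis .
qed

lemma sets_P0 [measurable_cong]: "sets (P0 n) = sets (PiM {..<n} (\<lambda>_. \<nu>))"
  by (intro sets_PiM_cong) auto

lemma markov:
  assumes [measurable]: "u \<in> borel_measurable (P0 n)" and u: "(\<integral>\<^sup>+X. u X \<partial>P0 n) \<le> ennreal e"
    and c: "0 \<le> c" and e: "0 \<le> e"
  shows "measure (P0 n) {X \<in> space (P0 n). 1 \<le> ennreal c * u X} \<le> c * e"
proof -
  interpret P0: prob_space "P0 n" by (rule prob_space_P0)
  have "emeasure (P0 n) {X \<in> space (P0 n). 1 \<le> ennreal c * u X} \<le> ennreal c * (\<integral>\<^sup>+X. u X \<partial>P0 n)"
    using nn_integral_Markov_inequality[of u "space (P0 n)" "P0 n" "ennreal c"]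
    by (simp cong: nn_integral_cong)
  also have "\<dots> \<le> ennreal (c * e)" using u c e by (simp add: ennreal_mult mult_left_mono)
  finally show ?thesis using c e by (simp add: P0.emeasure_eq_measure)
qed

text \<open>By Cauchy--Schwarz the marginal likelihood is at least \<open>P(B)\<^sup>2\<close> divided by the integral of the
  inverse likelihood ratio over \<open>B\<close>, whose expectation is controlled by a chi-square divergence.\<close>

lemma evidence_lower_bound:
  assumes X: "X \<in> space (P0 n)" and B: "B \<in> sets P"
  shows "(ennreal (P.prob B))\<^sup>2 \<le> (\<integral>\<^sup>+\<omega>. LR n (W \<omega>) X \<partial>P) * (\<integral>\<^sup>+\<omega>. LR_inv n (W \<omega>) X * indicator B \<omega> \<partial>P)"
proof -
  have XX: "X \<in> space (PiM {..<n} (\<lambda>_. \<nu>))" using X by (simp add: space_PiM)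
  note [measurable] = B
  have [measurable]: "(\<lambda>\<omega>. LR n (W \<omega>) X) \<in> borel_measurable P" "(\<lambda>\<omega>. LR_inv n (W \<omega>) X) \<in> borel_measurable P"
    using measurable_compose[OF measurable_Pair2'[OF XX] LR_joint_measurable]
      measurable_compose[OF measurable_Pair2'[OF XX] LR_inv_joint_measurable] by simp_all
  define h where "h v = (\<Prod>i<n. ennreal (sqrt (pd v (X i) / pd w (X i))))" for v
  define h' where "h' v = (\<Prod>i<n. ennreal (sqrt (pd w (X i) / pd v (X i))))" for v
  have pdm [measurable]: "(\<lambda>\<omega>. pd (W \<omega>) (X i)) \<in> borel_measurable P" if "i \<in> {..<n}" for i
  proof -
    have Xi: "X i \<in> space \<nu>" using space_P0[OF X] that by simp
    have "(\<lambda>\<omega>. (W \<omega>, X i)) \<in> measurable P (borel \<Otimes>\<^sub>M \<nu>)" using Xi by measurable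
    from measurable_compose[OF this pd_joint_measurable] show ?thesis by simp
  qed
  have [measurable]: "(\<lambda>\<omega>. h (W \<omega>)) \<in> borel_measurable P" "(\<lambda>\<omega>. h' (W \<omega>)) \<in> borel_measurable P"
    unfolding h_def h'_def by measurable
  have sq: "h v ^ 2 = LR n v X" "h' v ^ 2 = LR_inv n v X" "h v * h' v = 1" for v
    unfolding h_def h'_def LR_def LR_inv_def prod_power_distrib prod.distrib[symmetric]
    using pd_pos by (auto intro!: prod.cong prod.neutral simp: ennreal_power real_sqrt_pow2 less_imp_le
        ennreal_mult[symmetric] real_sqrt_mult[symmetric] less_imp_neq[symmetric])
  have "ennreal (P.prob B) = (\<integral>\<^sup>+\<omega>. h (W \<omega>) * (h' (W \<omega>) * indicator B \<omega>) \<partial>P)"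
    using B by (simp add: mult.assoc[symmetric] sq P.emeasure_eq_measure)
  then have "(ennreal (P.prob B))\<^sup>2 \<le> (\<integral>\<^sup>+\<omega>. h (W \<omega>) ^ 2 \<partial>P) * (\<integral>\<^sup>+\<omega>. (h' (W \<omega>) * indicator B \<omega>) ^ 2 \<partial>P)"
    using Cauchy_Schwarz_nn_integral[of "\<lambda>\<omega>. h (W \<omega>)" P "\<lambda>\<omega>. h' (W \<omega>) * indicator B \<omega>"] by simp
  also have "(\<integral>\<^sup>+\<omega>. (h' (W \<omega>) * indicator B \<omega>) ^ 2 \<partial>P) = (\<integral>\<^sup>+\<omega>. LR_inv n (W \<omega>) X * indicator B \<omega> \<partial>P)"
    by (intro nn_integral_cong) (auto simp: sq indicator_def)
  finally show ?thesis by (simp add: sq)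
qed

text \<open>The three summands bound the probabilities of three exceptional events: too little
  evidence, a test that rejects the truth, and too large a numerator in Bayes' formula. Outside them
  the posterior mass is at most a. The denominator in the last summand is a times the lower bound
  for the evidence.\<close>

lemma posterior_bound:
  fixes n :: nat and D :: "'x set" and s \<rho> \<delta> a :: real
  assumes \<delta>: "0 < \<delta>" "\<delta> \<le> 1 / 2" and PB: "0 < P.prob {\<omega> \<in> space P. norm (W \<omega> - w) < \<delta>}"
    and \<Theta> [measurable]: "\<Theta> \<in> sets borel" and D: "finite D" and net: "\<And>v. v \<in> \<Theta> \<Longrightarrow> \<exists>d\<in>D. norm (v - d) < s"
    and s: "s \<le> 1 / 2" "512 * s\<^sup>2 \<le> \<rho>\<^sup>2" and \<rho>: "0 < \<rho>" and a: "0 < a"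
  shows "measure (P0 n) {X \<in> space (P0 n).
        measure (posterior (law_of P (\<lambda>\<omega>. pd (W \<omega>))) n X) {\<pi>. hellinger_dist \<nu> \<pi> (pd w) > \<rho>} > a}
    \<le> exp (- 16 * real n * \<delta>\<^sup>2) + real (card D) * exp (- (real n * \<rho>\<^sup>2 / 8))
      + (exp (- (real n * \<rho>\<^sup>2 / 32)) + P.prob {\<omega> \<in> space P. W \<omega> \<notin> \<Theta>}) * exp (32 * real n * \<delta>\<^sup>2)
        / (a * P.prob {\<omega> \<in> space P. norm (W \<omega> - w) < \<delta>})"
proof -
  interpret P0: prob_space "P0 n" by (rule prob_space_P0)
  interpret pr: pair_sigma_finite P "P0 n" by standard
  define B where "B = {\<omega> \<in> space P. norm (W \<omega> - w) < \<delta>}"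
  have B [measurable]: "B \<in> sets P" unfolding B_def by measurable
  define b where "b = P.prob B"
  have b: "0 < b" using PB by (simp add: b_def B_def)
  \<comment> \<open>Centres close to the truth admit no useful test and are dropped; every far point
    of \<open>\<Theta>\<close> is still near a centre in \<open>D'\<close>.\<close>
  define D' where "D' = {d \<in> D. \<rho>\<^sup>2 / 4 \<le> hell2 d w}"
  have D': "finite D'" "card D' \<le> card D" using D by (auto simp: D'_def intro: card_mono)
  define q where "q = P.prob {\<omega> \<in> space P. W \<omega> \<notin> \<Theta>}"
  define L where "L = b * exp (- (32 * real n * \<delta>\<^sup>2))"
  have L: "0 < L" using b by (simp add: L_def)
  define Y where "Y X = (\<integral>\<^sup>+\<omega>. LR_inv n (W \<omega>) X * indicator B \<omega> \<partial>P)" for X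
  define Acc where "Acc = {X. \<forall>d\<in>D'. LR_sqrt n d X < 1}"
  \<comment> \<open>Inside \<open>\<Theta>\<close> the likelihood ratio of a far density counts only
    where all tests accept, which makes its mean small; outside it counts fully, and its mean is the
    prior mass.\<close>
  define K where "K \<omega> X = LR n (W \<omega>) X * (indicator {\<omega> \<in> space P. W \<omega> \<in> \<Theta> \<and> far \<rho> (W \<omega>)} \<omega> * indicator Acc X
        + indicator {\<omega> \<in> space P. W \<omega> \<notin> \<Theta>} \<omega>)" for \<omega> X
  define N where "N X = (\<integral>\<^sup>+\<omega>. K \<omega> X \<partial>P)" for X
  let ?P\<nu> = "PiM {..<n} (\<lambda>_::nat. \<nu>)"
  have Accm [measurable]: "Measurable.pred ?P\<nu> (\<lambda>X. X \<in> Acc)" unfolding Acc_def mem_Collect_eq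
    using D'(1) by measurable
  have Km: "(\<lambda>z. K (fst z) (snd z)) \<in> borel_measurable (P \<Otimes>\<^sub>M ?P\<nu>)"
    unfolding K_def by measurable
  have Im: "(\<lambda>z. LR_inv n (W (fst z)) (snd z) * indicator B (fst z)) \<in> borel_measurable (P \<Otimes>\<^sub>M ?P\<nu>)"
    by measurable
  have sg: "sets (P \<Otimes>\<^sub>M P0 n) = sets (P \<Otimes>\<^sub>M ?P\<nu>)" by (intro sets_pair_measure_cong sets_P0 refl)
  have Km': "case_prod K \<in> borel_measurable (P \<Otimes>\<^sub>M P0 n)"
    using Km by (simp add: case_prod_unfold measurable_cong_sets[OF sg refl])
  have Im': "(\<lambda>(\<omega>, X). LR_inv n (W \<omega>) X * indicator B \<omega>) \<in> borel_measurable (P \<Otimes>\<^sub>M P0 n)"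
    using Im by (simp add: case_prod_unfold measurable_cong_sets[OF sg refl])
  have Ym [measurable]: "Y \<in> borel_measurable (P0 n)"
    unfolding Y_def[abs_def]
    using P.borel_measurable_nn_integral[of "\<lambda>X \<omega>. LR_inv n (W \<omega>) X * indicator B \<omega>" "P0 n"] measurable_pair_swap[OF Im']
    by (simp add: case_prod_unfold)
  have Nm [measurable]: "N \<in> borel_measurable (P0 n)"
    unfolding N_def[abs_def]
    using P.borel_measurable_nn_integral[of "\<lambda>X \<omega>. K \<omega> X" "P0 n"] measurable_pair_swap[OF Km']
    by (simp add: case_prod_unfold)
  have EY: "(\<integral>\<^sup>+X. Y X \<partial>P0 n) \<le> ennreal (b * exp (16 * real n * \<delta>\<^sup>2))"
  proof -
    have "(\<integral>\<^sup>+X. Y X \<partial>P0 n) = (\<integral>\<^sup>+\<omega>. (\<integral>\<^sup>+X. LR_inv n (W \<omega>) X * indicator B \<omega> \<partial>P0 n) \<partial>P)"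
      unfolding Y_def by (rule pr.Fubini'[OF Im'])
    also have "\<dots> \<le> (\<integral>\<^sup>+\<omega>. ennreal (exp (16 * real n * \<delta>\<^sup>2)) * indicator B \<omega> \<partial>P)"
    proof (rule nn_integral_mono)
      fix \<omega>
      show "(\<integral>\<^sup>+X. LR_inv n (W \<omega>) X * indicator B \<omega> \<partial>P0 n) \<le> ennreal (exp (16 * real n * \<delta>\<^sup>2)) * indicator B \<omega>"
      proof (cases "\<omega> \<in> B")
        case True
        then have d: "norm (W \<omega> - w) < \<delta>" by (simp add: B_def)
        then have "(norm (W \<omega> - w))\<^sup>2 \<le> \<delta>\<^sup>2" by (intro power_mono) auto
        then have "real n * (16 * (norm (W \<omega> - w))\<^sup>2) \<le> 16 * real n * \<delta>\<^sup>2"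
          using mult_left_mono[of "(norm (W \<omega> - w))\<^sup>2" "\<delta>\<^sup>2" "16 * real n"] by (simp add: mult_ac)
        then have "ennreal (exp (real n * (16 * (norm (W \<omega> - w))\<^sup>2))) \<le> ennreal (exp (16 * real n * \<delta>\<^sup>2))"
          by (intro ennreal_leI) simp
        then show ?thesis using nn_integral_LR_inv[of "W \<omega>" n] d \<delta> True by (auto intro: order_trans)
      qed simp
    qed
    also have "\<dots> = ennreal (b * exp (16 * real n * \<delta>\<^sup>2))"
      by (subst nn_integral_cmult_indicator) (simp_all add: P.emeasure_eq_measure b_def ennreal_mult mult_ac)
    finally show ?thesis .
  qed
  have EN: "(\<integral>\<^sup>+X. N X \<partial>P0 n) \<le> ennreal (exp (- (real n * \<rho>\<^sup>2 / 32)) + q)"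
  proof -
    have "(\<integral>\<^sup>+X. N X \<partial>P0 n) = (\<integral>\<^sup>+\<omega>. (\<integral>\<^sup>+X. K \<omega> X \<partial>P0 n) \<partial>P)"
      unfolding N_def by (rule pr.Fubini'[OF Km'])
    also have "\<dots> \<le> (\<integral>\<^sup>+\<omega>. ennreal (exp (- (real n * \<rho>\<^sup>2 / 32))) + indicator {\<omega> \<in> space P. W \<omega> \<notin> \<Theta>} \<omega> \<partial>P)"
    proof (rule nn_integral_mono)
      fix \<omega> assume \<omega>: "\<omega> \<in> space P"
      consider "W \<omega> \<notin> \<Theta>" | "W \<omega> \<in> \<Theta>" "\<not> far \<rho> (W \<omega>)" | "W \<omega> \<in> \<Theta>" "far \<rho> (W \<omega>)" by blast
      then show "(\<integral>\<^sup>+X. K \<omega> X \<partial>P0 n) \<le> ennreal (exp (- (real n * \<rho>\<^sup>2 / 32))) + indicator {\<omega> \<in> space P. W \<omega> \<notin> \<Theta>} \<omega>"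
      proof cases
        case 1
        then have "(\<integral>\<^sup>+X. K \<omega> X \<partial>P0 n) = 1" using \<omega> by (simp add: K_def nn_integral_LR)
        then show ?thesis using 1 \<omega> by simp
      next
        case 2
        then have "(\<integral>\<^sup>+X. K \<omega> X \<partial>P0 n) = 0" using \<omega> by (simp add: K_def)
        then show ?thesis by simp
      next
        case 3
        obtain d where d: "d \<in> D" "norm (W \<omega> - d) < s" using net[OF 3(1)] by blast
        have s2: "(norm (W \<omega> - d))\<^sup>2 \<le> s\<^sup>2" using d(2) by (intro power_mono) auto
        have "\<rho> < sqrt (hell2 (W \<omega>) w)" using 3(2) by (simp add: far_def)
        then have "\<rho>\<^sup>2 < (sqrt (hell2 (W \<omega>) w))\<^sup>2" using \<rho> by (intro power_strict_mono) auto
        then have "\<rho>\<^sup>2 < hell2 (W \<omega>) w" by (simp add: hell2_nonneg)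
        also have "\<dots> \<le> 2 * hell2 (W \<omega>) d + 2 * hell2 d w" by (rule hell2_triangle)
        also have "hell2 (W \<omega>) d \<le> 16 * (norm (W \<omega> - d))\<^sup>2" using d(2) s(1) by (intro hell2_le_norm) simp
        finally have h: "\<rho>\<^sup>2 < 32 * s\<^sup>2 + 2 * hell2 d w" using s2 by linarith
        \<comment> \<open>32 s^2 is at most rho^2/16, so 2 hell2 d w exceeds 15/16 rho^2.\<close>
        then have h4: "\<rho>\<^sup>2 / 4 \<le> hell2 d w" using s(2) zero_le_power2[of s] by linarith
        then have dD': "d \<in> D'" using d by (simp add: D'_def)
        have "(\<integral>\<^sup>+X. K \<omega> X \<partial>P0 n) \<le> (\<integral>\<^sup>+X. LR n (W \<omega>) X * indicator {X. LR_sqrt n d X < 1} X \<partial>P0 n)"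
          using 3 dD' \<omega> by (intro nn_integral_mono) (auto simp: K_def Acc_def indicator_def)
        also have "\<dots> \<le> ennreal (exp (real n * (16 * (norm (W \<omega> - d))\<^sup>2 - hell2 d w / 4)))"
          using d(2) s(1) by (intro nn_integral_LR_accept) simp
        also have "\<dots> \<le> ennreal (exp (- (real n * \<rho>\<^sup>2 / 32)))"
        proof (intro ennreal_leI iffD2[OF exp_le_cancel_iff])
          \<comment> \<open>This step needs the constant 512: 16 s^2 is at most rho^2/32, while a
            quarter of hell2 d w is at least rho^2/16.\<close>
          have "16 * (norm (W \<omega> - d))\<^sup>2 - hell2 d w / 4 \<le> - (\<rho>\<^sup>2 / 32)"
            using s2 s(2) h4 by linarith
          then have "real n * (16 * (norm (W \<omega> - d))\<^sup>2 - hell2 d w / 4) \<le> real n * - (\<rho>\<^sup>2 / 32)"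
            by (intro mult_left_mono) auto
          then show "real n * (16 * (norm (W \<omega> - d))\<^sup>2 - hell2 d w / 4) \<le> - (real n * \<rho>\<^sup>2 / 32)" by simp
        qed
        finally show ?thesis by (simp add: add_increasing2)
      qed
    qed
    also have "\<dots> = ennreal (exp (- (real n * \<rho>\<^sup>2 / 32)) + q)"
      by (subst nn_integral_add) (auto simp: P.prob_space P.emeasure_eq_measure q_def ennreal_plus)
    finally show ?thesis .
  qed
  \<comment> \<open>The exponent 32 exceeds the 16 in the mean of \<open>Y\<close>, so Markov's
    inequality leaves an error with exponent 16. Off \<open>Bad1\<close>, Cauchy-Schwarz turns
    \<open>c1 * Y X\<close> below 1 into evidence at least \<open>L\<close>.\<close>
  define c1 where "c1 = exp (- (32 * real n * \<delta>\<^sup>2)) / b"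
  define c3 where "c3 = 1 / (a * L)"
  have c: "0 \<le> c1" "0 \<le> c3" using b a L by (auto simp: c1_def c3_def)
  define Bad1 where "Bad1 = {X \<in> space (P0 n). 1 \<le> ennreal c1 * Y X}"
  define Bad2 where "Bad2 d = {X \<in> space (P0 n). 1 \<le> ennreal 1 * LR_sqrt n d X}" for d
  define Bad3 where "Bad3 = {X \<in> space (P0 n). 1 \<le> ennreal c3 * N X}"
  have m [measurable]: "Bad1 \<in> sets (P0 n)" "Bad3 \<in> sets (P0 n)" "Bad2 d \<in> sets (P0 n)" for d
    unfolding Bad1_def Bad2_def Bad3_def by measurable
  have b1: "measure (P0 n) Bad1 \<le> exp (- 16 * real n * \<delta>\<^sup>2)"
  proof -
    have "measure (P0 n) Bad1 \<le> c1 * (b * exp (16 * real n * \<delta>\<^sup>2))"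
      unfolding Bad1_def using b by (intro markov EY c Ym) auto
    also have "\<dots> = exp (- (32 * real n * \<delta>\<^sup>2) + 16 * real n * \<delta>\<^sup>2)" using b by (simp add: c1_def exp_add[symmetric])
    also have "- (32 * real n * \<delta>\<^sup>2) + 16 * real n * \<delta>\<^sup>2 = - 16 * real n * \<delta>\<^sup>2" by simp
    finally show ?thesis .
  qed
  have b2: "measure (P0 n) (\<Union>d\<in>D'. Bad2 d) \<le> real (card D) * exp (- (real n * \<rho>\<^sup>2 / 8))"
  proof -
    have "measure (P0 n) (\<Union>d\<in>D'. Bad2 d) \<le> (\<Sum>d\<in>D'. measure (P0 n) (Bad2 d))"
      by (rule measure_UNION_le[OF D'(1)]) auto
    also have "\<dots> \<le> (\<Sum>d\<in>D'. exp (- (real n * \<rho>\<^sup>2 / 8)))"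
    proof (rule sum_mono)
      fix d assume "d \<in> D'"
      then have h: "\<rho>\<^sup>2 / 4 \<le> hell2 d w" by (simp add: D'_def)
      have "measure (P0 n) (Bad2 d) \<le> 1 * exp (real n * - (hell2 d w / 2))"
        unfolding Bad2_def by (intro markov nn_integral_LR_sqrt) auto
      also have "\<dots> \<le> exp (- (real n * \<rho>\<^sup>2 / 8))"
        using mult_left_mono[OF h, of "real n / 2"] by simp
      finally show "measure (P0 n) (Bad2 d) \<le> exp (- (real n * \<rho>\<^sup>2 / 8))" .
    qed
    also have "\<dots> = real (card D') * exp (- (real n * \<rho>\<^sup>2 / 8))" by simp
    also have "\<dots> \<le> real (card D) * exp (- (real n * \<rho>\<^sup>2 / 8))" using D'(2) by (intro mult_right_mono) auto
    finally show ?thesis .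
  qed
  have b3: "measure (P0 n) Bad3 \<le> (exp (- (real n * \<rho>\<^sup>2 / 32)) + q) * exp (32 * real n * \<delta>\<^sup>2) / (a * b)"
  proof -
    have "measure (P0 n) Bad3 \<le> c3 * (exp (- (real n * \<rho>\<^sup>2 / 32)) + q)"
      unfolding Bad3_def by (intro markov EN c Nm) (auto simp: q_def intro: add_nonneg_nonneg)
    also have "\<dots> = (exp (- (real n * \<rho>\<^sup>2 / 32)) + q) * exp (32 * real n * \<delta>\<^sup>2) / (a * b)"
      by (simp add: c3_def L_def exp_minus field_simps)
    finally show ?thesis .
  qed
  have good: "measure (posterior (law_of P (\<lambda>\<omega>. pd (W \<omega>))) n X) {\<pi>. hellinger_dist \<nu> \<pi> (pd w) > \<rho>} \<le> a"
    if X: "X \<in> space (P0 n)" and g1: "X \<notin> Bad1" and g2: "X \<notin> (\<Union>d\<in>D'. Bad2 d)" and g3: "X \<notin> Bad3" for X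
  proof -
    define Den where "Den = (\<integral>\<^sup>+\<omega>. LR n (W \<omega>) X \<partial>P)"
    have "ennreal L = ennreal c1 * (ennreal b)\<^sup>2"
      using b by (simp add: L_def c1_def ennreal_power ennreal_mult[symmetric] power2_eq_square)
    also have "\<dots> \<le> ennreal c1 * (Den * Y X)"
      unfolding Den_def Y_def b_def by (intro mult_left_mono evidence_lower_bound X B) auto
    also have "\<dots> = Den * (ennreal c1 * Y X)" by (simp only: mult.left_commute)
    also have "\<dots> \<le> Den * 1" using g1 X by (intro mult_left_mono) (auto simp: Bad1_def not_le)
    finally have LDen: "ennreal L \<le> Den" by simp
    have Acc: "X \<in> Acc" using g2 X by (auto simp: Acc_def Bad2_def not_le)
    have "ennreal c3 * N X \<le> 1" using g3 X by (auto simp: Bad3_def not_le)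
    then have "ennreal (a * L) * (ennreal c3 * N X) \<le> ennreal (a * L) * 1" by (intro mult_left_mono) auto
    moreover have "ennreal (a * L) * ennreal c3 = 1"
      using a L by (subst ennreal_mult[symmetric]) (auto simp: c3_def)
    ultimately have NL: "N X \<le> ennreal (a * L)" by (simp add: mult.assoc[symmetric])
    have "(\<integral>\<^sup>+\<omega>. LR n (W \<omega>) X * indicator {\<omega> \<in> space P. far \<rho> (W \<omega>)} \<omega> \<partial>P) \<le> N X"
      unfolding N_def K_def using Acc by (intro nn_integral_mono) (auto simp: indicator_def)
    also have "\<dots> \<le> ennreal a * ennreal L" using NL a L by (simp add: ennreal_mult)
    also have "\<dots> \<le> ennreal a * Den" by (intro mult_left_mono LDen) simp
    finally have "(\<integral>\<^sup>+\<omega>. LR n (W \<omega>) X * indicator {\<omega> \<in> space P. far \<rho> (W \<omega>)} \<omega> \<partial>P) / Den \<le> ennreal a"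
      using LDen L by (intro divide_le_posI_ennreal) (auto simp: mult.commute intro: less_le_trans[of _ "ennreal L"])
    then have "emeasure (posterior (law_of P (\<lambda>\<omega>. pd (W \<omega>))) n X) {\<pi>. hellinger_dist \<nu> \<pi> (pd w) > \<rho>} \<le> ennreal a"
      unfolding emeasure_posterior[OF X] Den_def .
    then show ?thesis using a unfolding measure_def by (intro enn2real_leI) auto
  qed
  have "measure (P0 n) {X \<in> space (P0 n). measure (posterior (law_of P (\<lambda>\<omega>. pd (W \<omega>))) n X) {\<pi>. hellinger_dist \<nu> \<pi> (pd w) > \<rho>} > a}
     \<le> measure (P0 n) (Bad1 \<union> (\<Union>d\<in>D'. Bad2 d) \<union> Bad3)"
  proof (rule P0.finite_measure_mono)
    show "Bad1 \<union> (\<Union>d\<in>D'. Bad2 d) \<union> Bad3 \<in> sets (P0 n)"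
      by (intro sets.Un sets.finite_UN m D'(1))
    show "{X \<in> space (P0 n). measure (posterior (law_of P (\<lambda>\<omega>. pd (W \<omega>))) n X) {\<pi>. hellinger_dist \<nu> \<pi> (pd w) > \<rho>} > a}
      \<subseteq> Bad1 \<union> (\<Union>d\<in>D'. Bad2 d) \<union> Bad3" using good by (auto simp: not_le[symmetric])
  qed
  also have "\<dots> \<le> measure (P0 n) (Bad1 \<union> (\<Union>d\<in>D'. Bad2 d)) + measure (P0 n) Bad3"
    by (intro measure_Un_le sets.Un sets.finite_UN m D'(1))
  also have "measure (P0 n) (Bad1 \<union> (\<Union>d\<in>D'. Bad2 d)) \<le> measure (P0 n) Bad1 + measure (P0 n) (\<Union>d\<in>D'. Bad2 d)"
    by (intro measure_Un_le sets.finite_UN m D'(1))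
  finally show ?thesis using b1 b2 b3 unfolding b_def B_def q_def by linarith
qed

end

section \<open>The contraction rate\<close>

context p_exp_prior begin

abbreviation "small_ball \<epsilon> \<equiv> prob {\<omega> \<in> space P. norm (W \<omega>) \<le> \<epsilon>}"

text \<open>Dropping the infimum, which is nonnegative, gives the first bound. For the second, the
  shift inequality at a nearly optimal h multiplies exp(-|h|_Z^p / p) by the small ball mass, and
  this product is nearly the exponential of minus the concentration function. The distance from h to
  w raises the radius from 2 eps to 3 eps.\<close>

lemma concentration_function_bounds:
  assumes \<epsilon>: "0 < \<epsilon>" and t: "0 < t"
    and le: "concentration_function p \<gamma> \<psi> (distr P borel W) w \<epsilon> \<le> ereal t"
  shows "exp (- t) \<le> small_ball \<epsilon>" "exp (- (2 * t)) \<le> prob {\<omega> \<in> space P. norm (W \<omega> - w) < 3 * \<epsilon>}"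
proof -
  define b where "b = small_ball \<epsilon>"
  define I where "I = (INF h\<in>{h \<in> Z_space p \<gamma> \<psi>. norm (h - w) \<le> \<epsilon>}. ereal (1 / p * Z_norm p \<gamma> \<psi> h powr p))"
  have mb: "measure (distr P borel W) (cball 0 \<epsilon>) = b"
    unfolding b_def by (subst measure_distr) (auto intro!: arg_cong[of _ _ prob])
  have I0: "0 \<le> I" unfolding I_def using p by (intro INF_greatest) simp
  have bpos: "0 < b"
  proof (rule ccontr)
    assume "\<not> 0 < b"
    then have "b = 0" by (simp add: b_def zero_less_measure_iff)
    then have "I + \<infinity> \<le> ereal t" using le by (simp add: concentration_function_def mb I_def[symmetric])
    then show False using I0 by (cases I) auto
  qed
  have le': "I + ereal (- ln b) \<le> ereal t"
    using le bpos unfolding concentration_function_def mb I_def[symmetric] by simp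
  then have "ereal (- ln b) \<le> ereal t" using I0 by (metis add_0 add_right_mono order_trans)
  then have "- t \<le> ln b" by simp
  then have "exp (- t) \<le> exp (ln b)" by (simp only: exp_le_cancel_iff)
  then have "exp (- t) \<le> b" by (simp only: exp_ln[OF bpos])
  then show "exp (- t) \<le> small_ball \<epsilon>" by (simp only: b_def)
  have "I \<le> ereal (t + ln b)" using le' by (cases I) auto
  \<comment> \<open>The infimum need not be attained; spending another t makes the inequality strict
    and yields an h.\<close>
  also have "\<dots> < ereal (2 * t + ln b)" using t by simp
  finally have "I < ereal (2 * t + ln b)" .
  then obtain h where h: "h \<in> Z_space p \<gamma> \<psi>" "norm (h - w) \<le> \<epsilon>"
    and hz: "1 / p * Z_norm p \<gamma> \<psi> h powr p < 2 * t + ln b"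
    unfolding I_def INF_less_iff by auto
  have "1 / p * Z_sum p \<gamma> \<psi> h < 2 * t + ln b" using hz h(1) p by (simp add: Z_norm_powr)
  then have "exp (- (2 * t) - ln b) \<le> exp (- (Z_sum p \<gamma> \<psi> h / p))" by simp
  then have "exp (- (2 * t) - ln b) * b \<le> exp (- (Z_sum p \<gamma> \<psi> h / p)) * b" using bpos by (intro mult_right_mono) auto
  also have "\<dots> \<le> prob {\<omega> \<in> space P. norm (W \<omega> - h) < 2 * \<epsilon>}" unfolding b_def by (rule prob_shift[OF h(1) \<epsilon>])
  also have "\<dots> \<le> prob {\<omega> \<in> space P. norm (W \<omega> - w) < 3 * \<epsilon>}"
  proof (rule finite_measure_mono)
    have "norm (W \<omega> - w) < 3 * \<epsilon>" if "norm (W \<omega> - h) < 2 * \<epsilon>" for \<omega>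
      using norm_triangle_ineq[of "W \<omega> - h" "h - w"] that h(2) by simp
    then show "{\<omega> \<in> space P. norm (W \<omega> - h) < 2 * \<epsilon>} \<subseteq> {\<omega> \<in> space P. norm (W \<omega> - w) < 3 * \<epsilon>}" by auto
  qed measurable
  finally show "exp (- (2 * t)) \<le> prob {\<omega> \<in> space P. norm (W \<omega> - w) < 3 * \<epsilon>}"
    using bpos by (simp add: exp_diff)
qed

text \<open>The approximation hypothesis is only available for \<open>Q\<close>-balls of the given radius \<open>a\<close>; larger balls
  are reached by homogeneity, at the price of a proportionally larger approximation error.\<close>

lemma sieve_net:
  assumes \<epsilon>: "0 < \<epsilon>" and b: "0 < small_ball \<epsilon>" and A: "0 < A" and a: "0 \<le> a" and R: "0 \<le> R" "R \<le> (A * a)\<^sup>2"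
    and approx: "\<And>h. h \<in> Q_space \<gamma> \<psi> \<Longrightarrow> Q_norm \<gamma> \<psi> h \<le> a \<Longrightarrow> \<exists>x\<in>Z_space p \<gamma> \<psi>. norm (x - h) \<le> \<epsilon> \<and> Z_sum p \<gamma> \<psi> x \<le> T"
  obtains D where "finite D" "real (card D) \<le> exp (2 * (A powr p * T + R) / p) / small_ball \<epsilon>"
    "\<And>v. v \<in> sieve R (2 * \<epsilon>) \<Longrightarrow> \<exists>d\<in>D. norm (v - d) < (6 + A) * \<epsilon>"
proof -
  \<comment> \<open>The factor 2 is that of the quasi-triangle inequality, applied below to the sum
    of a rescaled approximation and z.\<close>
  obtain D where D: "finite D" "real (card D) \<le> exp (2 * (A powr p * T + R) / p) / small_ball \<epsilon>"
    and net: "\<And>z. z \<in> Z_space p \<gamma> \<psi> \<Longrightarrow> Z_sum p \<gamma> \<psi> z \<le> 2 * (A powr p * T + R) \<Longrightarrow> \<exists>d\<in>D. norm (z - d) < 4 * \<epsilon>"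
    using Z_ball_net[OF \<epsilon> b, of "2 * (A powr p * T + R)"] by blast
  show ?thesis
  proof (rule that[OF D])
    fix v assume "v \<in> sieve R (2 * \<epsilon>)"
    then obtain q z where q: "q \<in> Q_space \<gamma> \<psi>" "(Q_norm \<gamma> \<psi> q)\<^sup>2 \<le> R" and z: "z \<in> Z_space p \<gamma> \<psi>" "Z_sum p \<gamma> \<psi> z \<le> R"
      and v: "norm (v - (q + z)) < 2 * \<epsilon>" unfolding sieve_def by blast
    have "(Q_norm \<gamma> \<psi> q)\<^sup>2 \<le> (A * a)\<^sup>2" using q(2) R(2) by simp
    then have "\<bar>Q_norm \<gamma> \<psi> q\<bar> \<le> \<bar>A * a\<bar>" by (simp only: abs_le_square_iff)
    then have "Q_norm \<gamma> \<psi> q \<le> A * a" using A a by simp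
    then have "\<bar>1 / A\<bar> * Q_norm \<gamma> \<psi> q \<le> a" using A by (simp add: field_simps)
    then obtain x where x: "x \<in> Z_space p \<gamma> \<psi>" "norm (x - (1 / A) *\<^sub>R q) \<le> \<epsilon>" "Z_sum p \<gamma> \<psi> x \<le> T"
      using approx[of "(1 / A) *\<^sub>R q"] Q_space_scaleR[OF basis q(1), of "1 / A"] by auto
    define y where "y = A *\<^sub>R x + z"
    have Ax: "A *\<^sub>R x \<in> Z_space p \<gamma> \<psi>" "Z_sum p \<gamma> \<psi> (A *\<^sub>R x) = A powr p * Z_sum p \<gamma> \<psi> x"
      using Z_space_scaleR[OF basis x(1), of A] A by auto
    have y: "y \<in> Z_space p \<gamma> \<psi>" unfolding y_def by (rule Z_space_add[OF basis p Ax(1) z(1)])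
    have "Z_sum p \<gamma> \<psi> y \<le> 2 * (Z_sum p \<gamma> \<psi> (A *\<^sub>R x) + Z_sum p \<gamma> \<psi> z)"
      unfolding y_def by (rule Z_space_add[OF basis p Ax(1) z(1)])
    also have "\<dots> \<le> 2 * (A powr p * T + R)"
      unfolding Ax(2) using x(3) z(2) by (intro mult_left_mono add_mono) auto
    finally obtain d where d: "d \<in> D" "norm (y - d) < 4 * \<epsilon>" using net[OF y] by blast
    have "norm (q - A *\<^sub>R x) = A * norm (x - (1 / A) *\<^sub>R q)"
    proof -
      have "q - A *\<^sub>R x = - (A *\<^sub>R (x - (1 / A) *\<^sub>R q))" using A by (simp add: scaleR_diff_right)
      then show ?thesis using A by (metis abs_of_pos norm_minus_cancel norm_scaleR)
    qed
    also have "\<dots> \<le> A * \<epsilon>" using x(2) A by (intro mult_left_mono) auto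
    finally have qx: "norm (q - A *\<^sub>R x) \<le> A * \<epsilon>" .
    have "v - d = (v - (q + z)) + (q - A *\<^sub>R x) + (y - d)" by (simp add: y_def)
    then have "norm (v - d) \<le> norm (v - (q + z)) + norm (q - A *\<^sub>R x) + norm (y - d)"
      using norm_triangle_ineq[of "(v - (q + z)) + (q - A *\<^sub>R x)" "y - d"]
        norm_triangle_ineq[of "v - (q + z)" "q - A *\<^sub>R x"] by (simp only:)
    \<comment> \<open>2 comes from the sieve, A from the rescaled approximation, 4 from the
      net.\<close>
    also have "\<dots> < (6 + A) * \<epsilon>" using v qx d(2) by (simp add: distrib_right)
    finally show "\<exists>d\<in>D. norm (v - d) < (6 + A) * \<epsilon>" using d(1) by blast
  qed
qed

text \<open>Since the prior has no atom at 0, no rate \<open>\<epsilon>\<^sub>n\<close> can solve the concentration inequality unless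
  \<open>n \<epsilon>\<^sub>n\<^sup>2\<close> tends to infinity.\<close>

lemma rate_tendsto_infinity:
  assumes \<epsilon>: "\<And>n. 1 \<le> n \<Longrightarrow> 0 < \<epsilon> n" and sb: "\<And>n. 1 \<le> n \<Longrightarrow> exp (- (real n * (\<epsilon> n)\<^sup>2)) \<le> small_ball (\<epsilon> n)"
  shows "filterlim (\<lambda>n. real n * (\<epsilon> n)\<^sup>2) at_top sequentially"
  unfolding filterlim_at_top
proof
  fix K :: real
  \<comment> \<open>If \<open>\<epsilon> n\<close> is below c, the small ball bound already forces
    the exponent past K; otherwise n c^2 exceeds K for large n.\<close>
  obtain c where c: "0 < c" "small_ball c < exp (- K)" using small_ball_tendsto[of "exp (- K)"] by auto
  have "eventually (\<lambda>n. K / c\<^sup>2 \<le> real n) sequentially"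
    using filterlim_real_sequentially unfolding filterlim_at_top by blast
  then show "eventually (\<lambda>n. K \<le> real n * (\<epsilon> n)\<^sup>2) sequentially" using eventually_ge_at_top[of 1]
  proof eventually_elim
    fix n :: nat assume n: "K / c\<^sup>2 \<le> real n" "1 \<le> n"
    show "K \<le> real n * (\<epsilon> n)\<^sup>2"
    proof (cases "\<epsilon> n \<le> c")
      case True
      have "small_ball (\<epsilon> n) \<le> small_ball c" using True by (intro finite_measure_mono) auto
      then have "exp (- (real n * (\<epsilon> n)\<^sup>2)) < exp (- K)" using sb[OF n(2)] c(2) by linarith
      then show ?thesis by simp
    next
      case False
      then have "c\<^sup>2 \<le> (\<epsilon> n)\<^sup>2" using c by (intro power_mono) auto
      have "K \<le> real n * c\<^sup>2" using n(1) c by (simp add: pos_divide_le_eq)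
      also have "\<dots> \<le> real n * (\<epsilon> n)\<^sup>2" by (intro mult_left_mono \<open>c\<^sup>2 \<le> (\<epsilon> n)\<^sup>2\<close>) simp
      finally show ?thesis .
    qed
  qed
qed

end

theorem theorem4p1:
  fixes \<nu> :: "'a measure"
    and \<tau> :: "'a topology"
    and J :: "'x::{banach, second_countable_topology} \<Rightarrow> 'a \<Rightarrow> real"
    and \<psi> :: "nat \<Rightarrow> 'x"
    and p :: real
    and \<gamma> :: "nat \<Rightarrow> real"
    and P :: "'w measure"
    and W :: "'w \<Rightarrow> 'x"
    and \<pi>\<^sub>0 :: "'a \<Rightarrow> real"
    and w\<^sub>0 :: 'x
    and f g :: "real \<Rightarrow> real"
    and \<epsilon> \<epsilon>' :: "nat \<Rightarrow> real"
  assumes "finite_measure \<nu>"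
    and "topspace \<tau> = space \<nu>"
    and "Linf_subspace \<nu> J"
    and "schauder_basis \<psi>"
    and "1 \<le> p" and "p \<le> 2"
    and "prob_space P"
    and "p_exponential_element p \<gamma> \<psi> P W"
    and "AE \<omega> in P. continuous_map \<tau> euclideanreal (J (W \<omega>))"
    and "\<pi>\<^sub>0 \<in> borel_measurable \<nu>"
    and "\<forall>x\<in>space \<nu>. 0 < \<pi>\<^sub>0 x"
    and "(\<integral>\<^sup>+x. ennreal (\<pi>\<^sub>0 x) \<partial>\<nu>) = 1"
    and "\<forall>x\<in>space \<nu>. J w\<^sub>0 x = ln (\<pi>\<^sub>0 x)"
    and "w\<^sub>0 \<in> measure_support (distr P borel W)"
    and "\<forall>a>0. 0 < f a" and "mono_on {0<..} f"
    and "\<forall>e>0. 0 < g e" and "antimono_on {0<..} g"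
    and "\<forall>e>0. \<forall>a>0. \<forall>h\<in>Q_space \<gamma> \<psi>. Q_norm \<gamma> \<psi> h \<le> a \<longrightarrow>
           (INF x\<in>{x \<in> Z_space p \<gamma> \<psi>. norm (x - h) \<le> e}. ereal (Z_norm p \<gamma> \<psi> x powr p))
             \<le> ereal (f a * g e powr (1 - p / 2))"
    and "filterlim f at_top at_top"
    and "\<exists>k::nat. f \<in> O[at_top](\<lambda>a. a ^ k)"
    and "\<forall>n\<ge>1. 0 < \<epsilon> n"
    and "\<forall>n\<ge>1. concentration_function p \<gamma> \<psi> (distr P borel W) w\<^sub>0 (\<epsilon> n)
           \<le> ereal (real n * (\<epsilon> n)\<^sup>2)"
    and "\<forall>n\<ge>1. 0 < \<epsilon>' n"
    and "(\<lambda>n. f (sqrt (real n) * \<epsilon> n) * g (\<epsilon> n) powr (1 - p / 2)) \<in> O(\<lambda>n. real n * (\<epsilon>' n)\<^sup>2)"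
  shows "\<exists>M\<^sub>0>0. \<forall>M\<ge>M\<^sub>0.
           tendsto_zero_in_prob (sample_law \<nu> \<pi>\<^sub>0)
             (\<lambda>n X. measure (posterior (law_of P (\<lambda>\<omega>. exp_normalized \<nu> (J (W \<omega>)))) n X)
                      {\<pi>. hellinger_dist \<nu> \<pi> \<pi>\<^sub>0 > M * max (\<epsilon> n) (\<epsilon>' n)})"
proof -
  interpret \<nu>: finite_measure \<nu> by fact
  interpret prior: p_exp_prior P p \<gamma> \<psi> W
    using assms(4-8) by (simp add: p_exp_prior_def p_exp_prior_axioms_def)
  interpret posterior_model \<nu> J P W w\<^sub>0
  proof (intro posterior_model.intro density_model.intro density_model_axioms.intro posterior_model_axioms.intro)
    show "finite_measure \<nu>" "prob_space P" "Linf_subspace \<nu> J" by fact+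
    show "0 < measure \<nu> (space \<nu>)"
    proof (rule ccontr)
      assume "\<not> ?thesis"
      then have "emeasure \<nu> (space \<nu>) = 0" by (simp add: \<nu>.emeasure_eq_measure zero_less_measure_iff)
      then have "AE x in \<nu>. False" by (intro AE_I[of _ _ "space \<nu>"]) auto
      then have "(\<integral>\<^sup>+x. ennreal (\<pi>\<^sub>0 x) \<partial>\<nu>) = 0" by (subst nn_integral_0_iff_AE) (use assms(10) in auto)
      then show False using assms(12) by simp
    qed
    show "W \<in> borel_measurable P" by (rule prior.W_measurable)
  qed
  \<comment> \<open>The exponential of \<open>J w\<^sub>0\<close> is already a probability density,
    so its normalizing constant is 1.\<close>
  have \<pi>0: "\<pi>\<^sub>0 x = pd w\<^sub>0 x" if x: "x \<in> space \<nu>" for x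
  proof -
    have e: "exp (J w\<^sub>0 y) = \<pi>\<^sub>0 y" if "y \<in> space \<nu>" for y using assms(11,13) that by simp
    have "normalizer w\<^sub>0 = (\<integral>y. \<pi>\<^sub>0 y \<partial>\<nu>)"
      unfolding normalizer_def by (intro Bochner_Integration.integral_cong e refl)
    also have "\<dots> = enn2real (\<integral>\<^sup>+y. ennreal (\<pi>\<^sub>0 y) \<partial>\<nu>)"
      using assms(10,11) by (intro integral_eq_nn_integral) (auto intro!: AE_I2 less_imp_le)
    finally show ?thesis using e[OF x] by (simp add: pd_eq assms(12))
  qed
  have sample: "sample_law \<nu> \<pi>\<^sub>0 n = P0 n" for n
  proof -
    have "density \<nu> (\<lambda>x. ennreal (\<pi>\<^sub>0 x)) = \<nu>0"
      using assms(10) by (intro density_cong) (auto intro!: AE_I2 simp: \<pi>0)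
    then show ?thesis by (simp add: sample_law_def)
  qed
  have hell: "hellinger_dist \<nu> \<pi> \<pi>\<^sub>0 = hellinger_dist \<nu> \<pi> (pd w\<^sub>0)" for \<pi>
    unfolding hellinger_dist_def by (intro arg_cong[of _ _ sqrt] Bochner_Integration.integral_cong) (auto simp: \<pi>0)
  define post where "post n X \<rho> = measure (posterior (law_of P (\<lambda>\<omega>. pd (W \<omega>))) n X) {\<pi>. hellinger_dist \<nu> \<pi> (pd w\<^sub>0) > \<rho>}" for n X \<rho>
  define t where "t n = real n * (\<epsilon> n)\<^sup>2" for n
  have \<epsilon>: "0 < \<epsilon> n" "0 < \<epsilon>' n" "0 < t n" if "1 \<le> n" for n
    using assms(22,24) that by (auto simp: t_def)
  have conc: "exp (- t n) \<le> prior.small_ball (\<epsilon> n)"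
    "exp (- (2 * t n)) \<le> prior.prob {\<omega> \<in> space P. norm (W \<omega> - w\<^sub>0) < 3 * \<epsilon> n}" if "1 \<le> n" for n
    using prior.concentration_function_bounds[OF \<epsilon>(1,3)[OF that]] assms(23) that by (auto simp: t_def)
  have t_top: "filterlim t at_top sequentially"
    unfolding t_def using prior.rate_tendsto_infinity \<epsilon> conc(1) unfolding t_def by blast
  define F where "F n = f (sqrt (real n) * \<epsilon> n) * g (\<epsilon> n) powr (1 - p / 2)" for n
  obtain L where L: "0 < L" and evL: "eventually (\<lambda>n. norm (F n) \<le> L * norm (real n * (\<epsilon>' n)\<^sup>2)) sequentially"
    using landau_o.bigE[OF assms(25)] unfolding F_def by blast
  \<comment> \<open>With 300 t in the concentration inequality, the prior mass outside the sieve is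
    at most exp(-299 t), one t going to the small ball mass. This has to outweigh 288 t from the
    evidence bound at delta = 3 eps (32 times 9) and 2 t from the prior mass near
    \<open>w\<^sub>0\<close>.\<close>
  define C where "C = 300 / prior.k\<^sub>0"
  have C: "0 < C" using prior.k0_pos by (simp add: C_def)
  \<comment> \<open>The Q-radius sqrt(C t n) of the sieve is A times sqrt(n) eps, the radius at
    which the rate condition evaluates \<open>f\<close>.\<close>
  define A where "A = sqrt C"
  have A: "0 < A" "A\<^sup>2 = C" using C by (auto simp: A_def)
  \<comment> \<open>With eta the larger of the two rates, K n eta^2 bounds the exponent of the net
    coming from the Z-ball; the small ball mass will add one more n eta^2.\<close>
  define K where "K = 2 * (A powr p * (2 * L) + C)"
  have K: "0 < K" using L C A by (auto simp: K_def intro!: add_nonneg_pos)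
  \<comment> \<open>The first summand makes M eta >= 2 when eta is large, meets 512 s^2 <= rho^2 for
    s = (6 + A) eps, and gives M >= 600. The rest lets n rho^2 / 8 outweigh the entropy.\<close>
  define M\<^sub>0 where "M\<^sub>0 = 100 * (6 + A) + K + 2"
  have main: "measure (P0 n) {X \<in> space (P0 n). post n X (M * max (\<epsilon> n) (\<epsilon>' n)) > a} \<le> (2 + 2 / a) * exp (- t n)"
    if M: "M\<^sub>0 \<le> M" and a: "0 < a" and n: "1 \<le> n" and nL: "norm (F n) \<le> L * norm (real n * (\<epsilon>' n)\<^sup>2)" for M a n
  proof -
    define \<eta> where "\<eta> = max (\<epsilon> n) (\<epsilon>' n)"
    have \<eta>: "0 < \<eta>" "\<epsilon> n \<le> \<eta>" "\<epsilon>' n \<le> \<eta>" using \<epsilon>[OF n] by (auto simp: \<eta>_def)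
    have M1: "600 \<le> M" "K + 2 \<le> M" "100 * (6 + A) \<le> M" using M A K by (auto simp: M\<^sub>0_def)
    show ?thesis
    \<comment> \<open>The likelihood estimates work for distances up to 1/2. If (6 + A) eta is at
      least 1/2, then M eta >= 2 exceeds every Hellinger distance.\<close>
    proof (cases "1 / (2 * (6 + A)) \<le> \<eta>")
      case True
      have "2 \<le> 100 * (6 + A) * (1 / (2 * (6 + A)))" using A by (simp add: field_simps)
      also have "\<dots> \<le> M * \<eta>" using M1 True A \<eta> by (intro mult_mono) auto
      finally have M2: "2 \<le> M * \<eta>" .
      have "\<not> far (M * \<eta>) v" for v
      proof -
        have "sqrt (hell2 v w\<^sub>0) \<le> sqrt (2\<^sup>2)" using hell2_le_2[of v w\<^sub>0] by (intro real_sqrt_le_mono) simp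
        then show ?thesis using M2 by (simp add: far_def)
      qed
      then have "post n X (M * \<eta>) = 0" if "X \<in> space (P0 n)" for X
        unfolding post_def measure_def emeasure_posterior[OF that] by simp
      then have empty: "{X \<in> space (P0 n). post n X (M * \<eta>) > a} = {}" using a by auto
      show ?thesis using a unfolding \<eta>_def[symmetric] empty by simp
    next
      case False
      define e where "e = \<epsilon> n"
      have e: "0 < e" "e \<le> \<eta>" using \<epsilon>[OF n] \<eta> by (auto simp: e_def)
      have e_small: "(6 + A) * e \<le> 1 / 2"
      proof -
        have "(6 + A) * e \<le> (6 + A) * (1 / (2 * (6 + A)))" using False e A by (intro mult_left_mono) auto
        also have "\<dots> = 1 / 2" using A by simp
        finally show ?thesis .
      qed
      moreover have "3 * e \<le> (6 + A) * e" using A e by (intro mult_right_mono) auto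
      ultimately have e_small2: "3 * e \<le> 1 / 2" by (rule order_trans[rotated])
      have nn: "0 < real n" using n by simp
      have tn: "t n = real n * e\<^sup>2" by (simp add: t_def e_def)
      have t\<eta>: "t n \<le> real n * \<eta>\<^sup>2" unfolding tn using e by (intro mult_left_mono power_mono) auto
      have b: "0 < prior.small_ball e" using conc(1)[OF n] unfolding e_def by (meson exp_gt_zero less_le_trans)
      \<comment> \<open>The factor 2 makes \<open>F n\<close> strictly smaller than T, so that a
        point with value below T can be taken from the infimum.\<close>
      define T where "T = 2 * L * (real n * \<eta>\<^sup>2)"
      have T: "F n < T" "0 < T"
      proof -
        have "F n \<le> L * (real n * (\<epsilon>' n)\<^sup>2)" using nL by simp
        also have "\<dots> \<le> L * (real n * \<eta>\<^sup>2)" using L \<eta> \<epsilon>[OF n] by (intro mult_left_mono power_mono) auto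
        also have "\<dots> < T" using L \<eta> nn by (simp add: T_def)
        finally show "F n < T" .
        show "0 < T" using L \<eta> nn by (simp add: T_def)
      qed
      define aa where "aa = sqrt (real n) * e"
      have aa: "0 < aa" using nn e by (simp add: aa_def)
      have approx: "\<exists>x\<in>Z_space p \<gamma> \<psi>. norm (x - h) \<le> e \<and> Z_sum p \<gamma> \<psi> x \<le> T"
        if h: "h \<in> Q_space \<gamma> \<psi>" "Q_norm \<gamma> \<psi> h \<le> aa" for h
      proof -
        have "(INF x\<in>{x \<in> Z_space p \<gamma> \<psi>. norm (x - h) \<le> e}. ereal (Z_norm p \<gamma> \<psi> x powr p)) \<le> ereal (f aa * g e powr (1 - p / 2))"
          using assms(19) e(1) aa h by blast
        also have "\<dots> < ereal T" using T by (simp add: F_def aa_def e_def)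
        finally obtain x where x: "x \<in> Z_space p \<gamma> \<psi>" "norm (x - h) \<le> e" "Z_norm p \<gamma> \<psi> x powr p < T"
          unfolding INF_less_iff by auto
        then show ?thesis using assms(5) by (intro bexI[of _ x]) (auto simp: Z_norm_powr)
      qed
      define R where "R = C * t n"
      have R: "0 \<le> R" "R \<le> (A * aa)\<^sup>2"
        using C \<epsilon>(3)[OF n] nn by (auto simp: R_def tn aa_def power_mult_distrib A(2))
      obtain D where D: "finite D" "real (card D) \<le> exp (2 * (A powr p * T + R) / p) / prior.small_ball e"
        and net: "\<And>v. v \<in> prior.sieve R (2 * e) \<Longrightarrow> \<exists>d\<in>D. norm (v - d) < (6 + A) * e"
        using prior.sieve_net[OF e(1) b A(1) less_imp_le[OF aa] R approx] by blast
      have cardD: "real (card D) \<le> exp ((K + 1) * (real n * \<eta>\<^sup>2))"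
      proof -
        have "2 * (A powr p * T + R) \<le> K * (real n * \<eta>\<^sup>2)"
        proof -
          have "R \<le> C * (real n * \<eta>\<^sup>2)" unfolding R_def using C t\<eta> by (intro mult_left_mono) auto
          then show ?thesis by (simp add: K_def T_def algebra_simps)
        qed
        moreover have "0 \<le> A powr p * T + R" using T R by (intro add_nonneg_nonneg mult_nonneg_nonneg) auto
        then have "2 * (A powr p * T + R) / p \<le> 2 * (A powr p * T + R) / 1"
          using assms(5) by (intro divide_left_mono) auto
        ultimately have "2 * (A powr p * T + R) / p \<le> K * (real n * \<eta>\<^sup>2)" by linarith
        then have "exp (2 * (A powr p * T + R) / p) / prior.small_ball e \<le> exp (K * (real n * \<eta>\<^sup>2)) / exp (- t n)"
          using conc(1)[OF n] by (intro frac_le) (auto simp: e_def)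
        also have "\<dots> = exp (K * (real n * \<eta>\<^sup>2) + t n)" by (simp add: exp_add exp_minus field_simps)
        also have "\<dots> \<le> exp ((K + 1) * (real n * \<eta>\<^sup>2))" using t\<eta> by (simp add: algebra_simps)
        finally show ?thesis using D(2) by simp
      qed
      define PB where "PB = prior.prob {\<omega> \<in> space P. norm (W \<omega> - w\<^sub>0) < 3 * e}"
      have PB: "exp (- (2 * t n)) \<le> PB" "0 < PB"
        using conc(2)[OF n] unfolding PB_def e_def by (auto intro: less_le_trans[OF exp_gt_zero])
      have outside: "prior.prob {\<omega> \<in> space P. W \<omega> \<notin> prior.sieve R (2 * e)} \<le> exp (- (299 * t n))"
      proof -
        define q where "q = prior.prob {\<omega> \<in> space P. W \<omega> \<notin> prior.sieve R (2 * e)}"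
        have "R = 300 * t n / prior.k\<^sub>0" by (simp add: R_def C_def)
        then have "prior.small_ball e * q \<le> exp (- (300 * t n))"
          unfolding q_def using prior.two_level_concentration[OF e(1), of "300 * t n"] by (simp only:)
        moreover have "exp (- t n) * q \<le> prior.small_ball e * q"
          using conc(1)[OF n] by (intro mult_right_mono) (auto simp: e_def q_def)
        ultimately have "exp (- t n) * q \<le> exp (- (300 * t n))" by linarith
        then have "exp (t n) * (exp (- t n) * q) \<le> exp (t n) * exp (- (300 * t n))" by (intro mult_left_mono) auto
        then show ?thesis by (simp add: q_def mult.assoc[symmetric] exp_add[symmetric])
      qed
      define \<rho> where "\<rho> = M * \<eta>"
      have M600: "600 * M \<le> M\<^sup>2" using M1 by (simp add: power2_eq_square)
      have \<rho>2: "\<rho>\<^sup>2 = M\<^sup>2 * \<eta>\<^sup>2" by (simp add: \<rho>_def power_mult_distrib)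
      have s512: "512 * ((6 + A) * e)\<^sup>2 \<le> \<rho>\<^sup>2"
      proof -
        have "512 * ((6 + A) * e)\<^sup>2 \<le> 10000 * ((6 + A) * e)\<^sup>2" by (intro mult_right_mono) auto
        also have "\<dots> = (100 * (6 + A) * e)\<^sup>2" by (simp only: power_mult_distrib) simp
        also have "\<dots> \<le> (M * \<eta>)\<^sup>2" using M1 A e \<eta> by (intro power_mono mult_mono) auto
        finally show ?thesis by (simp add: \<rho>_def)
      qed
      have "measure (P0 n) {X \<in> space (P0 n). post n X \<rho> > a}
        \<le> exp (- 16 * real n * (3 * e)\<^sup>2) + real (card D) * exp (- (real n * \<rho>\<^sup>2 / 8))
        + (exp (- (real n * \<rho>\<^sup>2 / 32)) + prior.prob {\<omega> \<in> space P. W \<omega> \<notin> prior.sieve R (2 * e)}) * exp (32 * real n * (3 * e)\<^sup>2) / (a * PB)"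
        unfolding post_def PB_def
        by (rule posterior_bound[OF _ e_small2 _ prior.sieve_borel D(1) net e_small s512 _ a])
           (use e PB M1 \<eta> in \<open>auto simp: PB_def[symmetric] \<rho>_def\<close>)
      \<comment> \<open>After the loss of 288 + 2 multiples of t n, the exponents 291 and 299 leave
        1 and 9. The exponent 291 is reached because M >= 600 makes M^2/32 at least 291.\<close>
      also have "\<dots> \<le> exp (- t n) + exp (- t n) + (exp (- (291 * t n)) + exp (- (299 * t n))) * exp (288 * t n) / (a * exp (- (2 * t n)))"
      proof (intro add_mono)
        have t0: "0 < t n" by (rule \<epsilon>(3)[OF n])
        have "16 * real n * (3 * e)\<^sup>2 = 144 * t n" by (simp add: tn power_mult_distrib)
        then show "exp (- 16 * real n * (3 * e)\<^sup>2) \<le> exp (- t n)" using t0 by simp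
        have M8: "8 * (K + 2) \<le> M\<^sup>2" 
        proof -
          have "8 * (K + 2) \<le> 8 * M" using M1(2) by simp
          also have "\<dots> \<le> 600 * M" using M1(1) by simp
          finally show ?thesis using M600 by simp
        qed
        have "real (card D) * exp (- (real n * \<rho>\<^sup>2 / 8)) \<le> exp ((K + 1) * (real n * \<eta>\<^sup>2)) * exp (- (real n * \<rho>\<^sup>2 / 8))"
          by (intro mult_right_mono cardD) simp
        also have "\<dots> = exp ((K + 1) * (real n * \<eta>\<^sup>2) - M\<^sup>2 / 8 * (real n * \<eta>\<^sup>2))"
          by (simp add: \<rho>2 exp_add[symmetric])
        also have "\<dots> \<le> exp (- t n)"
        proof (intro iffD2[OF exp_le_cancel_iff])
          have "(K + 2) * (real n * \<eta>\<^sup>2) \<le> M\<^sup>2 / 8 * (real n * \<eta>\<^sup>2)" using M8 by (intro mult_right_mono) auto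
          then show "(K + 1) * (real n * \<eta>\<^sup>2) - M\<^sup>2 / 8 * (real n * \<eta>\<^sup>2) \<le> - t n" using t\<eta> by (simp add: algebra_simps)
        qed
        finally show "real (card D) * exp (- (real n * \<rho>\<^sup>2 / 8)) \<le> exp (- t n)" .
        have M32: "291 * 32 \<le> M\<^sup>2" using M1 M600 by linarith
        have "291 * t n \<le> M\<^sup>2 / 32 * (real n * \<eta>\<^sup>2)" using M32 t\<eta> t0 by (intro mult_mono) auto
        then have "exp (- (real n * \<rho>\<^sup>2 / 32)) \<le> exp (- (291 * t n))" by (simp add: \<rho>2 mult_ac)
        moreover have "32 * real n * (3 * e)\<^sup>2 = 288 * t n" by (simp add: tn power_mult_distrib)
        ultimately show "(exp (- (real n * \<rho>\<^sup>2 / 32)) + prior.prob {\<omega> \<in> space P. W \<omega> \<notin> prior.sieve R (2 * e)}) * exp (32 * real n * (3 * e)\<^sup>2) / (a * PB)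
          \<le> (exp (- (291 * t n)) + exp (- (299 * t n))) * exp (288 * t n) / (a * exp (- (2 * t n)))"
          using outside PB a by (intro frac_le mult_mono add_mono) auto
      qed
      also have "\<dots> = 2 * exp (- t n) + (exp (- t n) + exp (- (9 * t n))) / a"
        using a by (simp add: field_simps exp_add[symmetric] exp_minus)
      also have "\<dots> \<le> 2 * exp (- t n) + (exp (- t n) + exp (- t n)) / a"
        using a \<epsilon>(3)[OF n] by (intro add_left_mono divide_right_mono) auto
      also have "\<dots> = (2 + 2 / a) * exp (- t n)" by (simp add: algebra_simps)
      finally show ?thesis by (simp add: \<rho>_def \<eta>_def)
    qed
  qed
  have "tendsto_zero_in_prob (sample_law \<nu> \<pi>\<^sub>0)
             (\<lambda>n X. measure (posterior (law_of P (\<lambda>\<omega>. exp_normalized \<nu> (J (W \<omega>)))) n X)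
                      {\<pi>. hellinger_dist \<nu> \<pi> \<pi>\<^sub>0 > M * max (\<epsilon> n) (\<epsilon>' n)})" if M: "M\<^sub>0 \<le> M" for M
    unfolding tendsto_zero_in_prob_def
  proof (intro allI impI)
    fix a :: real assume a: "0 < a"
    have exp0: "(\<lambda>n. (2 + 2 / a) * exp (- t n)) \<longlonglongrightarrow> (2 + 2 / a) * 0"
      by (intro tendsto_intros filterlim_compose[OF exp_at_bot] filterlim_compose[OF filterlim_uminus_at_bot_at_top] t_top)
    have "(\<lambda>n. measure (P0 n) {X \<in> space (P0 n). post n X (M * max (\<epsilon> n) (\<epsilon>' n)) > a}) \<longlonglongrightarrow> 0"
    proof (rule tendsto_sandwich[OF _ _ tendsto_const])
      show "eventually (\<lambda>n. measure (P0 n) {X \<in> space (P0 n). post n X (M * max (\<epsilon> n) (\<epsilon>' n)) > a} \<le> (2 + 2 / a) * exp (- t n)) sequentially"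
        using evL eventually_ge_at_top[of 1] by eventually_elim (rule main[OF M a])
      show "(\<lambda>n. (2 + 2 / a) * exp (- t n)) \<longlonglongrightarrow> 0" using exp0 by simp
    qed simp
    then show "(\<lambda>n. measure (sample_law \<nu> \<pi>\<^sub>0 n) {X \<in> space (sample_law \<nu> \<pi>\<^sub>0 n).
        \<bar>measure (posterior (law_of P (\<lambda>\<omega>. exp_normalized \<nu> (J (W \<omega>)))) n X)
                      {\<pi>. hellinger_dist \<nu> \<pi> \<pi>\<^sub>0 > M * max (\<epsilon> n) (\<epsilon>' n)}\<bar> > a}) \<longlonglongrightarrow> 0"
      by (simp add: sample hell post_def)
  qed
  moreover have "0 < M\<^sub>0" using A K by (simp add: M\<^sub>0_def)
  ultimately show ?thesis by blast
qed

end
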